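(* Let $0<s\le t<1$, $2\le p\le q<\infty$, and $\alpha\in(0,1]$ with $tq\le sp+\alpha$. Let $a:\mathbb{R}^d\times\mathbb{R}^d\to\mathbb{R}$ be measurable and satisfy, for all $x,y,z,x_1,x_2,y_1,y_2\in\mathbb{R}^d$: $a(x,y)=a(y,x)$; $a(x+z,y+z)=a(x,y)$; $0\le a(x,y)\le\|a\|_\infty<\infty$; and $|a(x_1,y_1)-a(x_2,y_2)|\le[a]_\alpha(|x_1-x_2|^\alpha+|y_1-y_2|^\alpha)$ with $[a]_\alpha<\infty$. Then any viscosity solution $u$ of $\mathcal{L}u=0$ in $B_2$ satisfies $$u\in C^{0,\gamma}_{\rm loc}(B_2)\qquad\text{for any }\gamma\le\min\left\{1,\frac{sp}{p-1},\frac{tq}{q-1}\right\}.$$ Besides, if $\frac{sp}{p-1}=\max\left\{\frac{sp}{p-1},\frac{tq}{q-1}\right\}<1$, then $u\in C^{0,\frac{sp}{p-1}}_{\rm loc}(B_2)$.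
   Context: $B_r(x_0)=\{x\in\mathbb{R}^d:|x-x_0|<r\}$ and $B_r=B_r(0)$. The operator is $$\mathcal{L}u(x)=\mathrm{P.V.}\int_{\mathbb{R}^d}\left(\frac{|u(x)-u(y)|^{p-2}(u(x)-u(y))}{|x-y|^{d+sp}}+a(x,y)\frac{|u(x)-u(y)|^{q-2}(u(x)-u(y))}{|x-y|^{d+tq}}\right)dy .$$ For $k\ge1$, $\gamma>0$: $L^k_\gamma(\mathbb{R}^d)=\{u:\int_{\mathbb{R}^d}\frac{|u(x)|^k}{(1+|x|)^{d+\gamma}}dx<\infty\}$. Viscosity solutions ($\Omega\subset\mathbb{R}^d$ open): a lower semicontinuous $u\in L^{p-1}_{sp}(\mathbb{R}^d)\cap L^{q-1}_{tq}(\mathbb{R}^d)$ is a viscosity supersolution of $\mathcal{L}u=0$ in $\Omega$ if, whenever $B_r(x_0)\subset\Omega$ and $\psi\in C^2(B_r(x_0))$ satisfy $\psi(x_0)=u(x_0)$ and $\psi\le u$ in $B_r(x_0)$, then $\mathcal{L}\psi_r(x_0)\ge0$, where $\psi_r=\psi$ in $B_r(x_0)$ and $\psi_r=u$ in $\mathbb{R}^d\setminus B_r(x_0)$. $u$ is a viscosity subsolution if $-u$ is a viscosity supersolution, and a viscosity solution if it is both. *)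

theory Defs
  imports "HOL-Analysis.Analysis"
begin

text \<open>The space $L^k_\gamma(\mathbb{R}^d)$. Measurability of \<open>u\<close> itself has to be
  demanded separately, since the integrand only sees \<open>\<bar>u\<bar>\<close>.\<close>

definition tail_space :: "real \<Rightarrow> real \<Rightarrow> ('a::euclidean_space \<Rightarrow> real) set" where
  "tail_space k \<gamma> =
    {u. u \<in> borel_measurable lebesgue \<and>
        integrable lebesgue
          (\<lambda>x. \<bar>u x\<bar> powr k / (1 + norm x) powr (real DIM('a) + \<gamma>))}"

text \<open>The integrals in the principal value are extended-real valued: in the definition of a
  viscosity supersolution the test function is only \<open>C\<^sup>2\<close> in an open ball and may tend to
  \<open>-\<infinity>\<close> at its boundary so fast that the positive part of the integrand is not
  integrable. The operator then takes the value \<open>\<infinity>\<close>. There, for bounded \<open>a \<ge> 0\<close>,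
  the truncated integrals always have finite negative part, so \<open>\<infinity> - \<infinity>\<close>
  (which is \<open>\<infinity>\<close> for \<^typ>\<open>ereal\<close>) does not occur.\<close>

definition ext_set_integral :: "'a::euclidean_space set \<Rightarrow> ('a \<Rightarrow> real) \<Rightarrow> ereal" where
  "ext_set_integral S f =
     enn2ereal (\<integral>\<^sup>+y\<in>S. ennreal (f y) \<partial>lebesgue) -
     enn2ereal (\<integral>\<^sup>+y\<in>S. ennreal (- f y) \<partial>lebesgue)"

definition pv_integral :: "'a::euclidean_space \<Rightarrow> ('a \<Rightarrow> real) \<Rightarrow> ereal" where
  "pv_integral x f =
     Lim (at_right (0::real)) (\<lambda>\<epsilon>. ext_set_integral {y. \<epsilon> < norm (x - y)} f)"

text \<open>At \<open>r = 0\<close> this is \<open>0\<close> also for \<open>m = 2\<close>,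
  although \<open>0 powr 0 = 0\<close> in the library.\<close>

definition signed_pow :: "real \<Rightarrow> real \<Rightarrow> real" where
  "signed_pow m r = \<bar>r\<bar> powr (m - 2) * r"

definition double_phase_op ::
  "real \<Rightarrow> real \<Rightarrow> real \<Rightarrow> real \<Rightarrow> ('a \<Rightarrow> 'a \<Rightarrow> real)
    \<Rightarrow> ('a::euclidean_space \<Rightarrow> real) \<Rightarrow> 'a \<Rightarrow> ereal" where
  "double_phase_op s t p q a u x =
     pv_integral x (\<lambda>y.
       signed_pow p (u x - u y) / norm (x - y) powr (real DIM('a) + s * p) +
       a x y * (signed_pow q (u x - u y) / norm (x - y) powr (real DIM('a) + t * q)))"

text \<open>Twice continuously Frechet differentiable; meant for open \<open>S\<close>.\<close>

definition C2_on :: "'a::euclidean_space set \<Rightarrow> ('a \<Rightarrow> real) \<Rightarrow> bool" where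
  "C2_on S \<psi> \<longleftrightarrow>
    (\<exists>(D1 :: 'a \<Rightarrow> 'a \<Rightarrow>\<^sub>L real) (D2 :: 'a \<Rightarrow> 'a \<Rightarrow>\<^sub>L 'a \<Rightarrow>\<^sub>L real).
       (\<forall>x\<in>S. (\<psi> has_derivative blinfun_apply (D1 x)) (at x)) \<and>
       (\<forall>x\<in>S. (D1 has_derivative blinfun_apply (D2 x)) (at x)) \<and>
       continuous_on S D2)"

definition lsc_on :: "'a::topological_space set \<Rightarrow> ('a \<Rightarrow> real) \<Rightarrow> bool" where
  "lsc_on S u \<longleftrightarrow> (\<forall>x\<in>S. \<forall>c < u x. \<forall>\<^sub>F y in at x within S. c < u y)"

text \<open>Semicontinuity is required in \<open>\<Omega>\<close> only, as is usual for viscosity solutions of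
  nonlocal equations; outside of \<open>\<Omega>\<close> only membership in the tail spaces is assumed.\<close>

definition visc_supersol ::
  "real \<Rightarrow> real \<Rightarrow> real \<Rightarrow> real \<Rightarrow> ('a \<Rightarrow> 'a \<Rightarrow> real)
    \<Rightarrow> 'a::euclidean_space set \<Rightarrow> ('a \<Rightarrow> real) \<Rightarrow> bool" where
  "visc_supersol s t p q a \<Omega> u \<longleftrightarrow>
     lsc_on \<Omega> u \<and>
     u \<in> tail_space (p - 1) (s * p) \<inter> tail_space (q - 1) (t * q) \<and>
     (\<forall>x0 r \<psi>.
        0 < r \<longrightarrow> ball x0 r \<subseteq> \<Omega> \<longrightarrow>
        C2_on (ball x0 r) \<psi> \<longrightarrow> \<psi> x0 = u x0 \<longrightarrow> (\<forall>x\<in>ball x0 r. \<psi> x \<le> u x) \<longrightarrow>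
        0 \<le> double_phase_op s t p q a (\<lambda>x. if x \<in> ball x0 r then \<psi> x else u x) x0)"

definition visc_subsol ::
  "real \<Rightarrow> real \<Rightarrow> real \<Rightarrow> real \<Rightarrow> ('a \<Rightarrow> 'a \<Rightarrow> real)
    \<Rightarrow> 'a::euclidean_space set \<Rightarrow> ('a \<Rightarrow> real) \<Rightarrow> bool" where
  "visc_subsol s t p q a \<Omega> u \<longleftrightarrow> visc_supersol s t p q a \<Omega> (\<lambda>x. - u x)"

definition visc_sol ::
  "real \<Rightarrow> real \<Rightarrow> real \<Rightarrow> real \<Rightarrow> ('a \<Rightarrow> 'a \<Rightarrow> real)
    \<Rightarrow> 'a::euclidean_space set \<Rightarrow> ('a \<Rightarrow> real) \<Rightarrow> bool" where
  "visc_sol s t p q a \<Omega> u \<longleftrightarrow>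
     visc_supersol s t p q a \<Omega> u \<and> visc_subsol s t p q a \<Omega> u"

text \<open>The class $C^{0,\gamma}_{\rm loc}(\Omega)$, for \<open>0 < \<gamma> \<le> 1\<close>. Boundedness on
  compact subsets is implied.\<close>

definition holder_loc :: "real \<Rightarrow> 'a::euclidean_space set \<Rightarrow> ('a \<Rightarrow> real) \<Rightarrow> bool" where
  "holder_loc \<gamma> \<Omega> u \<longleftrightarrow>
     (\<forall>K. compact K \<longrightarrow> K \<subseteq> \<Omega> \<longrightarrow>
        (\<exists>C. \<forall>x\<in>K. \<forall>y\<in>K. \<bar>u x - u y\<bar> \<le> C * norm (x - y) powr \<gamma>))"

end

theory Submission
  imports Defs
begin

text \<open>
  The proof is the method of Ishii and Lions. The invariance of \<open>a\<close> under translations means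
  \<open>a x (x + z) = b z\<close> with an even function \<open>b\<close>, so both phases of the operator are convolution-like:
  they integrate \<open>signed_pow P (u x - u (x + z))\<close> against an even kernel \<open>k z\<close>.
  Fix \<open>x0\<close> and maximise
  \<open>u x - u y - L * \<phi> (norm (x - y)) - m * (norm (x - x0))\<^sup>2\<close>, where \<open>\<phi>\<close> is a concave modulus that
  behaves like \<open>r powr \<gamma>\<close>. If \<open>u\<close> violates the Hoelder bound with constant \<open>L\<close> at \<open>x0\<close>, there is a
  maximum point \<open>(x, y)\<close> with positive value, and \<open>\<delta> = norm (x - y)\<close> satisfies \<open>0 < \<delta>\<close> and
  \<open>L * \<delta> powr \<gamma> \<le> 4 * sup \<bar>u\<bar>\<close>. Testing the equation at \<open>x\<close> from above and at \<open>y\<close> from below, and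
  subtracting, gives an upper bound for the difference of the integrals over \<open>norm z \<ge> \<rho>\<close>, where
  \<open>\<rho> = \<delta> powr (1 + \<theta>') / 4\<close> with a small \<open>\<theta>'\<close>; the integrals over \<open>norm z < \<rho>\<close> see only the smooth test functions
  and are small after symmetrisation (\<open>visc_supersol_far_inequality\<close>).

  On the other hand that difference is large (\<open>phase_difference_lower\<close>). If \<open>z\<close> is close to
  \<open>- (x - y) / 2\<close>, then \<open>x + z\<close> has about half the distance to \<open>y\<close>, and \<open>y + z\<close> about one and a half
  times the distance to \<open>x\<close>; comparing the maximum with its values at \<open>(x + z, y)\<close> and \<open>(x, y + z)\<close> one gains
  \<open>L * (2 * \<phi> \<delta> - \<phi> (\<delta> / 2) - \<phi> (3 * \<delta> / 2))\<close>, which is positive by strict concavity, and this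
  persists on a small ball of such \<open>z\<close>. For the other \<open>z\<close> the
  comparison with \<open>(x + z, y + z)\<close> loses only the increment of the quadratic penalty, or at most
  \<open>K * \<delta> powr \<kappa>\<close> if \<open>u\<close> is already known to be \<open>\<kappa>\<close>-Hoelder. In the region of large \<open>z\<close> the values of
  \<open>u\<close> are not controlled, but there the kernel is \<open>\<alpha>\<close>-Hoelder, and after the substitution
  \<open>w = x + z\<close> the loss is \<open>\<delta> powr \<alpha>\<close>. Up to an arbitrarily small power of \<open>\<delta>\<close> the gain is
  \<open>L powr (P - 1) * \<delta> powr (\<gamma> * (P - 1) - \<sigma>)\<close>. If \<open>\<gamma> \<le> \<sigma> / (P - 1)\<close> and \<open>\<gamma>\<close> exceeds \<open>\<kappa>\<close> only a little,
  the losses are smaller than \<open>\<delta> powr (\<gamma> * (P - 1) - \<sigma>)\<close> by a fixed positive power of \<open>\<delta>\<close>, so a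
  large \<open>L\<close> leads to a contradiction (\<open>key_inequality\<close>, \<open>holder_improvement\<close>). That the loss in the far
  region is a positive power of \<open>\<delta>\<close> is what admits the end-point exponents, including
  \<open>\<gamma> = 1\<close>, where the gain is reduced by a small power of \<open>\<delta>\<close>.

  One application improves \<open>\<kappa>\<close> by a bounded amount only, because the losses are measured with the
  regularity that is already known; finitely many applications, starting from \<open>\<kappa> = 0\<close>, reach the claimed exponent
  (\<open>holder_interior_bootstrap\<close>). The coefficient enters through the alternative \<open>b 0 = 0\<close> or
  \<open>0 < b 0\<close>. If \<open>b 0 = 0\<close>, then \<open>b z \<le> H * norm z powr \<alpha>\<close>, and \<open>t * q \<le> s * p + \<alpha>\<close> makes the kernel of
  the second phase no more singular than that of the first, so that the first phase controls
  everything and \<open>min 1 (s * p / (p - 1))\<close> is reached. If \<open>0 < b 0\<close>, each phase produces a gain of its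
  own that absorbs its own losses, which gives the minimum of both exponents. When
  \<open>s * p / (p - 1)\<close> is the larger one, the regularity \<open>t * q / (q - 1)\<close> obtained in this way turns the
  losses of the second phase outside the small ball into positive powers of \<open>\<delta>\<close>, the gain of the
  first phase absorbs them, and the iteration continues up to \<open>s * p / (p - 1)\<close> (\<open>holder_interior_beyond\<close>).
\<close>


section \<open>The monotone power nonlinearity\<close>

lemma signed_pow_minus [simp]: "signed_pow P (- r) = - signed_pow P r"
  by (simp add: signed_pow_def)

lemma abs_signed_pow: "\<bar>signed_pow P r\<bar> = \<bar>r\<bar> powr (P - 1)"
proof (cases "r = 0")
  case False
  then have "\<bar>r\<bar> powr (P - 2) * \<bar>r\<bar> powr 1 = \<bar>r\<bar> powr (P - 1)"
    by (subst powr_add [symmetric]) simp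
  then show ?thesis using False by (simp add: signed_pow_def abs_mult)
qed (simp add: signed_pow_def)

lemma signed_pow_nonneg: "0 \<le> r \<Longrightarrow> signed_pow P r = r powr (P - 1)"
  using abs_signed_pow [of P r] by (simp add: signed_pow_def)

lemma signed_pow_nonpos: "r \<le> 0 \<Longrightarrow> signed_pow P r = - ((- r) powr (P - 1))"
  using signed_pow_nonneg [of "- r" P] by simp

lemma signed_pow_borel [measurable]: "signed_pow P \<in> borel_measurable borel"
  unfolding signed_pow_def [abs_def] by measurable

text \<open>Convexity of \<open>x powr r\<close>; the case \<open>y = 0\<close> is separate because the mean value
  theorem needs a derivative on the closed interval.\<close>

lemma powr_diff_le:
  fixes x y r :: real
  assumes "1 \<le> r" "0 \<le> y" "y \<le> x"
  shows "x powr r - y powr r \<le> r * (x - y) * x powr (r - 1)"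
proof -
  consider "y = 0" | "y = x" | "0 < y" "y < x" using assms by fastforce
  then show ?thesis
  proof cases
    case 1
    have "x powr r \<le> r * x powr r" using assms by (simp add: mult_le_cancel_right1)
    also have "x powr r = x * x powr (r - 1)" using assms by (simp add: powr_mult_base)
    finally have "x * x powr (r - 1) \<le> r * (x * x powr (r - 1))" .
    then show ?thesis using 1 assms by (simp add: mult_ac powr_mult_base)
  next
    case 3
    have "\<exists>\<xi>. y < \<xi> \<and> \<xi> < x \<and> x powr r - y powr r = (x - y) * (r * \<xi> powr (r - 1))"
      using 3 by (intro MVT2) (auto intro!: has_real_derivative_powr)
    then obtain \<xi> where \<xi>: "y < \<xi>" "\<xi> < x" "x powr r - y powr r = (x - y) * (r * \<xi> powr (r - 1))"
      by blast
    have "\<xi> powr (r - 1) \<le> x powr (r - 1)" using \<xi> 3 assms by (intro powr_mono2) auto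
    then show ?thesis using \<xi> 3 assms by (simp add: mult_ac mult_left_mono)
  qed simp
qed

lemma powr_superadd:
  fixes x y r :: real
  assumes "1 \<le> r" "0 \<le> y" "y \<le> x"
  shows "(x - y) powr r + y powr r \<le> x powr r"
proof (cases "x = 0")
  case False
  then have x: "0 < x" using assms by auto
  have le: "w powr r \<le> w" if "0 \<le> w" "w \<le> 1" for w :: real
    using powr_mono' [of 1 r w] that assms by (cases "w = 0") auto
  have "((x - y) / x) powr r + (y / x) powr r \<le> (x - y) / x + y / x"
    using assms x by (intro add_mono le) auto
  also have "\<dots> = 1" using x by (simp add: field_simps)
  finally show ?thesis using x assms by (simp add: powr_divide field_simps)
qed (use assms in auto)

lemma signed_pow_mono:
  assumes "1 \<le> P" "x \<le> y" shows "signed_pow P x \<le> signed_pow P y"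
proof -
  consider "0 \<le> x" | "x \<le> 0" "0 \<le> y" | "y \<le> 0" using assms by linarith
  then show ?thesis
  proof cases
    case 1 then show ?thesis using assms by (simp add: signed_pow_nonneg powr_mono2)
  next
    case 2
    have "- ((- x) powr (P - 1)) \<le> 0" by simp
    also have "0 \<le> y powr (P - 1)" by simp
    finally show ?thesis using 2 by (simp add: signed_pow_nonneg signed_pow_nonpos)
  next
    case 3 then show ?thesis using assms by (simp add: signed_pow_nonpos powr_mono2)
  qed
qed

text \<open>The derivative is \<open>(P - 1) * \<bar>r\<bar> powr (P - 2)\<close>; the arguments of different sign are
  treated by hand.\<close>

lemma signed_pow_lipschitz:
  assumes P: "2 \<le> P" and M: "\<bar>x\<bar> \<le> M" "\<bar>y\<bar> \<le> M"
  shows "\<bar>signed_pow P x - signed_pow P y\<bar> \<le> P * \<bar>x - y\<bar> * M powr (P - 2)"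
proof -
  have pos: "w powr (P - 1) - v powr (P - 1) \<le> P * (w - v) * M powr (P - 2)"
    if "0 \<le> v" "v \<le> w" "w \<le> M" for v w :: real
  proof -
    have "w powr (P - 1) - v powr (P - 1) \<le> (P - 1) * (w - v) * w powr (P - 1 - 1)"
      using that P by (intro powr_diff_le) auto
    also have "(P - 1) * (w - v) * w powr (P - 1 - 1) = (P - 1) * (w - v) * w powr (P - 2)" by simp
    also have "\<dots> \<le> P * (w - v) * M powr (P - 2)"
      using that P by (intro mult_mono powr_mono2) auto
    finally show ?thesis .
  qed
  have base: "w powr (P - 1) \<le> w * M powr (P - 2)" if "0 \<le> w" "w \<le> M" for w :: real
  proof -
    have "w powr (P - 1) = w * w powr (P - 2)" using that by (simp add: powr_mult_base)
    also have "\<dots> \<le> w * M powr (P - 2)" using that P by (intro mult_left_mono powr_mono2) auto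
    finally show ?thesis .
  qed
  have main: "signed_pow P w - signed_pow P v \<le> P * (w - v) * M powr (P - 2)"
    if "v \<le> w" "\<bar>v\<bar> \<le> M" "\<bar>w\<bar> \<le> M" for v w
  proof -
    consider "0 \<le> v" | "v \<le> 0" "0 \<le> w" | "w \<le> 0" using that by linarith
    then show ?thesis
    proof cases
      case 1 then show ?thesis using pos [of v w] that by (simp add: signed_pow_nonneg)
    next
      case 2
      have "w powr (P - 1) + (- v) powr (P - 1) \<le> 1 * (w - v) * M powr (P - 2)"
        using base [of w] base [of "- v"] 2 that by (simp add: algebra_simps)
      also have "\<dots> \<le> P * (w - v) * M powr (P - 2)"
        using P that by (intro mult_right_mono) auto
      finally show ?thesis using 2 by (simp add: signed_pow_nonneg signed_pow_nonpos)
    next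
      case 3 then show ?thesis using pos [of "- w" "- v"] that by (simp add: signed_pow_nonpos)
    qed
  qed
  have "signed_pow P (min x y) \<le> signed_pow P (max x y)" using P by (intro signed_pow_mono) auto
  then show ?thesis using main [of x y] main [of y x] M
    by (cases "x \<le> y") (auto simp: min_def max_def)
qed

lemma signed_pow_sum_le:
  assumes "2 \<le> P" "\<bar>x\<bar> \<le> M" "\<bar>y\<bar> \<le> M"
  shows "\<bar>signed_pow P x + signed_pow P y\<bar> \<le> P * \<bar>x + y\<bar> * M powr (P - 2)"
  using signed_pow_lipschitz [of P x M "- y"] assms by simp

text \<open>Coercivity: this turns the gain in the differences of \<open>u\<close> into a gain for the
  operator.\<close>

lemma signed_pow_gap:
  assumes P: "2 \<le> P" and xy: "y \<le> x"
  shows "2 powr (1 - P) * (x - y) powr (P - 1) \<le> signed_pow P x - signed_pow P y"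
proof -
  have le: "2 powr (1 - P) * v \<le> v" if "0 \<le> v" for v :: real
  proof -
    have "(2::real) powr (1 - P) \<le> 2 powr 0" using P by (intro powr_mono) auto
    then show ?thesis using that by (simp add: mult_left_le_one_le)
  qed
  consider "0 \<le> y" | "y \<le> 0" "0 \<le> x" | "x \<le> 0" using xy by linarith
  then show ?thesis
  proof cases
    case 1
    then show ?thesis using powr_superadd [of "P - 1" y x] le [of "(x - y) powr (P - 1)"] xy P
      by (simp add: signed_pow_nonneg)
  next
    case 2
    define w where "w = max x (- y)"
    have w: "0 \<le> w" "(x - y) / 2 \<le> w" using 2 by (auto simp: w_def max_def)
    have "2 powr (1 - P) * (x - y) powr (P - 1) = ((x - y) / 2) powr (P - 1)"
      using xy by (subst powr_divide) (auto simp: powr_diff field_simps)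
    also have "\<dots> \<le> w powr (P - 1)" using w xy P by (intro powr_mono2) auto
    also have "\<dots> \<le> x powr (P - 1) + (- y) powr (P - 1)" by (simp add: w_def max_def)
    finally show ?thesis using 2 by (simp add: signed_pow_nonneg signed_pow_nonpos)
  next
    case 3
    then show ?thesis
      using powr_superadd [of "P - 1" "- x" "- y"] le [of "(x - y) powr (P - 1)"] xy P
      by (simp add: signed_pow_nonpos)
  qed
qed

section \<open>Lebesgue integrals of power kernels\<close>

lemma lebesgue_eq_translate_reflect:
  fixes x :: "'a::euclidean_space" and c :: real
  assumes "\<bar>c\<bar> = 1"
  shows "(\<lambda>z. x + c *\<^sub>R z) \<in> lebesgue \<rightarrow>\<^sub>M lebesgue"
    and "distr lebesgue lebesgue (\<lambda>z. x + c *\<^sub>R z) = lebesgue"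
proof -
  have eq: "(\<lambda>z. x + (\<Sum>j\<in>Basis. (c * (z \<bullet> j)) *\<^sub>R j)) = (\<lambda>z. x + c *\<^sub>R z)"
    by (simp add: scaleR_scaleR [symmetric] scaleR_sum_right [symmetric] euclidean_representation
        del: scaleR_scaleR)
  have c: "c \<noteq> 0" using assms by auto
  show m: "(\<lambda>z. x + c *\<^sub>R z) \<in> lebesgue \<rightarrow>\<^sub>M lebesgue"
    using lebesgue_affine_measurable [of "\<lambda>_. c" x] c unfolding eq by simp
  have "lebesgue = density (distr lebesgue lebesgue (\<lambda>z. x + c *\<^sub>R z)) (\<lambda>_. 1)"
    using lebesgue_affine_euclidean [of "\<lambda>_. c" x] c assms unfolding eq by simp
  then show "distr lebesgue lebesgue (\<lambda>z. x + c *\<^sub>R z) = lebesgue" by (simp add: density_1)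
qed

lemma lebesgue_integral_affine:
  fixes f :: "'a::euclidean_space \<Rightarrow> real"
  assumes f: "f \<in> borel_measurable lebesgue" and c: "\<bar>c\<bar> = 1"
  shows lebesgue_measurable_affine: "(\<lambda>z. f (x + c *\<^sub>R z)) \<in> borel_measurable lebesgue"
    and lebesgue_integrable_affine_iff:
      "integrable lebesgue (\<lambda>z. f (x + c *\<^sub>R z)) \<longleftrightarrow> integrable lebesgue f"
    and "(\<integral>z. f (x + c *\<^sub>R z) \<partial>lebesgue) = (\<integral>z. f z \<partial>lebesgue)"
proof -
  note m = lebesgue_eq_translate_reflect [OF c, of x]
  show "(\<lambda>z. f (x + c *\<^sub>R z)) \<in> borel_measurable lebesgue"
    using measurable_compose [OF m(1) f] .
  show "integrable lebesgue (\<lambda>z. f (x + c *\<^sub>R z)) \<longleftrightarrow> integrable lebesgue f"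
    using integrable_distr_eq [OF m(1) f] m(2) by simp
  show "(\<integral>z. f (x + c *\<^sub>R z) \<partial>lebesgue) = (\<integral>z. f z \<partial>lebesgue)"
    using integral_distr [OF m(1) f] m(2) by simp
qed

text \<open>A function that is bounded by \<open>B n\<close> on the n-th of a sequence of dyadic shells is dominated
  by a series of indicators of balls. The integrals of powers of the norm below are obtained from it.\<close>

lemma dyadic_bound:
  fixes f :: "'a::euclidean_space \<Rightarrow> real" and B :: "nat \<Rightarrow> real"
  assumes f: "f \<in> borel_measurable borel" "\<And>z. 0 \<le> f z"
    and le: "\<And>z. f z \<noteq> 0 \<Longrightarrow> \<exists>n. norm z \<le> R n \<and> f z \<le> B n"
    and R: "\<And>n. 0 \<le> R n" and B: "\<And>n. 0 \<le> B n"
    and sums: "(\<lambda>n. unit_ball_vol (real DIM('a)) * R n ^ DIM('a) * B n) sums T"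
  shows "integrable lebesgue f" "(\<integral>z. f z \<partial>lebesgue) \<le> T"
proof -
  have nn: "0 \<le> unit_ball_vol (real DIM('a)) * R n ^ DIM('a) * B n" for n using R B by simp
  have *: "ennreal (f z) \<le> (\<Sum>n. ennreal (B n) * indicator (cball 0 (R n)) z)" for z
  proof (cases "f z = 0")
    case False
    then obtain n where n: "norm z \<le> R n" "f z \<le> B n" using le by blast
    have "ennreal (f z) \<le> ennreal (B n) * indicator (cball 0 (R n)) z"
      using n by (simp add: ennreal_leI)
    also have "\<dots> \<le> (\<Sum>n. ennreal (B n) * indicator (cball 0 (R n)) z)"
      using sum_le_suminf [OF summableI, of "{n}" "\<lambda>n. ennreal (B n) * indicator (cball 0 (R n)) z"]
      by (simp only: sum.insert sum.empty finite.intros empty_iff not_False_eq_True add_0_right zero_le)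
    finally show ?thesis .
  qed simp
  have [measurable]: "cball (0::'a) (R n) \<in> sets borel" for n by simp
  from * have "(\<integral>\<^sup>+z. ennreal (f z) \<partial>lborel)
      \<le> (\<integral>\<^sup>+z. (\<Sum>n. ennreal (B n) * indicator (cball 0 (R n)) z) \<partial>(lborel :: 'a measure))"
    by (intro nn_integral_mono)
  also have "\<dots> = (\<Sum>n. \<integral>\<^sup>+z. ennreal (B n) * indicator (cball 0 (R n)) z \<partial>(lborel :: 'a measure))"
    by (intro nn_integral_suminf) measurable
  also have "\<dots> = (\<Sum>n. ennreal (unit_ball_vol (real DIM('a)) * R n ^ DIM('a) * B n))"
  proof (intro arg_cong [where f = suminf] ext)
    fix n
    have "(\<integral>\<^sup>+z. ennreal (B n) * indicator (cball 0 (R n)) z \<partial>(lborel :: 'a measure))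
        = ennreal (B n) * ennreal (unit_ball_vol (real DIM('a)) * R n ^ DIM('a))"
      using R by (subst nn_integral_cmult_indicator) (auto simp: emeasure_cball)
    also have "\<dots> = ennreal (unit_ball_vol (real DIM('a)) * R n ^ DIM('a) * B n)"
      using B by (subst ennreal_mult' [symmetric]) (simp_all add: mult.commute)
    finally show "(\<integral>\<^sup>+z. ennreal (B n) * indicator (cball 0 (R n)) z \<partial>(lborel :: 'a measure))
        = ennreal (unit_ball_vol (real DIM('a)) * R n ^ DIM('a) * B n)" .
  qed
  also have "\<dots> = ennreal T"
    by (rule suminf_ennreal_eq [OF nn sums])
  finally have le: "(\<integral>\<^sup>+z. ennreal (f z) \<partial>lborel) \<le> ennreal T" .
  have T: "0 \<le> T" using sums_le [OF nn sums_zero sums] .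
  have int: "integrable lborel f"
    using f le by (intro integrableI_nonneg) (auto simp: order.strict_trans1)
  then show "integrable lebesgue f" by (rule integrable_completion [THEN iffD2, rotated]) (use f in auto)
  have "integral\<^sup>L lebesgue f = integral\<^sup>L lborel f" using f by (intro integral_completion) auto
  also have "\<dots> \<le> T"
    using le T nn_integral_eq_integral [OF int] f by (simp add: ennreal_le_iff)
  finally show "(\<integral>z. f z \<partial>lebesgue) \<le> T" .
qed

lemma dyadic_scale:
  fixes t :: real
  assumes "0 < t" "t \<le> 1"
  shows "\<exists>n. (1/2) ^ Suc n < t \<and> t \<le> (1/2) ^ n"
proof -
  define N where "N = (LEAST n. (1/2) ^ n < t)"
  have ex: "\<exists>n. (1/2) ^ n < t" using assms real_arch_pow_inv [of t "1/2"] by auto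
  have N: "(1/2) ^ N < t" unfolding N_def by (rule LeastI_ex [OF ex])
  have "N \<noteq> 0" using N assms by (intro notI) simp
  then obtain n where n: "N = Suc n" by (cases N) auto
  have "\<not> (1/2) ^ n < t" using not_less_Least [of n "\<lambda>n. (1/2) ^ n < t"] n N_def by auto
  then show ?thesis using N n by (intro exI [of _ n]) auto
qed

lemma integral_norm_powr_inside:
  fixes \<beta> :: real
  assumes \<beta>: "0 < \<beta>"
  obtains C where "0 < C"
    "\<And>\<rho>. 0 < \<rho> \<Longrightarrow> integrable lebesgue (\<lambda>z::'a::euclidean_space. indicator (ball 0 \<rho>) z * norm z powr (\<beta> - real DIM('a)))"
    "\<And>\<rho>. 0 < \<rho> \<Longrightarrow> integral\<^sup>L lebesgue (\<lambda>z::'a. indicator (ball 0 \<rho>) z * norm z powr (\<beta> - real DIM('a))) \<le> C * \<rho> powr \<beta>"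
proof -
  define d where "d = real DIM('a)"
  define K where "K = (2::real) powr \<bar>\<beta> - d\<bar>"
  define q where "q = (1/2::real) powr \<beta>"
  define C where "C = unit_ball_vol d * K / (1 - q)"
  have q: "0 < q" "q < 1" using \<beta> powr_less_mono2 [of \<beta> "1/2" 1] by (auto simp: q_def)
  have "0 < K" by (simp add: K_def)
  then have C: "0 < C" using q by (simp add: C_def d_def)
  have main: "integrable lebesgue (\<lambda>z::'a. indicator (ball 0 \<rho>) z * norm z powr (\<beta> - d)) \<and>
     integral\<^sup>L lebesgue (\<lambda>z::'a. indicator (ball 0 \<rho>) z * norm z powr (\<beta> - d)) \<le> C * \<rho> powr \<beta>"
    if \<rho>: "0 < \<rho>" for \<rho>
  proof -
    define R where "R n = \<rho> * (1/2) ^ n" for n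
    define B where "B n = K * R n powr (\<beta> - d)" for n
    have Rp: "0 < R n" for n using \<rho> by (simp add: R_def)
    have eq: "unit_ball_vol (real DIM('a)) * R n ^ DIM('a) * B n = (unit_ball_vol d * K * \<rho> powr \<beta>) * q ^ n" for n
    proof -
      have "R n ^ DIM('a) * R n powr (\<beta> - d) = R n powr \<beta>"
        using Rp [of n] by (simp add: d_def powr_realpow [symmetric] powr_add [symmetric])
      also have "\<dots> = \<rho> powr \<beta> * q ^ n"
        using \<rho> by (simp add: R_def powr_mult q_def powr_realpow [symmetric] powr_powr mult.commute)
      finally show ?thesis by (simp add: B_def d_def)
    qed
    have s: "(\<lambda>n. unit_ball_vol (real DIM('a)) * R n ^ DIM('a) * B n) sums (C * \<rho> powr \<beta>)"
      unfolding eq C_def using sums_mult [OF geometric_sums [of q], of "unit_ball_vol d * K * \<rho> powr \<beta>"] q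
      by (simp add: field_simps)
    have le: "\<exists>n. norm z \<le> R n \<and> indicator (ball 0 \<rho>) z * norm z powr (\<beta> - d) \<le> B n"
      if "indicator (ball 0 \<rho>) z * norm z powr (\<beta> - d) \<noteq> 0" for z :: 'a
    proof -
      have z: "0 < norm z" "norm z < \<rho>" using that by (auto simp: indicator_def split: if_splits)
      then obtain n where n: "(1/2) ^ Suc n < norm z / \<rho>" "norm z / \<rho> \<le> (1/2) ^ n"
        using dyadic_scale [of "norm z / \<rho>"] \<rho> by (auto simp del: power_Suc)
      have n': "R n / 2 \<le> norm z" "norm z \<le> R n" using n \<rho> by (auto simp: R_def field_simps)
      have "norm z powr (\<beta> - d) = (norm z / R n) powr (\<beta> - d) * R n powr (\<beta> - d)"
        using Rp [of n] z by (subst powr_mult [symmetric]) auto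
      also have "(norm z / R n) powr (\<beta> - d) \<le> K"
      proof -
        have w: "1/2 \<le> norm z / R n" "norm z / R n \<le> 1" using n' Rp [of n] by (auto simp: field_simps)
        have "(norm z / R n) powr (\<beta> - d) \<le> (norm z / R n) powr (- \<bar>\<beta> - d\<bar>)"
          using w z Rp [of n] by (intro powr_mono') auto
        also have "\<dots> \<le> (1/2) powr (- \<bar>\<beta> - d\<bar>)"
          using w z Rp [of n] by (intro powr_mono2') auto
        also have "\<dots> = K" by (simp add: K_def powr_divide powr_minus)
        finally show ?thesis .
      qed
      finally have "norm z powr (\<beta> - d) \<le> B n" by (simp add: B_def mult_right_mono)
      then show ?thesis using n' z by (intro exI [of _ n]) (auto simp: indicator_def)
    qed
    have [measurable]: "ball (0::'a) \<rho> \<in> sets borel" by simp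
    have meas: "(\<lambda>z::'a. indicator (ball 0 \<rho>) z * norm z powr (\<beta> - d)) \<in> borel_measurable borel"
      by measurable
    show ?thesis
    proof
      show "integrable lebesgue (\<lambda>z::'a. indicator (ball 0 \<rho>) z * norm z powr (\<beta> - d))"
        by (rule dyadic_bound(1) [OF meas _ le _ _ s])
          (use \<open>0 < K\<close> Rp in \<open>simp_all add: B_def less_imp_le\<close>)
      show "integral\<^sup>L lebesgue (\<lambda>z::'a. indicator (ball 0 \<rho>) z * norm z powr (\<beta> - d)) \<le> C * \<rho> powr \<beta>"
        by (rule dyadic_bound(2) [OF meas _ le _ _ s])
          (use \<open>0 < K\<close> Rp in \<open>simp_all add: B_def less_imp_le\<close>)
    qed
  qed
  show ?thesis
    by (rule that [OF C]) (use main in \<open>simp_all add: d_def\<close>)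
qed

lemma integral_norm_powr_outside:
  fixes \<beta> :: real
  assumes \<beta>: "0 < \<beta>"
  obtains C where "0 < C"
    "\<And>\<rho>. 0 < \<rho> \<Longrightarrow> integrable lebesgue (\<lambda>z::'a::euclidean_space. indicator (- ball 0 \<rho>) z * norm z powr (- \<beta> - real DIM('a)))"
    "\<And>\<rho>. 0 < \<rho> \<Longrightarrow> integral\<^sup>L lebesgue (\<lambda>z::'a. indicator (- ball 0 \<rho>) z * norm z powr (- \<beta> - real DIM('a))) \<le> C * \<rho> powr (- \<beta>)"
proof -
  define d where "d = real DIM('a)"
  define q where "q = (1/2::real) powr \<beta>"
  define C where "C = unit_ball_vol d * 2 ^ DIM('a) / (1 - q)"
  have q: "0 < q" "q < 1" using \<beta> powr_less_mono2 [of \<beta> "1/2" 1] by (auto simp: q_def)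
  have C: "0 < C" using q by (simp add: C_def d_def)
  have main: "integrable lebesgue (\<lambda>z::'a. indicator (- ball 0 \<rho>) z * norm z powr (- \<beta> - d)) \<and>
     integral\<^sup>L lebesgue (\<lambda>z::'a. indicator (- ball 0 \<rho>) z * norm z powr (- \<beta> - d)) \<le> C * \<rho> powr (- \<beta>)"
    if \<rho>: "0 < \<rho>" for \<rho>
  proof -
    define R where "R n = \<rho> * 2 ^ n" for n
    define B where "B n = R n powr (- \<beta> - d)" for n
    have Rp: "0 < R n" for n using \<rho> by (simp add: R_def)
    have eq: "unit_ball_vol (real DIM('a)) * (2 * R n) ^ DIM('a) * B n = (unit_ball_vol d * 2 ^ DIM('a) * \<rho> powr (- \<beta>)) * q ^ n" for n
    proof -
      have "R n ^ DIM('a) * R n powr (- \<beta> - d) = R n powr (- \<beta>)"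
        using Rp [of n] by (simp add: d_def powr_realpow [symmetric] powr_add [symmetric])
      also have "\<dots> = \<rho> powr (- \<beta>) * q ^ n"
        using \<rho> by (simp add: R_def powr_mult q_def powr_realpow [symmetric] powr_powr mult.commute
            powr_divide powr_minus inverse_eq_divide)
      finally show ?thesis by (simp add: B_def d_def power_mult_distrib)
    qed
    have s: "(\<lambda>n. unit_ball_vol (real DIM('a)) * (2 * R n) ^ DIM('a) * B n) sums (C * \<rho> powr (- \<beta>))"
      unfolding eq C_def using sums_mult [OF geometric_sums [of q], of "unit_ball_vol d * 2 ^ DIM('a) * \<rho> powr (- \<beta>)"] q
      by (simp add: field_simps)
    have le: "\<exists>n. norm z \<le> 2 * R n \<and> indicator (- ball 0 \<rho>) z * norm z powr (- \<beta> - d) \<le> B n"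
      if "indicator (- ball 0 \<rho>) z * norm z powr (- \<beta> - d) \<noteq> 0" for z :: 'a
    proof -
      have z: "\<rho> \<le> norm z" using that by (auto simp: indicator_def split: if_splits)
      then have zp: "0 < norm z" using \<rho> by linarith
      then have "0 < \<rho> / norm z" "\<rho> / norm z \<le> 1" using \<rho> z by (simp_all add: divide_le_eq)
      then obtain n where n: "(1/2) ^ Suc n < \<rho> / norm z" "\<rho> / norm z \<le> (1/2) ^ n"
        using dyadic_scale [of "\<rho> / norm z"] by metis
      have n': "norm z \<le> 2 * R n" "R n \<le> norm z"
        using n zp by (auto simp: R_def power_divide divide_less_eq less_divide_eq divide_le_eq le_divide_eq mult_ac)
      have "norm z powr (- \<beta> - d) \<le> B n" unfolding B_def
        using Rp [of n] n' \<beta> by (intro powr_mono2') (auto simp: d_def)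
      then show ?thesis using n' z by (intro exI [of _ n]) (auto simp: indicator_def)
    qed
    have [measurable]: "ball (0::'a) \<rho> \<in> sets borel" by simp
    have meas: "(\<lambda>z::'a. indicator (- ball 0 \<rho>) z * norm z powr (- \<beta> - d)) \<in> borel_measurable borel"
      by measurable
    show ?thesis
    proof
      show "integrable lebesgue (\<lambda>z::'a. indicator (- ball 0 \<rho>) z * norm z powr (- \<beta> - d))"
        by (rule dyadic_bound(1) [OF meas _ le _ _ s])
          (use Rp in \<open>simp_all add: B_def less_imp_le\<close>)
      show "integral\<^sup>L lebesgue (\<lambda>z::'a. indicator (- ball 0 \<rho>) z * norm z powr (- \<beta> - d)) \<le> C * \<rho> powr (- \<beta>)"
        by (rule dyadic_bound(2) [OF meas _ le _ _ s])
          (use Rp in \<open>simp_all add: B_def less_imp_le\<close>)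
    qed
  qed
  show ?thesis
    by (rule that [OF C]) (use main in \<open>simp_all add: d_def\<close>)
qed


section \<open>Principal values\<close>

lemma lebesgue_ball [measurable]: "ball (x::'a::euclidean_space) r \<in> sets lebesgue"
  by (intro sets_completionI_sets) simp

lemma ext_set_integral_eq:
  assumes "integrable lebesgue (\<lambda>y. indicator S y * f y)"
  shows "ext_set_integral S f = ereal (\<integral>y. indicator S y * f y \<partial>lebesgue)"
proof -
  let ?g = "\<lambda>y. indicator S y * f y"
  have eq: "(\<integral>\<^sup>+y\<in>S. ennreal (f y) \<partial>lebesgue) = (\<integral>\<^sup>+y. ennreal (?g y) \<partial>lebesgue)"
    "(\<integral>\<^sup>+y\<in>S. ennreal (- f y) \<partial>lebesgue) = (\<integral>\<^sup>+y. ennreal (- ?g y) \<partial>lebesgue)"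
    by (auto intro!: nn_integral_cong simp: indicator_def)
  have fin: "(\<integral>\<^sup>+y. ennreal (?g y) \<partial>lebesgue) < \<infinity>" "(\<integral>\<^sup>+y. ennreal (- ?g y) \<partial>lebesgue) < \<infinity>"
    using integrableD(2,3) [OF assms] by (auto simp: top.not_eq_extremum)
  have e: "enn2ereal v = ereal (enn2real v)" if "v < \<infinity>" for v
    using that by (cases v) (auto simp: enn2ereal_ennreal)
  show ?thesis
    unfolding ext_set_integral_def eq e [OF fin(1)] e [OF fin(2)]
    by (simp add: real_lebesgue_integral_def [OF assms])
qed

text \<open>When the truncated integrals converge absolutely, the extended-real difference of the integrals of
  positive and negative part is the ordinary integral, and the principal value is the limit of these. The integrals
  are taken in the increment \<open>z = y - x\<close>.\<close>

lemma pv_integral_eq: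
  fixes x :: "'a::euclidean_space"
  assumes int: "\<And>\<epsilon>. 0 < \<epsilon> \<Longrightarrow> \<epsilon> < r \<Longrightarrow> integrable lebesgue (\<lambda>z. indicator {z. \<epsilon> < norm z} z * f (x + z))"
    and r: "0 < r"
    and lim: "((\<lambda>\<epsilon>. \<integral>z. indicator {z. \<epsilon> < norm z} z * f (x + z) \<partial>lebesgue) \<longlongrightarrow> I) (at_right 0)"
  shows "pv_integral x f = ereal I"
proof -
  have eq: "ext_set_integral {y. \<epsilon> < norm (x - y)} f
      = ereal (\<integral>z. indicator {z. \<epsilon> < norm z} z * f (x + z) \<partial>lebesgue)" if "0 < \<epsilon>" "\<epsilon> < r" for \<epsilon>
  proof -
    let ?F = "\<lambda>y. indicator {y. \<epsilon> < norm (x - y)} y * f y"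
    let ?G = "\<lambda>z. indicator {z. \<epsilon> < norm z} z * f (x + z)"
    have F: "?F = (\<lambda>y. ?G (- x + 1 *\<^sub>R y))"
      by (auto simp: fun_eq_iff indicator_def norm_minus_commute)
    note g = int [OF that]
    have "integrable lebesgue ?F"
      unfolding F using lebesgue_integrable_affine_iff [of ?G 1 "- x"] g by simp
    moreover have "integral\<^sup>L lebesgue ?F = integral\<^sup>L lebesgue ?G"
      unfolding F using lebesgue_integral_affine(3) [of ?G 1 "- x"] g by simp
    ultimately show ?thesis by (simp add: ext_set_integral_eq)
  qed
  have "((\<lambda>\<epsilon>. ext_set_integral {y. \<epsilon> < norm (x - y)} f) \<longlongrightarrow> ereal I) (at_right 0)"
  proof (rule Lim_transform_eventually [OF tendsto_ereal [OF lim]])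
    have "\<forall>\<^sub>F \<epsilon> in at_right 0. \<epsilon> \<in> {0<..<r}" using eventually_at_right_real [OF r] .
    then show "\<forall>\<^sub>F \<epsilon> in at_right 0. ereal (\<integral>z. indicator {z. \<epsilon> < norm z} z * f (x + z) \<partial>lebesgue)
        = ext_set_integral {y. \<epsilon> < norm (x - y)} f"
      by eventually_elim (simp add: eq)
  qed
  then show ?thesis unfolding pv_integral_def by (intro tendsto_Lim) auto
qed

lemma integral_shrinking_hole:
  fixes g :: "'a::euclidean_space \<Rightarrow> real"
  assumes g: "integrable lebesgue g" and g0: "g 0 = 0"
  shows "((\<lambda>\<epsilon>. \<integral>z. indicator {z. \<epsilon> < norm z} z * g z \<partial>lebesgue) \<longlongrightarrow> integral\<^sup>L lebesgue g) (at_right 0)"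
proof (rule tendsto_at_right_sequentially [where b = 1])
  fix S :: "nat \<Rightarrow> real"
  assume S: "\<And>n. 0 < S n" "S \<longlonglongrightarrow> 0"
  show "(\<lambda>n. \<integral>z. indicator {z. S n < norm z} z * g z \<partial>lebesgue) \<longlonglongrightarrow> integral\<^sup>L lebesgue g"
  proof (rule integral_dominated_convergence [where w = "\<lambda>z. norm (g z)"])
    have [measurable]: "g \<in> borel_measurable lebesgue" using g by simp
    have [measurable]: "{z::'a. e < norm z} \<in> sets lebesgue" for e
      by (intro sets_completionI_sets) simp
    show "g \<in> borel_measurable lebesgue" by simp
    show "(\<lambda>z. indicator {z. S n < norm z} z * g z) \<in> borel_measurable lebesgue" for n
      by measurable
    show "integrable lebesgue (\<lambda>z. norm (g z))" using g by simp
    show "AE z in lebesgue. norm (indicator {z. S n < norm z} z * g z) \<le> norm (g z)" for n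
      by (simp add: indicator_def)
    show "AE z in lebesgue. (\<lambda>n. indicator {z. S n < norm z} z * g z) \<longlonglongrightarrow> g z"
    proof (rule AE_I2)
      fix z :: 'a
      show "(\<lambda>n. indicator {z. S n < norm z} z * g z) \<longlonglongrightarrow> g z"
      proof (cases "z = 0")
        case False
        then have "\<forall>\<^sub>F n in sequentially. S n < norm z" using S(2) by (intro order_tendstoD(2)) auto
        then have "\<forall>\<^sub>F n in sequentially. indicator {z. S n < norm z} z * g z = g z" by eventually_elim simp
        then show ?thesis by (rule tendsto_eventually)
      qed (simp add: g0)
    qed
  qed
qed auto

lemma integral_reflect:
  fixes f :: "'a::euclidean_space \<Rightarrow> real"
  assumes "integrable lebesgue f"
  shows "integrable lebesgue (\<lambda>z. f (- z))" "(\<integral>z. f (- z) \<partial>lebesgue) = integral\<^sup>L lebesgue f"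
  using lebesgue_integrable_affine_iff [of f "-1" 0] lebesgue_integral_affine(3) [of f "-1" 0] assms by auto

lemma abs_le_two_powr:
  fixes c v :: real
  assumes "1 \<le> r"
  shows "\<bar>c - v\<bar> powr r \<le> 2 powr r * (\<bar>c\<bar> powr r + \<bar>v\<bar> powr r)"
proof -
  have "\<bar>c - v\<bar> powr r \<le> (2 * max \<bar>c\<bar> \<bar>v\<bar>) powr r" using assms by (intro powr_mono2) auto
  also have "\<dots> = 2 powr r * max \<bar>c\<bar> \<bar>v\<bar> powr r" by (subst powr_mult) auto
  also have "max \<bar>c\<bar> \<bar>v\<bar> powr r \<le> \<bar>c\<bar> powr r + \<bar>v\<bar> powr r" by (simp add: max_def)
  finally show ?thesis by simp
qed

lemma tail_weight_integrable:
  fixes u :: "'a::euclidean_space \<Rightarrow> real"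
  assumes "0 < \<sigma>" "u \<in> tail_space k \<sigma>"
  shows "integrable lebesgue (\<lambda>w. (c + \<bar>u w\<bar> powr k) * (1 + norm w) powr (- (real DIM('a) + \<sigma>)))"
proof -
  let ?m = "real DIM('a) + \<sigma>"
  obtain C where C: "\<And>\<rho>. 0 < \<rho> \<Longrightarrow> integrable lebesgue (\<lambda>z::'a. indicator (- ball 0 \<rho>) z * norm z powr (- \<sigma> - real DIM('a)))"
    using integral_norm_powr_outside [where 'a = 'a, OF assms(1)] by metis
  have 1: "integrable lebesgue (\<lambda>w::'a. indicator (ball 0 1) w + indicator (- ball 0 1) w * norm w powr (- ?m))"
  proof (rule Bochner_Integration.integrable_add)
    show "integrable lebesgue (indicator (ball (0::'a) 1) :: 'a \<Rightarrow> real)"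
      by (intro integrable_real_indicator) (auto simp: emeasure_ball)
    show "integrable lebesgue (\<lambda>w::'a. indicator (- ball 0 1) w * norm w powr (- ?m))"
      using C [of 1] by (simp add: algebra_simps)
  qed
  have [measurable]: "(\<lambda>w::'a. (1 + norm w) powr (- ?m)) \<in> borel_measurable lebesgue"
    by (intro measurable_completion) simp
  have 2: "integrable lebesgue (\<lambda>w::'a. (1 + norm w) powr (- ?m))"
  proof (rule Bochner_Integration.integrable_bound [OF 1])
    show "AE w in lebesgue. norm ((1 + norm (w::'a)) powr (- ?m))
        \<le> norm (indicator (ball 0 1) w + indicator (- ball 0 1) w * norm w powr (- ?m))"
    proof (rule AE_I2)
      fix w :: 'a
      show "norm ((1 + norm w) powr (- ?m)) \<le> norm (indicator (ball 0 1) w + indicator (- ball 0 1) w * norm w powr (- ?m))"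
      proof (cases "norm w < 1")
        case True
        have "(1 + norm w) powr (- ?m) \<le> 1 powr (- ?m)" using assms(1) by (intro powr_mono2') auto
        then show ?thesis using True by simp
      next
        case False
        then have "0 < norm w" by linarith
        then have "(1 + norm w) powr (- ?m) \<le> norm w powr (- ?m)" using assms(1) by (intro powr_mono2') auto
        then show ?thesis using False by simp
      qed
    qed
  qed measurable
  have 3: "integrable lebesgue (\<lambda>x. \<bar>u x\<bar> powr k * (1 + norm x) powr (- ?m))"
    using assms(2) unfolding tail_space_def by (simp only: mem_Collect_eq powr_minus divide_inverse)
  have "integrable lebesgue (\<lambda>w. c * (1 + norm w) powr (- ?m) + \<bar>u w\<bar> powr k * (1 + norm w) powr (- ?m))"
    using 2 3 by (intro Bochner_Integration.integrable_add) auto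
  then show ?thesis by (simp add: algebra_simps)
qed

text \<open>Compares the kernel \<open>m powr (- e)\<close>, where \<open>m\<close> is at least \<open>h\<close> and
  \<open>norm z\<close>, with the weight of the tail space at \<open>x + z\<close>.\<close>

lemma weight_le:
  fixes x z :: "'a::real_normed_vector"
  assumes "0 < h" "h \<le> m" "norm z \<le> m" "0 \<le> e" "norm x \<le> R"
  shows "m powr (- e) \<le> ((1 + R) / h + 1) powr e * (1 + norm (x + z)) powr (- e)"
proof -
  let ?c = "(1 + R) / h + 1"
  have R: "0 \<le> R" using assms norm_ge_zero order_trans by blast
  have c: "0 < ?c" using R assms(1) by (simp add: add_nonneg_pos)
  have p: "0 < 1 + norm (x + z)" by (simp add: add_pos_nonneg)
  have m: "0 < m" using assms by linarith
  have "1 + norm (x + z) \<le> (1 + R) + norm z" using norm_triangle_ineq [of x z] assms by simp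
  also have "\<dots> \<le> (1 + R) / h * m + m"
  proof -
    have "(1 + R) * 1 \<le> (1 + R) * (m / h)" using assms R by (intro mult_left_mono) auto
    then show ?thesis using assms by simp
  qed
  also have "\<dots> = ?c * m" by (simp add: algebra_simps)
  finally have "(1 + norm (x + z)) / ?c \<le> m" using c by (simp add: field_simps)
  then have "m powr (- e) \<le> ((1 + norm (x + z)) / ?c) powr (- e)"
    using assms c p by (intro powr_mono2') auto
  also have "\<dots> = ?c powr e * (1 + norm (x + z)) powr (- e)"
    using c p by (simp add: powr_divide powr_minus_divide)
  finally show ?thesis .
qed

section \<open>Integrals against a kernel of order sigma\<close>

text \<open>The first-order and second-order bounds that a test function contributes to the principal value.\<close>

definition smooth_near ::
  "('a::euclidean_space \<Rightarrow> real) \<Rightarrow> 'a \<Rightarrow> real \<Rightarrow> real \<Rightarrow> real \<Rightarrow> bool"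
where
  "smooth_near w x r G N \<longleftrightarrow>
     0 < r \<and> r \<le> 1 \<and> 0 \<le> G \<and> 0 \<le> N \<and>
     (\<lambda>z. indicator (ball 0 r) z * w (x + z)) \<in> borel_measurable lebesgue \<and>
     (\<forall>z. norm z < r \<longrightarrow> \<bar>w (x + z) - w x\<bar> \<le> G * norm z) \<and>
     (\<forall>z. norm z < r \<longrightarrow> \<bar>w (x + z) + w (x - z) - 2 * w x\<bar> \<le> N * (norm z)\<^sup>2)"

abbreviation shell_integrand ::
  "real \<Rightarrow> ('a::euclidean_space \<Rightarrow> real) \<Rightarrow> ('a \<Rightarrow> real) \<Rightarrow> 'a \<Rightarrow> real \<Rightarrow> real \<Rightarrow> 'a \<Rightarrow> real"
where
  "shell_integrand P k w x r \<epsilon> z \<equiv>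
     indicator {z. \<epsilon> < norm z \<and> norm z < r} z * (signed_pow P (w x - w (x + z)) * k z)"

text \<open>One phase of the operator: \<open>\<sigma>\<close> is the order that governs the tail of \<open>u\<close>,
  and \<open>\<tau>\<close> the order of the singularity at the origin, which may be lower than
  \<open>\<sigma>\<close> when a coefficient that vanishes there is part of the kernel.\<close>

locale phase_kernel =
  fixes P \<sigma> \<tau> \<Lambda> :: real and k :: "'a::euclidean_space \<Rightarrow> real"
  assumes P: "2 \<le> P" and \<sigma>: "0 < \<sigma>" and \<tau>: "0 < \<tau>" "\<tau> < P"
    and k_borel: "k \<in> borel_measurable borel"
    and k_nonneg: "0 \<le> k z" and k_even: "k (- z) = k z"
    and k_le: "k z \<le> \<Lambda> * norm z powr (- (real DIM('a) + \<sigma>))"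
    and k_near: "norm z \<le> 1 \<Longrightarrow> k z \<le> \<Lambda> * norm z powr (- (real DIM('a) + \<tau>))"
begin

lemma \<Lambda>: "0 \<le> \<Lambda>"
proof -
  obtain b :: 'a where b: "b \<in> Basis" using nonempty_Basis by blast
  show ?thesis using k_nonneg [of b] k_le [of b] b by simp
qed

lemma k_lebesgue [measurable]: "k \<in> borel_measurable lebesgue"
  using k_borel by (intro measurable_completion) simp

lemma tail_abs_le:
  assumes h: "0 < h" "h \<le> norm z" and x: "norm x \<le> R"
  shows "\<bar>signed_pow P (c - v) * k z\<bar> \<le> (\<Lambda> * ((1 + R) / h + 1) powr (real DIM('a) + \<sigma>) * 2 powr (P - 1))
    * ((\<bar>c\<bar> powr (P - 1) + \<bar>v\<bar> powr (P - 1)) * (1 + norm (x + z)) powr (- (real DIM('a) + \<sigma>)))"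
proof -
  let ?e = "real DIM('a) + \<sigma>"
  have "k z \<le> \<Lambda> * norm z powr (- ?e)" by (rule k_le)
  also have "\<dots> \<le> \<Lambda> * (((1 + R) / h + 1) powr ?e * (1 + norm (x + z)) powr (- ?e))"
    using h x \<sigma> \<Lambda> by (intro mult_left_mono weight_le) auto
  finally have k: "k z \<le> \<Lambda> * (((1 + R) / h + 1) powr ?e * (1 + norm (x + z)) powr (- ?e))" .
  have "\<bar>signed_pow P (c - v) * k z\<bar> = \<bar>c - v\<bar> powr (P - 1) * k z"
    by (simp add: abs_mult abs_signed_pow k_nonneg)
  also have "\<dots> \<le> (2 powr (P - 1) * (\<bar>c\<bar> powr (P - 1) + \<bar>v\<bar> powr (P - 1)))
      * (\<Lambda> * (((1 + R) / h + 1) powr ?e * (1 + norm (x + z)) powr (- ?e)))"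
    using P k by (intro mult_mono abs_le_two_powr k_nonneg) auto
  finally show ?thesis by (simp add: mult_ac)
qed

text \<open>This is what membership in the tail space is for.\<close>

lemma tail_integrable:
  assumes u: "u \<in> tail_space (P - 1) \<sigma>" and r: "0 < r"
  shows "integrable lebesgue (\<lambda>z. indicator (- ball 0 r) z * (signed_pow P (c - u (x + z)) * k z))"
proof -
  let ?e = "real DIM('a) + \<sigma>"
  define C where "C = \<Lambda> * ((1 + norm x) / r + 1) powr ?e * 2 powr (P - 1)"
  let ?W = "\<lambda>w. (\<bar>c\<bar> powr (P - 1) + \<bar>u w\<bar> powr (P - 1)) * (1 + norm w) powr (- ?e)"
  have W: "integrable lebesgue ?W" by (rule tail_weight_integrable [OF \<sigma> u])
  then have "integrable lebesgue (\<lambda>z. ?W (x + 1 *\<^sub>R z))"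
    by (subst lebesgue_integrable_affine_iff) auto
  then have W': "integrable lebesgue (\<lambda>z. C * ?W (x + z))" by simp
  have [measurable]: "u \<in> borel_measurable lebesgue" using u by (simp add: tail_space_def)
  have [measurable]: "(\<lambda>z. u (x + z)) \<in> borel_measurable lebesgue"
    using lebesgue_measurable_affine [of u 1 x] by simp
  show ?thesis
  proof (rule Bochner_Integration.integrable_bound [OF W'])
    show "AE z in lebesgue. norm (indicator (- ball 0 r) z * (signed_pow P (c - u (x + z)) * k z)) \<le> norm (C * ?W (x + z))"
    proof (rule AE_I2)
      fix z
      have "0 \<le> C * ?W (x + z)" using \<Lambda> by (simp add: C_def)
      then show "norm (indicator (- ball 0 r) z * (signed_pow P (c - u (x + z)) * k z)) \<le> norm (C * ?W (x + z))"
        using tail_abs_le [of r z x "norm x" c "u (x + z)"] r by (auto simp: indicator_def C_def not_less)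
    qed
    show "(\<lambda>z. indicator (- ball 0 r) z * (signed_pow P (c - u (x + z)) * k z)) \<in> borel_measurable lebesgue"
      by measurable
  qed
qed

text \<open>As the kernel is even, the integrand may be replaced by its even part, where the first-order terms cancel:
  it is of size \<open>(G * norm z) powr (P - 2) * N * (norm z)\<^sup>2\<close> and therefore absolutely integrable
  against the kernel because \<open>\<tau> < P\<close>.\<close>

lemma near_symmetric:
  obtains C where "0 < C"
    "\<And>w x r G N. smooth_near w x r G N \<Longrightarrow>
       \<exists>I. \<bar>I\<bar> \<le> C * (G powr (P - 2) * N * r powr (P - \<tau>)) \<and>
         (\<forall>\<epsilon>>0. integrable lebesgue (\<lambda>z. shell_integrand P k w x r \<epsilon> z)) \<and>
         ((\<lambda>\<epsilon>. \<integral>z. shell_integrand P k w x r \<epsilon> z \<partial>lebesgue) \<longlongrightarrow> I) (at_right 0)"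
proof -
  obtain C where C: "0 < C"
    "\<And>\<rho>. 0 < \<rho> \<Longrightarrow> integrable lebesgue (\<lambda>z::'a. indicator (ball 0 \<rho>) z * norm z powr ((P - \<tau>) - real DIM('a)))"
    "\<And>\<rho>. 0 < \<rho> \<Longrightarrow> integral\<^sup>L lebesgue (\<lambda>z::'a. indicator (ball 0 \<rho>) z * norm z powr ((P - \<tau>) - real DIM('a))) \<le> C * \<rho> powr (P - \<tau>)"
    by (rule integral_norm_powr_inside [where 'a = 'a and \<beta> = "P - \<tau>"]) (use \<tau> in auto)
  define D where "D = P * \<Lambda> * C + 1"
  have D: "0 < D" using P \<Lambda> C(1) by (simp add: D_def add_nonneg_pos)
  show ?thesis
  proof (rule that [OF D])
    fix w :: "'a \<Rightarrow> real" and x r G N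
    assume "smooth_near w x r G N"
    then have r: "0 < r" "r \<le> 1" and GN: "0 \<le> G" "0 \<le> N"
      and meas: "(\<lambda>z. indicator (ball 0 r) z * w (x + z)) \<in> borel_measurable lebesgue"
      and G: "\<And>z. norm z < r \<Longrightarrow> \<bar>w (x + z) - w x\<bar> \<le> G * norm z"
      and N: "\<And>z. norm z < r \<Longrightarrow> \<bar>w (x + z) + w (x - z) - 2 * w x\<bar> \<le> N * (norm z)\<^sup>2"
      unfolding smooth_near_def by blast+
    define f where "f z = indicator (ball 0 r) z * (signed_pow P (w x - indicator (ball 0 r) z * w (x + z)) * k z)" for z
    have f_meas [measurable]: "f \<in> borel_measurable lebesgue"
      unfolding f_def [abs_def] using meas by measurable
    have fm_meas [measurable]: "(\<lambda>z. f (- z)) \<in> borel_measurable lebesgue"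
      using lebesgue_measurable_affine [of f "-1" 0] by simp
    define g where "g z = (f z + f (- z)) / 2" for z
    have f_eq: "f z = signed_pow P (w x - w (x + z)) * k z" if "norm z < r" for z
      using that by (simp add: f_def)
    have f_out: "f z = 0" if "\<not> norm z < r" for z using that by (simp add: f_def)
    let ?B = "P * \<Lambda> * (G powr (P - 2) * N)"
    let ?w = "\<lambda>z::'a. indicator (ball 0 r) z * norm z powr ((P - \<tau>) - real DIM('a))"
    have g_le: "\<bar>g z\<bar> \<le> ?B * ?w z" for z
    proof (cases "norm z < r \<and> z \<noteq> 0")
      case True
      then have z: "norm z < r" "z \<noteq> 0" "0 < norm z" by auto
      have "\<bar>g z\<bar> = \<bar>signed_pow P (w x - w (x + z)) + signed_pow P (w x - w (x - z))\<bar> * k z / 2"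
        using z f_eq [of z] f_eq [of "- z"] by (simp add: g_def k_even distrib_right [symmetric] abs_mult k_nonneg)
      also have "\<dots> \<le> \<bar>signed_pow P (w x - w (x + z)) + signed_pow P (w x - w (x - z))\<bar> * k z"
        using k_nonneg [of z] by (simp add: mult_nonneg_nonneg)
      also have "\<dots> \<le> (P * \<bar>(w x - w (x + z)) + (w x - w (x - z))\<bar> * (G * norm z) powr (P - 2)) * k z"
        using G [of z] G [of "- z"] z P
        by (intro mult_right_mono signed_pow_sum_le k_nonneg) (auto simp: abs_minus_commute)
      also have "\<dots> \<le> (P * (N * (norm z)\<^sup>2) * (G * norm z) powr (P - 2)) * (\<Lambda> * norm z powr (- (real DIM('a) + \<tau>)))"
        using N [of z] z P r GN
        by (intro mult_mono mult_right_mono mult_left_mono k_near) (auto simp: k_nonneg abs_minus_commute algebra_simps)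
      also have "\<dots> = ?B * (norm z powr 2 * norm z powr (P - 2) * norm z powr (- (real DIM('a) + \<tau>)))"
        using z GN by (simp add: powr_mult powr_numeral mult_ac)
      also have "norm z powr 2 * norm z powr (P - 2) * norm z powr (- (real DIM('a) + \<tau>)) = norm z powr ((P - \<tau>) - real DIM('a))"
        by (simp only: powr_add [symmetric]) (rule arg_cong [where f = "(powr) (norm z)"], simp)
      finally show ?thesis using z by simp
    next
      case False
      then have "g z = 0" using f_out [of z] f_out [of "- z"] f_eq [of 0] r by (auto simp: g_def signed_pow_def)
      then show ?thesis using P \<Lambda> GN by simp
    qed
    have g_int: "integrable lebesgue g"
    proof (rule Bochner_Integration.integrable_bound)
      show "integrable lebesgue (\<lambda>z. ?B * ?w z)" using C(2) [OF r(1)] by (intro integrable_mult_right) auto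
      show "g \<in> borel_measurable lebesgue" unfolding g_def [abs_def] by measurable
      show "AE z in lebesgue. norm (g z) \<le> norm (?B * ?w z)"
        by (rule AE_I2) (use g_le in \<open>simp, meson abs_ge_self order_trans\<close>)
    qed
    have "\<bar>integral\<^sup>L lebesgue g\<bar> \<le> (\<integral>z. ?B * ?w z \<partial>lebesgue)"
    proof -
      have "\<bar>integral\<^sup>L lebesgue g\<bar> \<le> (\<integral>z. \<bar>g z\<bar> \<partial>lebesgue)" by (rule integral_abs_bound)
      also have "\<dots> \<le> (\<integral>z. ?B * ?w z \<partial>lebesgue)"
        using g_int C(2) [OF r(1)] g_le by (intro integral_mono) auto
      finally show ?thesis .
    qed
    also have "\<dots> = ?B * integral\<^sup>L lebesgue ?w" by simp
    also have "\<dots> \<le> ?B * (C * r powr (P - \<tau>))"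
      using C(3) [OF r(1)] P \<Lambda> GN by (intro mult_left_mono) auto
    also have "\<dots> = (P * \<Lambda> * C) * (G powr (P - 2) * N * r powr (P - \<tau>))" by simp
    also have "\<dots> \<le> D * (G powr (P - 2) * N * r powr (P - \<tau>))"
      using GN by (intro mult_right_mono) (auto simp: D_def)
    finally have I: "\<bar>integral\<^sup>L lebesgue g\<bar> \<le> D * (G powr (P - 2) * N * r powr (P - \<tau>))" .
    let ?F = "\<lambda>\<epsilon> z. indicator {z. \<epsilon> < norm z \<and> norm z < r} z * (signed_pow P (w x - w (x + z)) * k z)"
    have F_eq: "?F \<epsilon> = (\<lambda>z. indicator {z. \<epsilon> < norm z} z * f z)" for \<epsilon>
      by (auto simp: fun_eq_iff indicator_def f_def)
    have meas_s [measurable]: "{z::'a. e < norm z} \<in> sets lebesgue" for e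
      by (intro sets_completionI_sets) simp
    have F_int: "integrable lebesgue (?F \<epsilon>)" if \<epsilon>: "0 < \<epsilon>" for \<epsilon>
    proof (rule Bochner_Integration.integrable_bound)
      let ?M = "(G * r) powr (P - 1) * (\<Lambda> * \<epsilon> powr (- (real DIM('a) + \<sigma>)))"
      show "integrable lebesgue (\<lambda>z::'a. ?M * indicator (ball 0 r) z)"
        by (intro integrable_mult_right integrable_real_indicator) (use r in \<open>auto simp: emeasure_ball less_imp_le\<close>)
      show "?F \<epsilon> \<in> borel_measurable lebesgue" unfolding F_eq by measurable
      show "AE z in lebesgue. norm (?F \<epsilon> z) \<le> norm (?M * indicator (ball 0 r) z)"
      proof (rule AE_I2)
        fix z :: 'a
        show "norm (?F \<epsilon> z) \<le> norm (?M * indicator (ball 0 r) z)"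
        proof (cases "\<epsilon> < norm z \<and> norm z < r")
          case True
          have "k z \<le> \<Lambda> * norm z powr (- (real DIM('a) + \<sigma>))" by (rule k_le)
          also have "\<dots> \<le> \<Lambda> * \<epsilon> powr (- (real DIM('a) + \<sigma>))"
            using True \<epsilon> \<sigma> \<Lambda> by (intro mult_left_mono powr_mono2') auto
          finally have "k z \<le> \<Lambda> * \<epsilon> powr (- (real DIM('a) + \<sigma>))" .
          moreover have "\<bar>w x - w (x + z)\<bar> powr (P - 1) \<le> (G * r) powr (P - 1)"
          proof (intro powr_mono2)
            have "\<bar>w x - w (x + z)\<bar> \<le> G * norm z" using G [of z] True by (simp add: abs_minus_commute)
            also have "\<dots> \<le> G * r" using True GN by (intro mult_left_mono) auto
            finally show "\<bar>w x - w (x + z)\<bar> \<le> G * r" .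
          qed (use P in auto)
          ultimately have "\<bar>w x - w (x + z)\<bar> powr (P - 1) * k z \<le> ?M"
            using k_nonneg [of z] by (intro mult_mono) auto
          then have "\<bar>signed_pow P (w x - w (x + z)) * k z\<bar> \<le> ?M"
            by (simp add: abs_mult abs_signed_pow k_nonneg)
          moreover have "?M \<le> norm ?M" by simp
          ultimately show ?thesis using True by (auto simp: indicator_def)
        qed auto
      qed
    qed
    have half: "integral\<^sup>L lebesgue (?F \<epsilon>) = (\<integral>z. indicator {z. \<epsilon> < norm z} z * g z \<partial>lebesgue)" if \<epsilon>: "0 < \<epsilon>" for \<epsilon>
    proof -
      note r = integral_reflect [OF F_int [OF \<epsilon>]]
      have "(\<integral>z. indicator {z. \<epsilon> < norm z} z * g z \<partial>lebesgue) = (\<integral>z. (?F \<epsilon> z + ?F \<epsilon> (- z)) / 2 \<partial>lebesgue)"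
        unfolding F_eq by (intro Bochner_Integration.integral_cong) (auto simp: g_def indicator_def f_eq f_out)
      also have "\<dots> = integral\<^sup>L lebesgue (?F \<epsilon>)"
        using r F_int [OF \<epsilon>] by (simp del: mult_minus_left)
      finally show ?thesis by simp
    qed
    have "((\<lambda>\<epsilon>. \<integral>z. indicator {z. \<epsilon> < norm z} z * g z \<partial>lebesgue) \<longlongrightarrow> integral\<^sup>L lebesgue g) (at_right 0)"
      by (rule integral_shrinking_hole [OF g_int]) (use g_le [of 0] in simp)
    then have lim: "((\<lambda>\<epsilon>. integral\<^sup>L lebesgue (?F \<epsilon>)) \<longlongrightarrow> integral\<^sup>L lebesgue g) (at_right 0)"
    proof (rule Lim_transform_eventually)
      show "\<forall>\<^sub>F \<epsilon> in at_right 0. (\<integral>z. indicator {z. \<epsilon> < norm z} z * g z \<partial>lebesgue) = integral\<^sup>L lebesgue (?F \<epsilon>)"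
        using eventually_at_right_less [of 0] by eventually_elim (simp add: half)
    qed
    show "\<exists>I. \<bar>I\<bar> \<le> D * (G powr (P - 2) * N * r powr (P - \<tau>)) \<and>
         (\<forall>\<epsilon>>0. integrable lebesgue (?F \<epsilon>)) \<and> ((\<lambda>\<epsilon>. integral\<^sup>L lebesgue (?F \<epsilon>)) \<longlongrightarrow> I) (at_right 0)"
      using I F_int lim by blast
  qed
qed

end


section \<open>Consequences of the viscosity inequality\<close>

abbreviation exterior_integral ::
  "real \<Rightarrow> ('a::euclidean_space \<Rightarrow> real) \<Rightarrow> ('a \<Rightarrow> real) \<Rightarrow> real \<Rightarrow> 'a \<Rightarrow> real"
where
  "exterior_integral P k u r x \<equiv>
     \<integral>z. indicator (- ball 0 r) z * (signed_pow P (u x - u (x + z)) * k z) \<partial>lebesgue"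

definition test_from_below ::
  "'a::euclidean_space set \<Rightarrow> ('a \<Rightarrow> real) \<Rightarrow> 'a \<Rightarrow> real \<Rightarrow> ('a \<Rightarrow> real) \<Rightarrow> real \<Rightarrow> real \<Rightarrow> bool"
where
  "test_from_below \<Omega> u x r \<psi> G N \<longleftrightarrow>
     0 < r \<and> r \<le> 1 \<and> ball x r \<subseteq> \<Omega> \<and> C2_on (ball x r) \<psi> \<and> \<psi> x = u x \<and> (\<forall>y\<in>ball x r. \<psi> y \<le> u y) \<and>
     0 \<le> G \<and> 0 \<le> N \<and>
     (\<forall>z. norm z < r \<longrightarrow> \<bar>\<psi> (x + z) - \<psi> x\<bar> \<le> G * norm z) \<and>
     (\<forall>z. norm z < r \<longrightarrow> \<bar>\<psi> (x + z) + \<psi> (x - z) - 2 * \<psi> x\<bar> \<le> N * (norm z)\<^sup>2)"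

text \<open>The operator at the test function splits into the principal value inside the ball, which
  \<open>near_symmetric\<close> bounds in terms of the test function, and the exterior integral of \<open>u\<close>
  itself. Since the radius of the ball is free in the definition of viscosity solutions, it may be chosen in terms of
  the distance of the doubled points, which is how the lemma is applied.\<close>

lemma visc_supersol_far_inequality:
  fixes kp kq :: "'a::euclidean_space \<Rightarrow> real"
  assumes kp: "phase_kernel p (s * p) \<tau>p \<Lambda>p kp" and kq: "phase_kernel q (t * q) \<tau>q \<Lambda>q kq"
    and kp_eq: "\<And>z. kp z = norm z powr (- (real DIM('a) + s * p))"
    and kq_eq: "\<And>x z. kq z = a x (x + z) * norm z powr (- (real DIM('a) + t * q))"
  obtains C where "0 < C"
    "\<And>u \<Omega> x r \<psi> G N. visc_supersol s t p q a \<Omega> u \<Longrightarrow> test_from_below \<Omega> u x r \<psi> G N \<Longrightarrow>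
       0 \<le> exterior_integral p kp u r x
         + exterior_integral q kq u r x
         + C * (G powr (p - 2) * N * r powr (p - \<tau>p) + G powr (q - 2) * N * r powr (q - \<tau>q))"
proof -
  interpret p: phase_kernel p "s * p" \<tau>p \<Lambda>p kp by (rule kp)
  interpret q: phase_kernel q "t * q" \<tau>q \<Lambda>q kq by (rule kq)
  obtain Cp where Cp: "0 < Cp" and Ip: "\<And>w x r G N. smooth_near w x r G N \<Longrightarrow>
       \<exists>I. \<bar>I\<bar> \<le> Cp * (G powr (p - 2) * N * r powr (p - \<tau>p)) \<and>
         (\<forall>\<epsilon>>0. integrable lebesgue (\<lambda>z. shell_integrand p kp w x r \<epsilon> z)) \<and>
         ((\<lambda>\<epsilon>. \<integral>z. shell_integrand p kp w x r \<epsilon> z \<partial>lebesgue) \<longlongrightarrow> I) (at_right 0)"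
    by (rule p.near_symmetric) blast
  obtain Cq where Cq: "0 < Cq" and Iq: "\<And>w x r G N. smooth_near w x r G N \<Longrightarrow>
       \<exists>I. \<bar>I\<bar> \<le> Cq * (G powr (q - 2) * N * r powr (q - \<tau>q)) \<and>
         (\<forall>\<epsilon>>0. integrable lebesgue (\<lambda>z. shell_integrand q kq w x r \<epsilon> z)) \<and>
         ((\<lambda>\<epsilon>. \<integral>z. shell_integrand q kq w x r \<epsilon> z \<partial>lebesgue) \<longlongrightarrow> I) (at_right 0)"
    by (rule q.near_symmetric) blast
  show ?thesis
  proof (rule that [of "Cp + Cq"])
    show "0 < Cp + Cq" using Cp Cq by simp
    fix u :: "'a \<Rightarrow> real" and \<Omega> x r \<psi> G N
    assume u: "visc_supersol s t p q a \<Omega> u" and test: "test_from_below \<Omega> u x r \<psi> G N"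
    have r: "0 < r" "r \<le> 1" and sub: "ball x r \<subseteq> \<Omega>"
      and C2: "C2_on (ball x r) \<psi>" and \<psi>: "\<psi> x = u x" "\<And>y. y \<in> ball x r \<Longrightarrow> \<psi> y \<le> u y"
      and GN: "0 \<le> G" "0 \<le> N"
      and G: "\<And>z. norm z < r \<Longrightarrow> \<bar>\<psi> (x + z) - \<psi> x\<bar> \<le> G * norm z"
      and N: "\<And>z. norm z < r \<Longrightarrow> \<bar>\<psi> (x + z) + \<psi> (x - z) - 2 * \<psi> x\<bar> \<le> N * (norm z)\<^sup>2"
      using test unfolding test_from_below_def by blast+
    define w where "w y = (if y \<in> ball x r then \<psi> y else u y)" for y
    have w_x: "w x = u x" using r \<psi> by (simp add: w_def)
    have w_in: "w (x + z) = \<psi> (x + z)" "w (x - z) = \<psi> (x - z)" if "norm z < r" for z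
      using that by (auto simp: w_def dist_norm)
    have w_out: "w (x + z) = u (x + z)" if "\<not> norm z < r" for z
      using that by (auto simp: w_def dist_norm)
    have tails: "u \<in> tail_space (p - 1) (s * p)" "u \<in> tail_space (q - 1) (t * q)"
      using u by (auto simp: visc_supersol_def)
    have "0 \<le> double_phase_op s t p q a (\<lambda>y. if y \<in> ball x r then \<psi> y else u y) x"
      using u r sub C2 \<psi> unfolding visc_supersol_def by blast
    then have op: "0 \<le> double_phase_op s t p q a w x" by (simp add: w_def [abs_def])
    have cont: "continuous_on (ball x r) \<psi>"
    proof -
      obtain D1 where "\<forall>y\<in>ball x r. (\<psi> has_derivative blinfun_apply (D1 y)) (at y)"
        using C2 unfolding C2_on_def by blast
      then show ?thesis
        by (intro differentiable_imp_continuous_on) (auto simp: differentiable_on_def differentiable_def intro: has_derivative_at_withinI)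
    qed
    have "(\<lambda>y. indicator (ball x r) y *\<^sub>R \<psi> y) \<in> borel_measurable borel"
      by (rule borel_measurable_continuous_on_indicator [OF _ cont]) simp
    then have "(\<lambda>y. indicator (ball x r) y *\<^sub>R \<psi> y) \<in> borel_measurable lebesgue"
      by (intro measurable_completion) simp
    then have "(\<lambda>z. indicator (ball x r) (x + 1 *\<^sub>R z) *\<^sub>R \<psi> (x + 1 *\<^sub>R z)) \<in> borel_measurable lebesgue"
      by (rule lebesgue_measurable_affine) simp
    also have "(\<lambda>z. indicator (ball x r) (x + 1 *\<^sub>R z) *\<^sub>R \<psi> (x + 1 *\<^sub>R z)) = (\<lambda>z. indicator (ball 0 r) z * w (x + z))"
      by (auto simp: fun_eq_iff indicator_def w_def dist_norm)
    finally have meas: "(\<lambda>z. indicator (ball 0 r) z * w (x + z)) \<in> borel_measurable lebesgue" .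
    have Gw: "\<bar>w (x + z) - w x\<bar> \<le> G * norm z" if "norm z < r" for z
      using G [OF that] w_in [OF that] w_x \<psi> by simp
    have Nw: "\<bar>w (x + z) + w (x - z) - 2 * w x\<bar> \<le> N * (norm z)\<^sup>2" if "norm z < r" for z
      using N [OF that] w_in [OF that] w_x \<psi> by simp
    have smooth: "smooth_near w x r G N"
      unfolding smooth_near_def using r GN meas Gw Nw by blast
    let ?hole = "\<lambda>\<epsilon>. indicator {z::'a. \<epsilon> < norm z \<and> norm z < r} :: 'a \<Rightarrow> real"
    let ?fp = "\<lambda>z. signed_pow p (w x - w (x + z)) * kp z"
    let ?fq = "\<lambda>z. signed_pow q (w x - w (x + z)) * kq z"
    let ?up = "\<lambda>z. indicator (- ball 0 r) z * (signed_pow p (u x - u (x + z)) * kp z)"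
    let ?uq = "\<lambda>z. indicator (- ball 0 r) z * (signed_pow q (u x - u (x + z)) * kq z)"
    obtain Jp where Jp: "\<bar>Jp\<bar> \<le> Cp * (G powr (p - 2) * N * r powr (p - \<tau>p))"
      "\<And>\<epsilon>. 0 < \<epsilon> \<Longrightarrow> integrable lebesgue (\<lambda>z. ?hole \<epsilon> z * ?fp z)"
      "((\<lambda>\<epsilon>. \<integral>z. ?hole \<epsilon> z * ?fp z \<partial>lebesgue) \<longlongrightarrow> Jp) (at_right 0)"
      using Ip [OF smooth] by auto
    obtain Jq where Jq: "\<bar>Jq\<bar> \<le> Cq * (G powr (q - 2) * N * r powr (q - \<tau>q))"
      "\<And>\<epsilon>. 0 < \<epsilon> \<Longrightarrow> integrable lebesgue (\<lambda>z. ?hole \<epsilon> z * ?fq z)"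
      "((\<lambda>\<epsilon>. \<integral>z. ?hole \<epsilon> z * ?fq z \<partial>lebesgue) \<longlongrightarrow> Jq) (at_right 0)"
      using Iq [OF smooth] by auto
    have up: "integrable lebesgue ?up" by (rule p.tail_integrable [OF tails(1) r(1)])
    have uq: "integrable lebesgue ?uq" by (rule q.tail_integrable [OF tails(2) r(1)])
    define F where "F y = signed_pow p (w x - w y) / norm (x - y) powr (real DIM('a) + s * p) +
       a x y * (signed_pow q (w x - w y) / norm (x - y) powr (real DIM('a) + t * q))" for y
    have F: "F (x + z) = ?fp z + ?fq z" for z
      unfolding F_def kp_eq kq_eq [of z x] powr_minus divide_inverse by (simp add: mult_ac)
    have split: "(\<lambda>z. indicator {z. \<epsilon> < norm z} z * F (x + z))
        = (\<lambda>z. (?up z + ?uq z) + (?hole \<epsilon> z * ?fp z + ?hole \<epsilon> z * ?fq z))" if "\<epsilon> < r" for \<epsilon>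
    proof
      fix z
      show "indicator {z. \<epsilon> < norm z} z * F (x + z) = (?up z + ?uq z) + (?hole \<epsilon> z * ?fp z + ?hole \<epsilon> z * ?fq z)"
        using that w_out [of z] w_x by (cases "norm z < r"; cases "\<epsilon> < norm z") (auto simp: F)
    qed
    have "pv_integral x F = ereal (integral\<^sup>L lebesgue ?up + integral\<^sup>L lebesgue ?uq + (Jp + Jq))"
    proof (rule pv_integral_eq [OF _ r(1)])
      fix \<epsilon> :: real assume \<epsilon>: "0 < \<epsilon>" "\<epsilon> < r"
      show "integrable lebesgue (\<lambda>z. indicator {z. \<epsilon> < norm z} z * F (x + z))"
        unfolding split [OF \<epsilon>(2)] using up uq Jp(2) [OF \<epsilon>(1)] Jq(2) [OF \<epsilon>(1)]
        by (intro Bochner_Integration.integrable_add)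
    next
      have "((\<lambda>\<epsilon>. integral\<^sup>L lebesgue ?up + integral\<^sup>L lebesgue ?uq +
          ((\<integral>z. ?hole \<epsilon> z * ?fp z \<partial>lebesgue) + (\<integral>z. ?hole \<epsilon> z * ?fq z \<partial>lebesgue)))
          \<longlongrightarrow> integral\<^sup>L lebesgue ?up + integral\<^sup>L lebesgue ?uq + (Jp + Jq)) (at_right 0)"
        by (intro tendsto_intros Jp(3) Jq(3))
      then show "((\<lambda>\<epsilon>. \<integral>z. indicator {z. \<epsilon> < norm z} z * F (x + z) \<partial>lebesgue)
          \<longlongrightarrow> integral\<^sup>L lebesgue ?up + integral\<^sup>L lebesgue ?uq + (Jp + Jq)) (at_right 0)"
      proof (rule Lim_transform_eventually)
        have "\<forall>\<^sub>F \<epsilon> in at_right 0. \<epsilon> \<in> {0<..<r}" using eventually_at_right_real [OF r(1)] .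
        then show "\<forall>\<^sub>F \<epsilon> in at_right 0. integral\<^sup>L lebesgue ?up + integral\<^sup>L lebesgue ?uq +
          ((\<integral>z. ?hole \<epsilon> z * ?fp z \<partial>lebesgue) + (\<integral>z. ?hole \<epsilon> z * ?fq z \<partial>lebesgue))
          = (\<integral>z. indicator {z. \<epsilon> < norm z} z * F (x + z) \<partial>lebesgue)"
        proof eventually_elim
          case (elim \<epsilon>)
          then have \<epsilon>: "0 < \<epsilon>" "\<epsilon> < r" by auto
          note ints = up uq Jp(2) [OF \<epsilon>(1)] Jq(2) [OF \<epsilon>(1)]
          show ?case
            unfolding split [OF \<epsilon>(2)]
            using Bochner_Integration.integral_add [OF Bochner_Integration.integrable_add [OF ints(1,2)] Bochner_Integration.integrable_add [OF ints(3,4)]]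
              Bochner_Integration.integral_add [OF ints(1,2)] Bochner_Integration.integral_add [OF ints(3,4)]
            by simp
        qed
      qed
    qed
    then have "double_phase_op s t p q a w x = ereal (integral\<^sup>L lebesgue ?up + integral\<^sup>L lebesgue ?uq + (Jp + Jq))"
      by (simp add: double_phase_op_def F_def [abs_def])
    then have "0 \<le> integral\<^sup>L lebesgue ?up + integral\<^sup>L lebesgue ?uq + (Jp + Jq)" using op by simp
    moreover have "Jp + Jq \<le> (Cp + Cq) * (G powr (p - 2) * N * r powr (p - \<tau>p) + G powr (q - 2) * N * r powr (q - \<tau>q))"
    proof -
      have "0 \<le> Cq * (G powr (p - 2) * N * r powr (p - \<tau>p))" "0 \<le> Cp * (G powr (q - 2) * N * r powr (q - \<tau>q))"
        using Cp Cq GN by auto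
      then show ?thesis using Jp(1) Jq(1) by (simp add: algebra_simps)
    qed
    ultimately show "0 \<le> integral\<^sup>L lebesgue ?up + integral\<^sup>L lebesgue ?uq
         + (Cp + Cq) * (G powr (p - 2) * N * r powr (p - \<tau>p) + G powr (q - 2) * N * r powr (q - \<tau>q))" by linarith
  qed
qed

section \<open>Twice differentiable test functions\<close>

lemma C2_on_const: "C2_on S (\<lambda>x::'a::euclidean_space. c)"
  unfolding C2_on_def
  by (rule exI [of _ "\<lambda>_. 0"], rule exI [of _ "\<lambda>_. 0"]) (auto simp: continuous_on_const zero_blinfun.rep_eq)

lemma C2_on_lincomb:
  assumes "C2_on S f" "C2_on S g"
  shows "C2_on S (\<lambda>x::'a::euclidean_space. A * f x + B * g x)"
proof -
  obtain D1 D2 where f: "\<And>x. x \<in> S \<Longrightarrow> (f has_derivative blinfun_apply (D1 x)) (at x)"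
    "\<And>x. x \<in> S \<Longrightarrow> (D1 has_derivative blinfun_apply (D2 x)) (at x)" "continuous_on S D2"
    using assms(1) unfolding C2_on_def by blast
  obtain E1 E2 where g: "\<And>x. x \<in> S \<Longrightarrow> (g has_derivative blinfun_apply (E1 x)) (at x)"
    "\<And>x. x \<in> S \<Longrightarrow> (E1 has_derivative blinfun_apply (E2 x)) (at x)" "continuous_on S E2"
    using assms(2) unfolding C2_on_def by blast
  show ?thesis
    unfolding C2_on_def
  proof (intro exI conjI ballI)
    fix x assume x: "x \<in> S"
    show "((\<lambda>x. A * f x + B * g x) has_derivative blinfun_apply (A *\<^sub>R D1 x + B *\<^sub>R E1 x)) (at x)"
      by (rule has_derivative_eq_rhs [OF has_derivative_add [OF has_derivative_mult_right [OF f(1) [OF x]] has_derivative_mult_right [OF g(1) [OF x]]]])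
        (auto simp: fun_eq_iff blinfun.bilinear_simps)
    show "((\<lambda>x. A *\<^sub>R D1 x + B *\<^sub>R E1 x) has_derivative blinfun_apply (A *\<^sub>R D2 x + B *\<^sub>R E2 x)) (at x)"
      by (rule has_derivative_eq_rhs [OF has_derivative_add [OF has_derivative_scaleR_right [OF f(2) [OF x]] has_derivative_scaleR_right [OF g(2) [OF x]]]])
        (auto simp: fun_eq_iff blinfun.bilinear_simps)
  next
    show "continuous_on S (\<lambda>x. A *\<^sub>R D2 x + B *\<^sub>R E2 x)"
      by (intro continuous_intros f(3) g(3))
  qed
qed

lemma has_derivative_inner_self:
  fixes y :: "'a::euclidean_space"
  shows "((\<lambda>x. (x - y) \<bullet> (x - y)) has_derivative (\<lambda>v. 2 * ((x - y) \<bullet> v))) (at x)"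
  by (auto intro!: derivative_eq_intros simp: inner_commute)

lemma blinfun_apply_Blinfun_inner_left:
  "blinfun_apply (Blinfun blinfun_inner_left) v = blinfun_inner_left (v :: 'a::euclidean_space)"
  by (simp add: bounded_linear_Blinfun_apply bounded_linear_blinfun_inner_left)

lemma has_derivative_blinfun_inner_left:
  "((\<lambda>x::'a::euclidean_space. blinfun_inner_left (x - y)) has_derivative blinfun_inner_left) (at x)"
  by (rule bounded_linear.has_derivative [OF bounded_linear_blinfun_inner_left, THEN has_derivative_eq_rhs])
    (auto intro!: derivative_eq_intros)

lemma C2_on_norm_squared: "C2_on S (\<lambda>x::'a::euclidean_space. (norm (x - y))\<^sup>2)"
  unfolding C2_on_def
proof (intro exI conjI ballI)
  fix x assume "x \<in> S"
  show "((\<lambda>x. (norm (x - y))\<^sup>2) has_derivative blinfun_apply (2 *\<^sub>R blinfun_inner_left (x - y))) (at x)"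
    unfolding power2_norm_eq_inner
    by (rule has_derivative_eq_rhs [OF has_derivative_inner_self]) (auto simp: fun_eq_iff scaleR_blinfun.rep_eq inner_commute)
  show "((\<lambda>x. 2 *\<^sub>R blinfun_inner_left (x - y)) has_derivative blinfun_apply (2 *\<^sub>R Blinfun blinfun_inner_left)) (at x)"
    by (rule has_derivative_eq_rhs [OF has_derivative_scaleR_right [OF has_derivative_blinfun_inner_left]])
      (auto simp: fun_eq_iff scaleR_blinfun.rep_eq blinfun_apply_Blinfun_inner_left)
qed (simp add: continuous_on_const)

text \<open>The function is \<open>n powr (\<beta> / 2)\<close> for the polynomial
  \<open>n x = (x - y) \<bullet> (x - y)\<close>, which is positive away from \<open>y\<close>.\<close>

lemma C2_on_norm_powr:
  fixes y :: "'a::euclidean_space"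
  assumes "y \<notin> S"
  shows "C2_on S (\<lambda>x. norm (x - y) powr \<beta>)"
proof -
  define n where "n x = (x - y) \<bullet> (x - y)" for x
  have n: "0 < n x" if "x \<in> S" for x using that assms by (auto simp: n_def)
  have norm_eq: "norm (x - y) powr \<beta> = n x powr (\<beta> / 2)" for x
  proof -
    have "norm (x - y) powr \<beta> = (norm (x - y) powr 2) powr (\<beta> / 2)" by (simp only: powr_powr) simp
    then show ?thesis by (simp add: n_def power2_norm_eq_inner)
  qed
  have n_deriv: "(n has_derivative (\<lambda>v. 2 * ((x - y) \<bullet> v))) (at x)" for x
    unfolding n_def [abs_def] by (rule has_derivative_inner_self)
  have powr_deriv: "((\<lambda>x. n x powr e) has_derivative (\<lambda>v. 2 * ((x - y) \<bullet> v) * (e * n x powr (e - 1)))) (at x)"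
    if "x \<in> S" for x e
    using n [OF that]
    by (intro DERIV_compose_FDERIV [OF _ n_deriv]) (auto intro!: has_real_derivative_powr)
  define D1 where "D1 x = (\<beta> * n x powr (\<beta> / 2 - 1)) *\<^sub>R blinfun_inner_left (x - y)" for x
  define D2 where "D2 x = (\<beta> * n x powr (\<beta> / 2 - 1)) *\<^sub>R Blinfun blinfun_inner_left
      + (\<beta> * (\<beta> - 2) * n x powr (\<beta> / 2 - 2)) *\<^sub>R (blinfun_scaleR_left (blinfun_inner_left (x - y)) o\<^sub>L blinfun_inner_left (x - y))" for x
  show ?thesis
    unfolding C2_on_def
  proof (intro exI conjI ballI)
    fix x assume x: "x \<in> S"
    show "((\<lambda>x. norm (x - y) powr \<beta>) has_derivative blinfun_apply (D1 x)) (at x)"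
      unfolding norm_eq
      by (rule has_derivative_eq_rhs [OF powr_deriv [OF x]])
        (auto simp: fun_eq_iff D1_def scaleR_blinfun.rep_eq inner_commute)
    show "(D1 has_derivative blinfun_apply (D2 x)) (at x)"
      unfolding D1_def [abs_def]
      by (rule has_derivative_eq_rhs [OF has_derivative_scaleR [OF has_derivative_mult_right [OF powr_deriv [OF x]] has_derivative_blinfun_inner_left]])
        (auto simp: fun_eq_iff D2_def blinfun.bilinear_simps blinfun_apply_Blinfun_inner_left inner_commute field_simps intro!: blinfun_eqI)
  next
    have "continuous_on S n" unfolding n_def [abs_def] by (intro continuous_intros)
    then have p: "continuous_on S (\<lambda>x. n x powr e)" for e
      using n by (intro continuous_intros) (auto simp: less_le)
    have l: "continuous_on S (\<lambda>x. blinfun_inner_left (x - y))"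
      by (intro bounded_linear.continuous_on [OF bounded_linear_blinfun_inner_left] continuous_intros)
    show "continuous_on S D2"
      unfolding D2_def [abs_def]
      by (intro continuous_intros p l bounded_linear.continuous_on [OF bounded_linear_blinfun_scaleR_left]
          bounded_bilinear.continuous_on [OF bounded_bilinear_blinfun_compose])
  qed
qed


section \<open>The regular part of the kernel\<close>

lemma powr_neg_lipschitz:
  fixes m m' e h :: real
  assumes "0 < h" "h \<le> m" "h \<le> m'" "\<bar>m - m'\<bar> \<le> h" "0 \<le> e"
  shows "\<bar>m powr (- e) - m' powr (- e)\<bar> \<le> (e * 2 powr (e + 1) / h) * \<bar>m - m'\<bar> * m powr (- e)"
proof -
  have main: "\<bar>v powr (- e) - w powr (- e)\<bar> \<le> (e * 2 powr (e + 1) / h) * (w - v) * m powr (- e)"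
    if "v \<le> w" "m / 2 \<le> v" "v = m \<or> w = m" for v w
  proof (cases "v = w")
    case False
    have v: "0 < v" "v < w" using that False assms by linarith+
    have "\<exists>\<xi>. v < \<xi> \<and> \<xi> < w \<and> w powr (- e) - v powr (- e) = (w - v) * (- e * \<xi> powr (- e - 1))"
      using v by (intro MVT2) (auto intro!: DERIV_cong [OF has_real_derivative_powr])
    then obtain \<xi> where \<xi>: "v < \<xi>" "\<xi> < w" "w powr (- e) - v powr (- e) = (w - v) * (- e * \<xi> powr (- e - 1))" by blast
    have "\<bar>v powr (- e) - w powr (- e)\<bar> = (w - v) * (e * \<xi> powr (- e - 1))"
    proof -
      have "v powr (- e) - w powr (- e) = (w - v) * (e * \<xi> powr (- e - 1))" using \<xi>(3) by simp
      moreover have "0 \<le> (w - v) * (e * \<xi> powr (- e - 1))" using v assms by simp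
      ultimately show ?thesis by simp
    qed
    also have "\<dots> \<le> (w - v) * (e * (m / 2) powr (- e - 1))"
      using \<xi> v assms that by (intro mult_left_mono powr_mono2') auto
    also have "(m / 2) powr (- e - 1) = 2 powr (e + 1) * (m powr (- e) / m)"
    proof -
      have "(m / 2) powr (- e - 1) = m powr (- e - 1) / 2 powr (- e - 1)" using assms by (simp add: powr_divide)
      also have "m powr (- e - 1) = m powr (- e) / m" using assms by (simp add: powr_diff)
      also have "(2::real) powr (- e - 1) = 1 / 2 powr (e + 1)" using powr_minus_divide [of 2 "e + 1"] by simp
      finally show ?thesis by simp
    qed
    also have "(w - v) * (e * (2 powr (e + 1) * (m powr (- e) / m))) \<le> (w - v) * (e * (2 powr (e + 1) * (m powr (- e) / h)))"
      using v assms by (intro mult_left_mono divide_left_mono) auto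
    finally show ?thesis by (simp add: mult_ac)
  qed simp
  have "m / 2 \<le> m'" using assms by linarith
  then show ?thesis
    using main [of m m'] main [of m' m] assms by (cases "m \<le> m'") (auto simp: abs_minus_commute)
qed

text \<open>The kernel is truncated at the radius \<open>h\<close>: the part \<open>kfar\<close> below is bounded and
  Hoelder continuous, and \<open>k - kfar\<close> is supported in the ball of radius \<open>h\<close>, where the
  regularity of \<open>u\<close> is under control.\<close>

locale holder_phase = phase_kernel P \<sigma> \<tau> \<Lambda> k
  for P \<sigma> \<tau> \<Lambda> :: real and k :: "'a::euclidean_space \<Rightarrow> real" +
  fixes b :: "'a \<Rightarrow> real" and B H \<alpha> h :: real
  assumes k_eq: "k z = b z * norm z powr (- (real DIM('a) + \<sigma>))"
    and b_borel: "b \<in> borel_measurable borel"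
    and b_nonneg: "0 \<le> b z" and b_le: "b z \<le> B"
    and b_holder: "\<bar>b z - b z'\<bar> \<le> H * norm (z - z') powr \<alpha>"
    and \<alpha>: "0 < \<alpha>" "\<alpha> \<le> 1" and h: "0 < h" "h \<le> 1" and H: "0 \<le> H"
begin

definition kfar :: "'a \<Rightarrow> real" where
  "kfar z = b z * max (norm z) h powr (- (real DIM('a) + \<sigma>))"

lemma B: "0 \<le> B" using b_nonneg b_le order_trans by blast

lemma kfar_nonneg: "0 \<le> kfar z" by (simp add: kfar_def b_nonneg)

lemma kfar_lebesgue [measurable]: "kfar \<in> borel_measurable lebesgue"
proof -
  have [measurable]: "b \<in> borel_measurable borel" by (rule b_borel)
  show ?thesis unfolding kfar_def [abs_def] by (intro measurable_completion) measurable
qed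

lemma kfar_le_k: "z \<noteq> 0 \<Longrightarrow> kfar z \<le> k z"
  using \<sigma> by (auto simp: kfar_def k_eq intro!: mult_left_mono powr_mono2' b_nonneg)

lemma kfar_eq_k: "h \<le> norm z \<Longrightarrow> kfar z = k z"
  by (simp add: kfar_def k_eq max_absorb1)

lemma kfar_near: "norm z \<le> h \<Longrightarrow> kfar z \<le> B * h powr (- (real DIM('a) + \<sigma>))"
  by (simp add: kfar_def max_absorb2 b_le mult_right_mono)

lemma kfar_holder:
  obtains C where "0 \<le> C"
    "\<And>z z'. norm (z - z') \<le> h \<Longrightarrow>
      \<bar>kfar z - kfar z'\<bar> \<le> C * norm (z - z') powr \<alpha> * max (norm z) h powr (- (real DIM('a) + \<sigma>))"
proof -
  define e where "e = real DIM('a) + \<sigma>"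
  define C where "C = H + B * (e * 2 powr (e + 1) / h)"
  have e: "0 \<le> e" using \<sigma> by (simp add: e_def)
  show ?thesis
  proof (rule that [of C])
    show "0 \<le> C" using H B e h by (simp add: C_def)
    fix z z' :: 'a
    assume zz: "norm (z - z') \<le> h"
    define m m' where "m = max (norm z) h" and "m' = max (norm z') h"
    have mm: "\<bar>m - m'\<bar> \<le> norm (z - z')"
      using norm_triangle_ineq3 [of z z'] by (auto simp: m_def m'_def max_def abs_le_iff)
    have t: "norm (z - z') \<le> norm (z - z') powr \<alpha>"
      using powr_mono' [of \<alpha> 1 "norm (z - z')"] zz h \<alpha> by simp
    have "\<bar>kfar z - kfar z'\<bar> = \<bar>(b z - b z') * m powr (- e) + b z' * (m powr (- e) - m' powr (- e))\<bar>"
      by (simp add: kfar_def m_def m'_def e_def algebra_simps)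
    also have "\<dots> \<le> \<bar>b z - b z'\<bar> * m powr (- e) + b z' * \<bar>m powr (- e) - m' powr (- e)\<bar>"
      by (rule order_trans [OF abs_triangle_ineq]) (simp add: abs_mult b_nonneg)
    also have "\<dots> \<le> (H * norm (z - z') powr \<alpha>) * m powr (- e) + B * ((e * 2 powr (e + 1) / h) * norm (z - z') powr \<alpha> * m powr (- e))"
    proof (intro add_mono mult_mono mult_right_mono b_holder b_le)
      have "\<bar>m powr (- e) - m' powr (- e)\<bar> \<le> (e * 2 powr (e + 1) / h) * \<bar>m - m'\<bar> * m powr (- e)"
        using h e mm zz by (intro powr_neg_lipschitz) (auto simp: m_def m'_def)
      also have "\<dots> \<le> (e * 2 powr (e + 1) / h) * norm (z - z') powr \<alpha> * m powr (- e)"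
        using h e mm t by (intro mult_right_mono mult_left_mono) auto
      finally show "\<bar>m powr (- e) - m' powr (- e)\<bar> \<le> (e * 2 powr (e + 1) / h) * norm (z - z') powr \<alpha> * m powr (- e)" .
    qed (use B H in auto)
    also have "\<dots> = C * norm (z - z') powr \<alpha> * m powr (- e)" by (simp add: C_def algebra_simps)
    finally show "\<bar>kfar z - kfar z'\<bar> \<le> C * norm (z - z') powr \<alpha> * max (norm z) h powr (- (real DIM('a) + \<sigma>))"
      by (simp add: m_def e_def)
  qed
qed

lemma kfar_integrable:
  assumes u: "u \<in> tail_space (P - 1) \<sigma>"
  shows "integrable lebesgue (\<lambda>z. signed_pow P (c - u (x + z)) * kfar z)"
proof -
  let ?e = "real DIM('a) + \<sigma>"
  define C where "C = 2 powr (P - 1) * (B * ((1 + norm x) / h + 1) powr ?e)"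
  let ?W = "\<lambda>w. (\<bar>c\<bar> powr (P - 1) + \<bar>u w\<bar> powr (P - 1)) * (1 + norm w) powr (- ?e)"
  have W: "integrable lebesgue ?W" by (rule tail_weight_integrable [OF \<sigma> u])
  then have "integrable lebesgue (\<lambda>z. ?W (x + 1 *\<^sub>R z))"
    by (subst lebesgue_integrable_affine_iff) auto
  then have W': "integrable lebesgue (\<lambda>z. C * ?W (x + z))" by simp
  have [measurable]: "u \<in> borel_measurable lebesgue" using u by (simp add: tail_space_def)
  have [measurable]: "(\<lambda>z. u (x + z)) \<in> borel_measurable lebesgue"
    using lebesgue_measurable_affine [of u 1 x] by simp
  show ?thesis
  proof (rule Bochner_Integration.integrable_bound [OF W'])
    show "AE z in lebesgue. norm (signed_pow P (c - u (x + z)) * kfar z) \<le> norm (C * ?W (x + z))"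
    proof (rule AE_I2)
      fix z
      have "norm (signed_pow P (c - u (x + z)) * kfar z) = \<bar>c - u (x + z)\<bar> powr (P - 1) * kfar z"
        by (simp add: abs_mult abs_signed_pow kfar_nonneg)
      also have "\<dots> \<le> (2 powr (P - 1) * (\<bar>c\<bar> powr (P - 1) + \<bar>u (x + z)\<bar> powr (P - 1)))
          * (B * (((1 + norm x) / h + 1) powr ?e * (1 + norm (x + z)) powr (- ?e)))"
      proof (intro mult_mono abs_le_two_powr kfar_nonneg)
        show "kfar z \<le> B * (((1 + norm x) / h + 1) powr ?e * (1 + norm (x + z)) powr (- ?e))"
          unfolding kfar_def using h \<sigma> B by (intro mult_mono b_le weight_le) auto
      qed (use P in auto)
      also have "\<dots> = C * ?W (x + z)" by (simp add: C_def mult_ac)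
      finally show "norm (signed_pow P (c - u (x + z)) * kfar z) \<le> norm (C * ?W (x + z))" by simp
    qed
    show "(\<lambda>z. signed_pow P (c - u (x + z)) * kfar z) \<in> borel_measurable lebesgue" by measurable
  qed
qed

text \<open>The values \<open>u (x + z)\<close> and \<open>u (y + z)\<close> are unrelated for large \<open>z\<close>.
  After the substitutions \<open>w = x + z\<close> and \<open>w = y + z\<close> both integrals involve the same
  \<open>u w\<close>; then \<open>u y \<le> u x\<close> and monotonicity give the right sign, and only the difference
  of the translated kernels is lost.\<close>

lemma kfar_difference_lower:
  assumes u: "u \<in> tail_space (P - 1) \<sigma>" and S: "0 \<le> S"
  obtains C where "0 \<le> C"
    "\<And>x y. norm y \<le> 2 \<Longrightarrow> \<bar>u y\<bar> \<le> S \<Longrightarrow> u y \<le> u x \<Longrightarrow> norm (x - y) \<le> h \<Longrightarrow>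
      - C * norm (x - y) powr \<alpha> \<le> (\<integral>z. signed_pow P (u x - u (x + z)) * kfar z - signed_pow P (u y - u (y + z)) * kfar z \<partial>lebesgue)"
proof -
  define e where "e = real DIM('a) + \<sigma>"
  obtain Ch where Ch: "0 \<le> Ch" "\<And>z z'. norm (z - z') \<le> h \<Longrightarrow>
      \<bar>kfar z - kfar z'\<bar> \<le> Ch * norm (z - z') powr \<alpha> * max (norm z) h powr (- e)"
    using kfar_holder unfolding e_def by blast
  define W where "W w = (S powr (P - 1) + \<bar>u w\<bar> powr (P - 1)) * (1 + norm w) powr (- e)" for w
  have W: "integrable lebesgue W"
    unfolding W_def [abs_def] e_def by (rule tail_weight_integrable [OF \<sigma> u])
  have Wn: "0 \<le> W w" for w by (simp add: W_def)
  define D where "D = 2 powr (P - 1) * (Ch * ((1 + 2) / h + 1) powr e)"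
  show ?thesis
  proof (rule that [of "D * integral\<^sup>L lebesgue W"])
    show "0 \<le> D * integral\<^sup>L lebesgue W" using Ch Wn by (simp add: D_def)
    fix x y :: 'a
    assume y: "norm y \<le> 2" "\<bar>u y\<bar> \<le> S" and le: "u y \<le> u x" and xy: "norm (x - y) \<le> h"
    let ?F = "\<lambda>x w. signed_pow P (u x - u w) * kfar (w - x)"
    let ?G = "\<lambda>x z. signed_pow P (u x - u (x + z)) * kfar z"
    have G: "integrable lebesgue (?G x)" for x by (rule kfar_integrable [OF u])
    have FG: "?F x = (\<lambda>w. ?G x (- x + 1 *\<^sub>R w))" for x by (simp add: fun_eq_iff)
    have F: "integrable lebesgue (?F x)" "integral\<^sup>L lebesgue (?F x) = integral\<^sup>L lebesgue (?G x)" for x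
      using lebesgue_integrable_affine_iff [of "?G x" 1 "- x"] lebesgue_integral_affine(3) [of "?G x" 1 "- x"] G [of x]
      unfolding FG by auto
    have pt: "- (D * norm (x - y) powr \<alpha>) * W w \<le> ?F x w - ?F y w" for w
    proof -
      have "\<bar>signed_pow P (u y - u w) * (kfar (w - y) - kfar (w - x))\<bar>
          = \<bar>u y - u w\<bar> powr (P - 1) * \<bar>kfar (w - y) - kfar (w - x)\<bar>"
        by (simp add: abs_mult abs_signed_pow)
      also have "\<dots> \<le> (2 powr (P - 1) * (S powr (P - 1) + \<bar>u w\<bar> powr (P - 1)))
          * (Ch * norm (x - y) powr \<alpha> * (((1 + 2) / h + 1) powr e * (1 + norm w) powr (- e)))"
      proof (intro mult_mono)
        have "\<bar>u y - u w\<bar> powr (P - 1) \<le> 2 powr (P - 1) * (\<bar>u y\<bar> powr (P - 1) + \<bar>u w\<bar> powr (P - 1))"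
          using P by (intro abs_le_two_powr) auto
        also have "\<dots> \<le> 2 powr (P - 1) * (S powr (P - 1) + \<bar>u w\<bar> powr (P - 1))"
          using y P by (intro mult_left_mono add_right_mono powr_mono2) auto
        finally show "\<bar>u y - u w\<bar> powr (P - 1) \<le> 2 powr (P - 1) * (S powr (P - 1) + \<bar>u w\<bar> powr (P - 1))" .
        have "\<bar>kfar (w - y) - kfar (w - x)\<bar> \<le> Ch * norm ((w - y) - (w - x)) powr \<alpha> * max (norm (w - y)) h powr (- e)"
          using xy by (intro Ch(2)) simp
        also have "norm ((w - y) - (w - x)) = norm (x - y)" by simp
        also have "max (norm (w - y)) h powr (- e) \<le> ((1 + 2) / h + 1) powr e * (1 + norm (y + (w - y))) powr (- e)"
          using h \<sigma> y by (intro weight_le) (auto simp: e_def)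
        finally show "\<bar>kfar (w - y) - kfar (w - x)\<bar> \<le> Ch * norm (x - y) powr \<alpha> * (((1 + 2) / h + 1) powr e * (1 + norm w) powr (- e))"
          using Ch(1) by (simp add: mult_left_mono)
      qed auto
      also have "\<dots> = (D * norm (x - y) powr \<alpha>) * W w" by (simp add: D_def W_def mult_ac)
      finally have 1: "- ((D * norm (x - y) powr \<alpha>) * W w) \<le> signed_pow P (u y - u w) * (kfar (w - x) - kfar (w - y))"
        by (simp add: abs_le_iff algebra_simps)
      have "signed_pow P (u y - u w) * kfar (w - x) \<le> signed_pow P (u x - u w) * kfar (w - x)"
        using P le by (intro mult_right_mono signed_pow_mono kfar_nonneg) auto
      then show ?thesis using 1 by (simp add: algebra_simps)
    qed
    have "- (D * integral\<^sup>L lebesgue W) * norm (x - y) powr \<alpha> = (\<integral>w. - (D * norm (x - y) powr \<alpha>) * W w \<partial>lebesgue)"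
      by simp
    also have "\<dots> \<le> (\<integral>w. ?F x w - ?F y w \<partial>lebesgue)"
      using W F(1) pt by (intro integral_mono) auto
    also have "\<dots> = integral\<^sup>L lebesgue (?G x) - integral\<^sup>L lebesgue (?G y)"
      using F by simp
    also have "\<dots> = (\<integral>z. ?G x z - ?G y z \<partial>lebesgue)" using G by simp
    finally show "- (D * integral\<^sup>L lebesgue W) * norm (x - y) powr \<alpha> \<le> (\<integral>z. ?G x z - ?G y z \<partial>lebesgue)" .
  qed
qed

end


section \<open>Lower bound for the difference of the operators at a maximum point\<close>

context phase_kernel begin

text \<open>If the difference at \<open>x\<close> is at least the one at \<open>y\<close> minus \<open>e\<close>, the
  nonlinearity loses at most its Lipschitz constant times \<open>e\<close>; known Hoelder regularity of
  \<open>u\<close> makes that constant a positive power of \<open>norm z\<close>.\<close>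

lemma ring_lower:
  assumes z: "z \<noteq> 0" "norm z \<le> 1" and k': "0 \<le> k'" "k' \<le> k z"
    and e: "0 \<le> e" "e \<le> C2 * norm z powr \<kappa>" and d2: "\<bar>d2\<bar> \<le> C1 * norm z powr \<kappa>"
    and d: "d2 - e \<le> d1" and E: "e \<le> M * norm z powr \<beta>" and C: "0 \<le> C1" "0 \<le> C2" "0 \<le> M"
    and \<epsilon>: "\<epsilon> \<le> \<beta> + \<kappa> * (P - 2) - \<tau>"
  shows "- (P * (C1 + C2) powr (P - 2) * \<Lambda> * M * norm z powr (\<epsilon> - real DIM('a)))
    \<le> (signed_pow P d1 - signed_pow P d2) * k'"
proof -
  let ?n = "norm z"
  have n: "0 < ?n" using z by simp
  have "\<bar>signed_pow P (d2 - e) - signed_pow P d2\<bar> \<le> P * \<bar>(d2 - e) - d2\<bar> * ((C1 + C2) * ?n powr \<kappa>) powr (P - 2)"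
  proof (rule signed_pow_lipschitz [OF P])
    show "\<bar>d2 - e\<bar> \<le> (C1 + C2) * ?n powr \<kappa>" using e d2 by (simp add: algebra_simps)
    have "C1 * ?n powr \<kappa> \<le> (C1 + C2) * ?n powr \<kappa>" using C by (intro mult_right_mono) auto
    then show "\<bar>d2\<bar> \<le> (C1 + C2) * ?n powr \<kappa>" using d2 by linarith
  qed
  also have "((C1 + C2) * ?n powr \<kappa>) powr (P - 2) = (C1 + C2) powr (P - 2) * ?n powr (\<kappa> * (P - 2))"
    using C n by (simp add: powr_mult powr_powr)
  finally have "signed_pow P d2 - signed_pow P (d2 - e) \<le> P * e * ((C1 + C2) powr (P - 2) * ?n powr (\<kappa> * (P - 2)))"
    using e by simp
  moreover have "signed_pow P (d2 - e) \<le> signed_pow P d1" using P d by (intro signed_pow_mono) auto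
  ultimately have 1: "- (P * e * ((C1 + C2) powr (P - 2) * ?n powr (\<kappa> * (P - 2)))) \<le> signed_pow P d1 - signed_pow P d2"
    by linarith
  have "P * e * ((C1 + C2) powr (P - 2) * ?n powr (\<kappa> * (P - 2))) * k'
      \<le> P * (M * ?n powr \<beta>) * ((C1 + C2) powr (P - 2) * ?n powr (\<kappa> * (P - 2))) * (\<Lambda> * ?n powr (- (real DIM('a) + \<tau>)))"
  proof (intro mult_mono)
    show "k' \<le> \<Lambda> * ?n powr (- (real DIM('a) + \<tau>))" using k_near [OF z(2)] k' by linarith
  qed (use E e P k' C in auto)
  also have "\<dots> = P * (C1 + C2) powr (P - 2) * \<Lambda> * M * (?n powr \<beta> * ?n powr (\<kappa> * (P - 2)) * ?n powr (- (real DIM('a) + \<tau>)))"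
    by (simp add: mult_ac)
  also have "?n powr \<beta> * ?n powr (\<kappa> * (P - 2)) * ?n powr (- (real DIM('a) + \<tau>)) = ?n powr (\<beta> + \<kappa> * (P - 2) - \<tau> - real DIM('a))"
    by (simp only: powr_add [symmetric]) (rule arg_cong [where f = "(powr) ?n"], simp)
  also have "P * (C1 + C2) powr (P - 2) * \<Lambda> * M * ?n powr (\<beta> + \<kappa> * (P - 2) - \<tau> - real DIM('a))
      \<le> P * (C1 + C2) powr (P - 2) * \<Lambda> * M * ?n powr (\<epsilon> - real DIM('a))"
    using n z \<epsilon> P C \<Lambda> by (intro mult_left_mono powr_mono') auto
  finally have 2: "P * e * ((C1 + C2) powr (P - 2) * ?n powr (\<kappa> * (P - 2))) * k'
      \<le> P * (C1 + C2) powr (P - 2) * \<Lambda> * M * ?n powr (\<epsilon> - real DIM('a))" .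
  have "- (P * e * ((C1 + C2) powr (P - 2) * ?n powr (\<kappa> * (P - 2)))) * k' \<le> (signed_pow P d1 - signed_pow P d2) * k'"
    using 1 k' by (intro mult_right_mono) auto
  then show ?thesis using 2 by (simp only: mult_minus_left)
qed

end

text \<open>What is known at a maximum point \<open>(x, y)\<close> of the doubled functional: the Hoelder bounds with
  exponent \<open>\<kappa>\<close>, the loss \<open>m * ...\<close> in a simultaneous translation (from the quadratic
  penalty), and the gain \<open>g\<close> for increments close to half way from \<open>x\<close> to
  \<open>y\<close>.\<close>

definition doubling_pair ::
  "('a::euclidean_space \<Rightarrow> real) \<Rightarrow> real \<Rightarrow> real \<Rightarrow> real \<Rightarrow> real \<Rightarrow> real \<Rightarrow> 'a \<Rightarrow> 'a \<Rightarrow> real \<Rightarrow> real \<Rightarrow> bool"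
where
  "doubling_pair u h \<kappa> K m S x y g \<eta> \<longleftrightarrow>
     0 < norm (x - y) \<and> norm (x - y) \<le> h / 2 \<and> norm y \<le> 2 \<and> \<bar>u y\<bar> \<le> S \<and> u y \<le> u x \<and>
     (\<forall>z. norm z < h \<longrightarrow> \<bar>u (x + z) - u (y + z)\<bar> \<le> K * norm (x - y) powr \<kappa>) \<and>
     (\<forall>z. norm z < h \<longrightarrow> \<bar>u x - u (x + z)\<bar> \<le> K * norm z powr \<kappa>) \<and>
     (\<forall>z. norm z < h \<longrightarrow> \<bar>u y - u (y + z)\<bar> \<le> K * norm z powr \<kappa>) \<and>
     (\<forall>z. norm z < h \<longrightarrow>
        u (x + z) - u (y + z) \<le> u x - u y + m * (norm (x - y) powr (\<kappa> / 2) * norm z + (norm z)\<^sup>2)) \<and>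
     0 \<le> g \<and> 0 < \<eta> \<and> \<eta> \<le> 1 / 4 \<and>
     (\<forall>z. norm (z + (x - y) /\<^sub>R 2) \<le> \<eta> * norm (x - y) \<longrightarrow> g \<le> (u x - u (x + z)) - (u y - u (y + z)))"

context holder_phase begin

text \<open>For \<open>norm z \<le> h / 2\<close> at least half of the kernel belongs to the singular part.\<close>

lemma gain_lower:
  assumes a: "0 < a" "a \<le> h / 2" and z: "a / 4 \<le> norm z" "norm z \<le> 3 * a / 4" and g: "0 \<le> g" "g \<le> d1 - d2"
    and \<beta>: "0 \<le> \<beta>" "\<beta> \<le> b z"
  shows "2 powr (1 - P) * (1 / 2) * (\<beta> * g powr (P - 1) * a powr (- (real DIM('a) + \<sigma>)))
    \<le> (signed_pow P d1 - signed_pow P d2) * (k z - kfar z)"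
proof -
  let ?e = "real DIM('a) + \<sigma>" and ?n = "norm z"
  have n: "0 < ?n" "?n \<le> h / 2" "?n \<le> a" using z a by linarith+
  have e: "1 \<le> ?e" using \<sigma> DIM_positive [where 'a = 'a] by linarith
  have "k z - kfar z = b z * (?n powr (- ?e) - h powr (- ?e))"
    using n h by (simp add: k_eq kfar_def max_absorb2 right_diff_distrib)
  moreover have "?n powr (- ?e) / 2 \<le> ?n powr (- ?e) - h powr (- ?e)"
  proof -
    have "h powr (- ?e) \<le> (2 * ?n) powr (- ?e)" using n e by (intro powr_mono2') auto
    also have "\<dots> = 2 powr (- ?e) * ?n powr (- ?e)" using n by (simp add: powr_mult)
    also have "\<dots> \<le> 2 powr (- 1) * ?n powr (- ?e)" using e by (intro mult_right_mono powr_mono) auto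
    finally show ?thesis by (simp add: powr_minus)
  qed
  moreover have "a powr (- ?e) \<le> ?n powr (- ?e)" using n e by (intro powr_mono2') auto
  ultimately have "a powr (- ?e) / 2 \<le> ?n powr (- ?e) - h powr (- ?e)" "k z - kfar z = b z * (?n powr (- ?e) - h powr (- ?e))"
    by linarith+
  then have kk: "\<beta> * (a powr (- ?e) / 2) \<le> k z - kfar z"
    using \<beta> by (simp only:) (intro mult_mono, auto)
  have "2 powr (1 - P) * g powr (P - 1) \<le> 2 powr (1 - P) * (d1 - d2) powr (P - 1)"
    using g P by (intro mult_left_mono powr_mono2) auto
  also have "\<dots> \<le> signed_pow P d1 - signed_pow P d2" using g P by (intro signed_pow_gap) auto
  finally have J: "2 powr (1 - P) * g powr (P - 1) \<le> signed_pow P d1 - signed_pow P d2" .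
  have "0 \<le> 2 powr (1 - P) * g powr (P - 1)" by simp
  with J have J0: "0 \<le> signed_pow P d1 - signed_pow P d2" by linarith
  have "(2 powr (1 - P) * g powr (P - 1)) * (\<beta> * (a powr (- ?e) / 2)) \<le> (signed_pow P d1 - signed_pow P d2) * (k z - kfar z)"
    by (rule mult_mono [OF J kk J0]) (use \<beta> in simp)
  then show ?thesis by (simp add: mult_ac)
qed

text \<open>The exterior integrals are compared pointwise: on the small ball around \<open>- (x - y) / 2\<close> by
  the gain, for \<open>norm z < sqrt a\<close> by the penalty, and for \<open>sqrt a \<le> norm z < h\<close> by the
  Hoelder bound between \<open>x + z\<close> and \<open>y + z\<close>. Up to the radius \<open>sqrt a\<close> the
  quadratic part \<open>(norm z)\<^sup>2\<close> of the penalty is dominated by the linear part. The exponents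
  \<open>e1\<close> and \<open>e2\<close> are those of the two error integrals; they are taken negative so that these
  integrals are governed by the inner radius.\<close>

lemma phase_difference_lower:
  assumes u: "u \<in> tail_space (P - 1) \<sigma>"
    and \<kappa>: "0 \<le> \<kappa>" "\<kappa> \<le> 1" and \<theta>: "0 < \<theta>'"
    and e1: "e1 < 0" "e1 \<le> 1 + \<kappa> * (P - 2) - \<tau>" and e2: "e2 < 0" "e2 \<le> \<kappa> * (P - 2) - \<tau>"
    and \<omega>: "\<omega> \<le> \<alpha>" "\<omega> \<le> \<kappa> / 2 + (1 + \<theta>') * e1" "\<omega> \<le> \<kappa> + e2 / 2"
    and SK: "0 \<le> S" "0 \<le> K" "0 \<le> m"
  obtains c C where "0 < c" "0 < C"
    "\<And>x y g \<eta> \<beta> a \<rho>. doubling_pair u h \<kappa> K m S x y g \<eta> \<Longrightarrow> a = norm (x - y) \<Longrightarrow> \<rho> = a powr (1 + \<theta>') / 4 \<Longrightarrow>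
      0 \<le> \<beta> \<Longrightarrow> (\<And>z. norm z \<le> h \<Longrightarrow> \<beta> \<le> b z) \<Longrightarrow>
      c * \<beta> * g powr (P - 1) * (\<eta> * a) powr real DIM('a) * a powr (- (real DIM('a) + \<sigma>)) - C * a powr \<omega>
      \<le> exterior_integral P k u \<rho> x
        - exterior_integral P k u \<rho> y"
proof -
  define d where "d = real DIM('a)"
  have d1: "1 \<le> d" using DIM_positive [where 'a = 'a] unfolding d_def by linarith
  obtain Cf where Cf: "0 \<le> Cf" "\<And>x y. norm y \<le> 2 \<Longrightarrow> \<bar>u y\<bar> \<le> S \<Longrightarrow> u y \<le> u x \<Longrightarrow> norm (x - y) \<le> h \<Longrightarrow>
      - Cf * norm (x - y) powr \<alpha> \<le> (\<integral>z. signed_pow P (u x - u (x + z)) * kfar z - signed_pow P (u y - u (y + z)) * kfar z \<partial>lebesgue)"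
    using kfar_difference_lower [OF u SK(1)] by blast
  obtain C1 where C1: "0 < C1"
    "\<And>\<rho>. 0 < \<rho> \<Longrightarrow> integrable lebesgue (\<lambda>z::'a. indicator (- ball 0 \<rho>) z * norm z powr (e1 - d))"
    "\<And>\<rho>. 0 < \<rho> \<Longrightarrow> integral\<^sup>L lebesgue (\<lambda>z::'a. indicator (- ball 0 \<rho>) z * norm z powr (e1 - d)) \<le> C1 * \<rho> powr e1"
    by (rule integral_norm_powr_outside [where 'a = 'a and \<beta> = "- e1"]) (use e1 in \<open>auto simp: d_def\<close>)
  obtain C2 where C2: "0 < C2"
    "\<And>\<rho>. 0 < \<rho> \<Longrightarrow> integrable lebesgue (\<lambda>z::'a. indicator (- ball 0 \<rho>) z * norm z powr (e2 - d))"
    "\<And>\<rho>. 0 < \<rho> \<Longrightarrow> integral\<^sup>L lebesgue (\<lambda>z::'a. indicator (- ball 0 \<rho>) z * norm z powr (e2 - d)) \<le> C2 * \<rho> powr e2"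
    by (rule integral_norm_powr_outside [where 'a = 'a and \<beta> = "- e2"]) (use e2 in \<open>auto simp: d_def\<close>)
  define V where "V = unit_ball_vol d"
  have V: "0 < V" using d1 by (simp add: V_def)
  define A1 where "A1 = P * (K + 2 * m) powr (P - 2) * \<Lambda> * (2 * m)"
  define A2 where "A2 = P * (K + K) powr (P - 2) * \<Lambda> * K"
  have A: "0 \<le> A1" "0 \<le> A2" using P SK \<Lambda> by (auto simp: A1_def A2_def)
  define A3 where "A3 = 2 * K powr (P - 1) * (B * h powr (- (d + \<sigma>)))"
  have A3: "0 \<le> A3" using B by (simp add: A3_def)
  define c where "c = 2 powr (1 - P) * (1 / 2) * V"
  define C where "C = A1 * C1 * (1/4) powr e1 + A2 * C2 + Cf + A3 * V + 1"
  have "0 < c" using V by (simp add: c_def)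
  have "0 < C" using A A3 C1(1) C2(1) Cf V by (auto simp: C_def intro!: add_nonneg_pos add_nonneg_nonneg)
  show ?thesis
  proof (rule that [OF \<open>0 < c\<close> \<open>0 < C\<close>])
    fix x y :: 'a and g \<eta> \<beta> a \<rho> :: real
    assume pair: "doubling_pair u h \<kappa> K m S x y g \<eta>" and a_eq: "a = norm (x - y)"
      and \<rho>_eq: "\<rho> = a powr (1 + \<theta>') / 4" and \<beta>: "0 \<le> \<beta>" "\<And>z. norm z \<le> h \<Longrightarrow> \<beta> \<le> b z"
    have a: "0 < a" "a \<le> h / 2" and y: "norm y \<le> 2" "\<bar>u y\<bar> \<le> S" and uyx: "u y \<le> u x"
      and K0: "\<And>z. norm z < h \<Longrightarrow> \<bar>u (x + z) - u (y + z)\<bar> \<le> K * a powr \<kappa>"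
      and Kx: "\<And>z. norm z < h \<Longrightarrow> \<bar>u x - u (x + z)\<bar> \<le> K * norm z powr \<kappa>"
      and Ky: "\<And>z. norm z < h \<Longrightarrow> \<bar>u y - u (y + z)\<bar> \<le> K * norm z powr \<kappa>"
      and T: "\<And>z. norm z < h \<Longrightarrow> u (x + z) - u (y + z) \<le> u x - u y + m * (a powr (\<kappa> / 2) * norm z + (norm z)\<^sup>2)"
      and g: "0 \<le> g" and \<eta>: "0 < \<eta>" "\<eta> \<le> 1 / 4"
      and gain: "\<And>z. norm (z + (x - y) /\<^sub>R 2) \<le> \<eta> * a \<Longrightarrow> g \<le> (u x - u (x + z)) - (u y - u (y + z))"
      using pair unfolding doubling_pair_def a_eq by blast+
    have a1: "a \<le> 1" "a < h" using a h by auto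
    have sqrt: "0 < sqrt a" "a \<le> sqrt a" "sqrt a = a powr (1/2)"
      using a a1 real_le_rsqrt [of a a] by (auto simp: powr_half_sqrt power2_eq_square mult_le_cancel_left1)
    have "a powr (1 + \<theta>') \<le> a powr 1" using a a1 \<theta> by (intro powr_mono') auto
    then have \<rho>: "0 < \<rho>" "\<rho> \<le> a / 4" using a by (auto simp: \<rho>_eq)
    let ?G = "cball (- ((x - y) /\<^sub>R 2)) (\<eta> * a)"
    let ?d1 = "\<lambda>z. u x - u (x + z)" and ?d2 = "\<lambda>z. u y - u (y + z)"
    let ?J = "\<lambda>z. signed_pow P (?d1 z) - signed_pow P (?d2 z)"
    define \<gamma> where "\<gamma> = 2 powr (1 - P) * (1 / 2) * (\<beta> * g powr (P - 1) * a powr (- (d + \<sigma>)))"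
    have \<gamma>: "0 \<le> \<gamma>" using \<beta> by (simp add: \<gamma>_def)
    define R1 where "R1 z = A1 * a powr (\<kappa> / 2) * (indicator (- ball 0 \<rho>) z * norm z powr (e1 - d))" for z :: 'a
    define R2 where "R2 z = A2 * a powr \<kappa> * (indicator (- ball 0 (sqrt a)) z * norm z powr (e2 - d))" for z :: 'a
    have R: "0 \<le> R1 z" "0 \<le> R2 z" for z using A by (auto simp: R1_def R2_def)
    have G_mem: "a / 4 \<le> norm z" "norm z \<le> 3 * a / 4" "norm (z + (x - y) /\<^sub>R 2) \<le> \<eta> * a" if "z \<in> ?G" for z
    proof -
      show 1: "norm (z + (x - y) /\<^sub>R 2) \<le> \<eta> * a"
        using that by (simp add: dist_norm norm_minus_commute)
      have "\<eta> * a \<le> a / 4" using \<eta> a by simp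
      moreover have "norm ((x - y) /\<^sub>R 2) = a / 2" by (simp add: a_eq)
      ultimately show "a / 4 \<le> norm z" "norm z \<le> 3 * a / 4"
        using 1 norm_triangle_ineq4 [of "z + (x - y) /\<^sub>R 2" "(x - y) /\<^sub>R 2"] norm_triangle_ineq4 [of "z + (x - y) /\<^sub>R 2" z]
        by auto
    qed
    \<comment> \<open>the singular part of the kernel, where \<open>R1\<close> and \<open>R2\<close> are the losses in the two rings\<close>
    have near: "indicator ?G z * \<gamma> - R1 z - R2 z \<le> indicator (- ball 0 \<rho>) z * (?J z * (k z - kfar z))" for z
    proof (cases "z \<in> ?G")
      case True
      note z = G_mem [OF True]
      have "\<gamma> \<le> ?J z * (k z - kfar z)"
        unfolding \<gamma>_def d_def using z a a1 g \<beta> gain by (intro gain_lower) auto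
      moreover have "z \<in> - ball 0 \<rho>" using z \<rho> by auto
      ultimately show ?thesis using True R [of z] by simp
    next
      case False
      show ?thesis
      proof (cases "\<rho> \<le> norm z \<and> norm z < h")
        case z: True
        then have z': "z \<noteq> 0" "norm z \<le> 1" "0 < norm z" using \<rho> h by auto
        have kk: "0 \<le> k z - kfar z" "k z - kfar z \<le> k z"
          using kfar_le_k [OF z'(1)] kfar_nonneg [of z] by auto
        have "- R1 z - R2 z \<le> ?J z * (k z - kfar z)"
        proof (cases "norm z < sqrt a")
          case True
          have n1: "norm z \<le> norm z powr \<kappa>" using powr_mono' [of \<kappa> 1 "norm z"] \<kappa> z' by simp
          have a2: "a powr (\<kappa> / 2) \<le> 1" using powr_le1 [of "\<kappa> / 2" a] \<kappa> a a1 by simp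
          have "norm z \<le> a powr (\<kappa> / 2)"
          proof -
            have "norm z \<le> a powr (1/2)" using True sqrt by simp
            also have "\<dots> \<le> a powr (\<kappa> / 2)" using \<kappa> a a1 by (intro powr_mono') auto
            finally show ?thesis .
          qed
          then have sq: "(norm z)\<^sup>2 \<le> a powr (\<kappa> / 2) * norm z"
            by (simp add: power2_eq_square mult_right_mono)
          have "- (P * (K + 2 * m) powr (P - 2) * \<Lambda> * (2 * m * a powr (\<kappa> / 2)) * norm z powr (e1 - real DIM('a)))
            \<le> ?J z * (k z - kfar z)"
          proof (rule ring_lower [where e = "m * (a powr (\<kappa> / 2) * norm z + (norm z)\<^sup>2)" and \<kappa> = \<kappa> and \<beta> = 1])
            show "m * (a powr (\<kappa> / 2) * norm z + (norm z)\<^sup>2) \<le> 2 * m * a powr (\<kappa> / 2) * norm z powr 1"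
              using sq SK z' mult_left_mono [OF sq, of m] by (simp add: algebra_simps)
            have "m * (a powr (\<kappa> / 2) * norm z + (norm z)\<^sup>2) \<le> m * (1 * norm z + 1 * norm z)"
              using sq SK a2 mult_right_mono [OF a2, of "norm z"] by (intro mult_left_mono add_mono) auto
            also have "\<dots> = 2 * m * norm z" by simp
            also have "\<dots> \<le> 2 * m * norm z powr \<kappa>" using n1 SK by (intro mult_left_mono) auto
            finally show "m * (a powr (\<kappa> / 2) * norm z + (norm z)\<^sup>2) \<le> 2 * m * norm z powr \<kappa>" .
            show "?d2 z - m * (a powr (\<kappa> / 2) * norm z + (norm z)\<^sup>2) \<le> ?d1 z" using T [of z] z by simp
          qed (use z z' kk SK Ky e1 in auto)
          then have "- R1 z \<le> ?J z * (k z - kfar z)"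
            using z by (simp add: R1_def A1_def d_def mult_ac)
          then show ?thesis using R(2) [of z] by linarith
        next
          case out: False
          have "a powr \<kappa> \<le> norm z powr \<kappa>" using \<kappa> a sqrt out by (intro powr_mono2) auto
          then have e_le: "K * a powr \<kappa> \<le> K * norm z powr \<kappa>" using SK by (intro mult_left_mono) auto
          have "- (P * (K + K) powr (P - 2) * \<Lambda> * (K * a powr \<kappa>) * norm z powr (e2 - real DIM('a)))
            \<le> ?J z * (k z - kfar z)"
          proof (rule ring_lower [where e = "K * a powr \<kappa>" and \<kappa> = \<kappa> and \<beta> = 0])
            show "?d2 z - K * a powr \<kappa> \<le> ?d1 z" using K0 [of z] z uyx by (auto simp: abs_le_iff)
          qed (use z z' kk SK Ky e2 e_le in auto)
          then have "- R2 z \<le> ?J z * (k z - kfar z)"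
            using out by (simp add: R2_def A2_def d_def mult_ac)
          then show ?thesis using R(1) [of z] by linarith
        qed
        then show ?thesis using False z by simp
      next
        case z: False
        have "indicator (- ball 0 \<rho>) z * (?J z * (k z - kfar z)) = 0"
          using z by (auto simp: kfar_eq_k not_less indicator_def)
        moreover have "indicator ?G z * \<gamma> - R1 z - R2 z \<le> 0" using False R [of z] by simp
        ultimately show ?thesis by linarith
      qed
    qed
    \<comment> \<open>the exterior integrals omit the ball of radius \<open>\<rho>\<close>, but \<open>kfar_difference_lower\<close> needs the whole
      space, so the bounded kernel on that ball is subtracted again\<close>
    have hole: "indicator (ball 0 \<rho>) z * (?J z * kfar z) \<le> A3 * indicator (ball 0 \<rho>) z" for z
    proof (cases "z \<in> ball 0 \<rho>")
      case True
      then have z: "norm z < h" "norm z \<le> 1" using \<rho> a1 a by auto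
      have n1: "norm z powr \<kappa> \<le> 1" using powr_le1 [of \<kappa> "norm z"] \<kappa> z by simp
      then have "K * norm z powr \<kappa> \<le> K" using SK by (simp add: mult_left_le)
      then have dd: "\<bar>?d1 z\<bar> \<le> K" "\<bar>?d2 z\<bar> \<le> K" using Kx [OF z(1)] Ky [OF z(1)] by linarith+
      have "?J z \<le> \<bar>?d1 z\<bar> powr (P - 1) + \<bar>?d2 z\<bar> powr (P - 1)"
        using abs_signed_pow [of P "?d1 z"] abs_signed_pow [of P "?d2 z"] by linarith
      also have "\<dots> \<le> K powr (P - 1) + K powr (P - 1)" using dd P by (intro add_mono powr_mono2) auto
      finally have "?J z * kfar z \<le> (2 * K powr (P - 1)) * kfar z" using kfar_nonneg by (intro mult_right_mono) auto
      also have "\<dots> \<le> A3" using kfar_near [of z] z by (simp add: A3_def d_def mult_left_mono)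
      finally show ?thesis using True by simp
    qed auto
    have balls: "integrable lebesgue (indicator ?G :: 'a \<Rightarrow> real)" "integrable lebesgue (indicator (ball (0::'a) \<rho>) :: 'a \<Rightarrow> real)"
      using \<rho> \<eta> a by (auto intro!: integrable_real_indicator simp: emeasure_ball emeasure_cball)
    let ?ux = "\<lambda>z. indicator (- ball 0 \<rho>) z * (signed_pow P (?d1 z) * k z)"
    let ?uy = "\<lambda>z. indicator (- ball 0 \<rho>) z * (signed_pow P (?d2 z) * k z)"
    let ?fx = "\<lambda>z. signed_pow P (?d1 z) * kfar z"
    let ?fy = "\<lambda>z. signed_pow P (?d2 z) * kfar z"
    have iu: "integrable lebesgue ?ux" "integrable lebesgue ?uy" by (intro tail_integrable u \<rho>)+
    have ifar: "integrable lebesgue ?fx" "integrable lebesgue ?fy" by (intro kfar_integrable u)+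
    have sqp: "0 < sqrt a" by (rule sqrt)
    have iR: "integrable lebesgue R1" "integrable lebesgue R2"
      unfolding R1_def [abs_def] R2_def [abs_def] using C1(2) [OF \<rho>(1)] C2(2) [OF sqp]
      by (intro integrable_mult_right; simp)+
    let ?low = "\<lambda>z. (((indicator ?G z * \<gamma> - R1 z) - R2 z) + (?fx z - ?fy z)) - A3 * indicator (ball 0 \<rho>) z"
    have low: "?low z \<le> ?ux z - ?uy z" for z
    proof -
      have "?ux z - ?uy z = indicator (- ball 0 \<rho>) z * (?J z * (k z - kfar z)) + (?fx z - ?fy z)
          - indicator (ball 0 \<rho>) z * (?J z * kfar z)"
        by (cases "z \<in> ball 0 \<rho>") (auto simp: algebra_simps)
      then show ?thesis using near [of z] hole [of z] by linarith
    qed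
    have "integral\<^sup>L lebesgue ?low \<le> (\<integral>z. ?ux z - ?uy z \<partial>lebesgue)"
    proof (rule integral_mono)
      show "integrable lebesgue ?low" using balls iR ifar by auto
      show "integrable lebesgue (\<lambda>z. ?ux z - ?uy z)" using iu by (rule Bochner_Integration.integrable_diff)
    qed (rule low)
    also have "(\<integral>z. ?ux z - ?uy z \<partial>lebesgue) = integral\<^sup>L lebesgue ?ux - integral\<^sup>L lebesgue ?uy"
      using iu by (rule Bochner_Integration.integral_diff)
    finally have main: "integral\<^sup>L lebesgue ?low \<le> integral\<^sup>L lebesgue ?ux - integral\<^sup>L lebesgue ?uy" .
    have Gv: "(\<integral>z. indicator ?G z * \<gamma> \<partial>lebesgue) = V * (\<eta> * a) powr d * \<gamma>"
    proof -
      have "measure lebesgue ?G = V * (\<eta> * a) ^ DIM('a)"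
        using \<eta> a by (simp add: content_cball V_def d_def)
      also have "(\<eta> * a) ^ DIM('a) = (\<eta> * a) powr d" using \<eta> a by (simp add: d_def powr_realpow)
      finally show ?thesis by simp
    qed
    have Bv: "(\<integral>z. A3 * indicator (ball (0::'a) \<rho>) z \<partial>lebesgue) \<le> A3 * V * a"
    proof -
      have "measure lebesgue (ball (0::'a) \<rho>) = V * \<rho> ^ DIM('a)"
        using \<rho> by (simp add: content_ball V_def d_def)
      also have "\<rho> ^ DIM('a) \<le> \<rho> ^ 1" using \<rho> a1 DIM_positive [where 'a = 'a]
        by (intro power_decreasing) auto
      also have "\<rho> ^ 1 \<le> a" using \<rho> a by simp
      finally show ?thesis using V A3 by (simp add: mult_left_mono mult.assoc)
    qed
    have eq: "integral\<^sup>L lebesgue ?low = V * (\<eta> * a) powr d * \<gamma> - integral\<^sup>L lebesgue R1 - integral\<^sup>L lebesgue R2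
        + (\<integral>z. ?fx z - ?fy z \<partial>lebesgue) - (\<integral>z. A3 * indicator (ball (0::'a) \<rho>) z \<partial>lebesgue)"
    proof -
      have i0: "integrable lebesgue (\<lambda>z. indicator ?G z * \<gamma>)" using balls by auto
      have i1: "integrable lebesgue (\<lambda>z. indicator ?G z * \<gamma> - R1 z)" using i0 iR(1) by (rule Bochner_Integration.integrable_diff)
      have i2: "integrable lebesgue (\<lambda>z. indicator ?G z * \<gamma> - R1 z - R2 z)" using i1 iR(2) by (rule Bochner_Integration.integrable_diff)
      have i3: "integrable lebesgue (\<lambda>z. ?fx z - ?fy z)" using ifar by (rule Bochner_Integration.integrable_diff)
      have i4: "integrable lebesgue (\<lambda>z. A3 * indicator (ball (0::'a) \<rho>) z)" using balls by auto
      show ?thesis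
        unfolding Bochner_Integration.integral_diff [OF Bochner_Integration.integrable_add [OF i2 i3] i4]
          Bochner_Integration.integral_add [OF i2 i3] Bochner_Integration.integral_diff [OF i1 iR(2)]
          Bochner_Integration.integral_diff [OF i0 iR(1)] Gv by simp
    qed
    have r1: "integral\<^sup>L lebesgue R1 \<le> A1 * C1 * (1/4) powr e1 * a powr \<omega>"
    proof -
      have "integral\<^sup>L lebesgue R1 = A1 * a powr (\<kappa> / 2) * integral\<^sup>L lebesgue (\<lambda>z::'a. indicator (- ball 0 \<rho>) z * norm z powr (e1 - d))"
        unfolding R1_def [abs_def] by simp
      also have "\<dots> \<le> A1 * a powr (\<kappa> / 2) * (C1 * \<rho> powr e1)"
        using C1(3) [OF \<rho>(1)] A by (intro mult_left_mono) auto
      also have "\<rho> powr e1 = (1/4) powr e1 * a powr ((1 + \<theta>') * e1)"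
        using a powr_mult [of "1/4" "a powr (1 + \<theta>')" e1] by (simp add: \<rho>_eq powr_powr)
      also have "A1 * a powr (\<kappa> / 2) * (C1 * ((1/4) powr e1 * a powr ((1 + \<theta>') * e1)))
          = A1 * C1 * (1/4) powr e1 * a powr (\<kappa> / 2 + (1 + \<theta>') * e1)"
        by (simp add: powr_add mult_ac)
      also have "\<dots> \<le> A1 * C1 * (1/4) powr e1 * a powr \<omega>"
        using a a1 \<omega> A C1(1) by (intro mult_left_mono powr_mono') auto
      finally show ?thesis .
    qed
    have r2: "integral\<^sup>L lebesgue R2 \<le> A2 * C2 * a powr \<omega>"
    proof -
      have "integral\<^sup>L lebesgue R2 = A2 * a powr \<kappa> * integral\<^sup>L lebesgue (\<lambda>z::'a. indicator (- ball 0 (sqrt a)) z * norm z powr (e2 - d))"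
        unfolding R2_def [abs_def] by simp
      also have "\<dots> \<le> A2 * a powr \<kappa> * (C2 * sqrt a powr e2)"
        using C2(3) [OF sqp] A by (intro mult_left_mono) auto
      also have "sqrt a powr e2 = a powr (e2 / 2)" unfolding sqrt(3) by (simp add: powr_powr)
      also have "A2 * a powr \<kappa> * (C2 * a powr (e2 / 2)) = A2 * C2 * a powr (\<kappa> + e2 / 2)"
        by (simp add: powr_add mult_ac)
      also have "\<dots> \<le> A2 * C2 * a powr \<omega>"
        using a a1 \<omega> A C2(1) by (intro mult_left_mono powr_mono') auto
      finally show ?thesis .
    qed
    have r3: "- Cf * a powr \<omega> \<le> (\<integral>z. ?fx z - ?fy z \<partial>lebesgue)"
    proof -
      have "- Cf * norm (x - y) powr \<alpha> \<le> (\<integral>z. ?fx z - ?fy z \<partial>lebesgue)"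
        using y uyx a1 a_eq by (intro Cf(2)) auto
      moreover have "Cf * a powr \<alpha> \<le> Cf * a powr \<omega>"
        using a a1 \<omega> Cf(1) by (intro mult_left_mono powr_mono') auto
      ultimately show ?thesis by (simp add: a_eq)
    qed
    have r4: "A3 * V * a \<le> A3 * V * a powr \<omega>"
    proof -
      have "a powr 1 \<le> a powr \<omega>" using a a1 \<omega> \<alpha> by (intro powr_mono') auto
      then show ?thesis using a A3 V by (intro mult_left_mono) auto
    qed
    have "c * \<beta> * g powr (P - 1) * (\<eta> * a) powr d * a powr (- (d + \<sigma>)) = V * (\<eta> * a) powr d * \<gamma>"
      by (simp add: c_def \<gamma>_def mult_ac)
    moreover have "C * a powr \<omega> = A1 * C1 * (1/4) powr e1 * a powr \<omega> + A2 * C2 * a powr \<omega> + Cf * a powr \<omega> + A3 * V * a powr \<omega> + a powr \<omega>"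
      by (simp add: C_def algebra_simps)
    moreover have "0 \<le> a powr \<omega>" by simp
    ultimately show "c * \<beta> * g powr (P - 1) * (\<eta> * a) powr real DIM('a) * a powr (- (real DIM('a) + \<sigma>)) - C * a powr \<omega>
      \<le> integral\<^sup>L lebesgue ?ux - integral\<^sup>L lebesgue ?uy"
      using main eq Bv r1 r2 r3 r4 unfolding d_def [symmetric] by linarith
  qed
qed

end


section \<open>The concave modulus\<close>

text \<open>For \<open>\<gamma> < 1\<close> the leading power is strictly concave; the correction matters for
  \<open>\<gamma> = 1\<close>, where it provides the concavity at the cost of a factor
  \<open>r powr \<theta>\<close>.\<close>

definition modulus :: "real \<Rightarrow> real \<Rightarrow> real \<Rightarrow> real" where
  "modulus \<gamma> \<theta> r = r powr \<gamma> - r powr (1 + \<theta>) / 2"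

locale modulus_params =
  fixes \<gamma> \<theta> :: real
  assumes \<gamma>: "0 < \<gamma>" "\<gamma> \<le> 1" and \<theta>: "0 < \<theta>" "\<theta> \<le> 1"
begin

abbreviation \<phi> :: "real \<Rightarrow> real" where "\<phi> \<equiv> modulus \<gamma> \<theta>"

lemma modulus_bounds:
  assumes "0 \<le> r" "r \<le> 1"
  shows "r powr \<gamma> / 2 \<le> \<phi> r" "\<phi> r \<le> r powr \<gamma>"
  using powr_mono' [of \<gamma> "1 + \<theta>" r] assms \<gamma> \<theta> by (auto simp: modulus_def)

lemma modulus_deriv:
  assumes "0 < r"
  shows "(\<phi> has_real_derivative (\<gamma> * r powr (\<gamma> - 1) - (1 + \<theta>) * r powr \<theta> / 2)) (at r)"
  unfolding modulus_def [abs_def] using assms by (auto intro!: derivative_eq_intros)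

lemma modulus_deriv2:
  assumes "0 < r"
  shows "((\<lambda>r. \<gamma> * r powr (\<gamma> - 1) - (1 + \<theta>) * r powr \<theta> / 2) has_real_derivative
    (\<gamma> * ((\<gamma> - 1) * r powr (\<gamma> - 2)) - (1 + \<theta>) * (\<theta> * r powr (\<theta> - 1)) / 2)) (at r)"
  using assms by (auto intro!: derivative_eq_intros)

lemma scale_powr:
  fixes a r e :: real
  assumes "0 < a" "a / 4 \<le> r" "-2 \<le> e" "e \<le> 0"
  shows "r powr e \<le> 16 * a powr e"
proof -
  have "r powr e \<le> (a / 4) powr e" using assms by (intro powr_mono2') auto
  also have "\<dots> = a powr e * 4 powr (- e)" using assms by (simp add: powr_divide powr_minus_divide)
  also have "\<dots> \<le> a powr e * 4 powr 2" using assms by (intro mult_left_mono powr_mono) auto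
  finally show ?thesis by simp
qed

lemma modulus_deriv_bound:
  assumes a: "0 < a" "a \<le> 1 / 2" and r: "a / 4 \<le> r" "r \<le> 2 * a"
  shows "\<bar>\<gamma> * r powr (\<gamma> - 1) - (1 + \<theta>) * r powr \<theta> / 2\<bar> \<le> 32 * a powr (\<gamma> - 1)"
    and "\<bar>\<gamma> * ((\<gamma> - 1) * r powr (\<gamma> - 2)) - (1 + \<theta>) * (\<theta> * r powr (\<theta> - 1)) / 2\<bar> \<le> 32 * a powr (\<gamma> - 2)"
proof -
  have r1: "0 < r" "r \<le> 1" using a r by linarith+
  have "r powr \<theta> \<le> r powr (\<gamma> - 1)" using r1 \<theta> \<gamma> by (intro powr_mono') auto
  then have "(1 + \<theta>) * r powr \<theta> \<le> 2 * r powr (\<gamma> - 1)" using \<theta> by (intro mult_mono) auto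
  moreover have "0 \<le> (1 + \<theta>) * r powr \<theta>" using \<theta> by simp
  moreover have "\<gamma> * r powr (\<gamma> - 1) \<le> 1 * r powr (\<gamma> - 1)" using \<gamma> by (intro mult_right_mono) auto
  moreover have "0 \<le> \<gamma> * r powr (\<gamma> - 1)" using \<gamma> by simp
  moreover have "r powr (\<gamma> - 1) \<le> 16 * a powr (\<gamma> - 1)" using a r \<gamma> by (intro scale_powr) auto
  ultimately show "\<bar>\<gamma> * r powr (\<gamma> - 1) - (1 + \<theta>) * r powr \<theta> / 2\<bar> \<le> 32 * a powr (\<gamma> - 1)"
    by linarith
  have "r powr (\<theta> - 1) \<le> r powr (\<gamma> - 2)" using r1 \<theta> \<gamma> by (intro powr_mono') auto
  then have "((1 + \<theta>) * \<theta>) * r powr (\<theta> - 1) \<le> 2 * r powr (\<gamma> - 2)"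
  proof (rule mult_mono [rotated])
    have "(1 + \<theta>) * \<theta> \<le> 2 * 1" using \<theta> by (intro mult_mono) auto
    then show "(1 + \<theta>) * \<theta> \<le> 2" by simp
  qed auto
  moreover have "0 \<le> (1 + \<theta>) * \<theta> * r powr (\<theta> - 1)" using \<theta> by simp
  moreover have "\<gamma> * (1 - \<gamma>) * r powr (\<gamma> - 2) \<le> 1 * r powr (\<gamma> - 2)"
  proof (rule mult_right_mono)
    have "\<gamma> * (1 - \<gamma>) \<le> 1 * 1" using \<gamma> by (intro mult_mono) auto
    then show "\<gamma> * (1 - \<gamma>) \<le> 1" by simp
  qed simp
  moreover have "0 \<le> \<gamma> * (1 - \<gamma>) * r powr (\<gamma> - 2)" using \<gamma> by simp
  moreover have "r powr (\<gamma> - 2) \<le> 16 * a powr (\<gamma> - 2)" using a r \<gamma> by (intro scale_powr) auto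
  moreover have "\<gamma> * ((\<gamma> - 1) * r powr (\<gamma> - 2)) = - (\<gamma> * (1 - \<gamma>) * r powr (\<gamma> - 2))"
    by (simp add: algebra_simps)
  ultimately show "\<bar>\<gamma> * ((\<gamma> - 1) * r powr (\<gamma> - 2)) - (1 + \<theta>) * (\<theta> * r powr (\<theta> - 1)) / 2\<bar> \<le> 32 * a powr (\<gamma> - 2)"
    by (simp only: mult.assoc [symmetric])
qed

lemma modulus_lipschitz:
  assumes a: "0 < a" "a \<le> 1 / 2" and r: "a / 4 \<le> r" "r \<le> 2 * a" "a / 4 \<le> r'" "r' \<le> 2 * a"
  shows "\<bar>\<phi> r - \<phi> r'\<bar> \<le> 32 * a powr (\<gamma> - 1) * \<bar>r - r'\<bar>"
proof -
  have "norm (\<phi> r - \<phi> r') \<le> 32 * a powr (\<gamma> - 1) * norm (r - r')"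
  proof (rule field_differentiable_bound [where S = "{a / 4..2 * a}" and f' = "\<lambda>r. \<gamma> * r powr (\<gamma> - 1) - (1 + \<theta>) * r powr \<theta> / 2"])
    show "\<And>z. z \<in> {a / 4..2 * a} \<Longrightarrow> (\<phi> has_field_derivative (\<gamma> * z powr (\<gamma> - 1) - (1 + \<theta>) * z powr \<theta> / 2)) (at z within {a / 4..2 * a})"
      using a by (auto intro!: has_field_derivative_at_within [OF modulus_deriv])
    show "\<And>z. z \<in> {a / 4..2 * a} \<Longrightarrow> norm (\<gamma> * z powr (\<gamma> - 1) - (1 + \<theta>) * z powr \<theta> / 2) \<le> 32 * a powr (\<gamma> - 1)"
      unfolding real_norm_def using a by (intro modulus_deriv_bound(1)) auto
  qed (use r in auto)
  then show ?thesis by simp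
qed

lemma modulus_taylor:
  assumes a: "0 < a" "a \<le> 1 / 2" and r: "a / 4 \<le> r" "r \<le> 2 * a"
  shows "\<bar>\<phi> r - \<phi> a - (\<gamma> * a powr (\<gamma> - 1) - (1 + \<theta>) * a powr \<theta> / 2) * (r - a)\<bar> \<le> 32 * a powr (\<gamma> - 2) * (r - a)\<^sup>2"
proof -
  let ?f' = "\<lambda>r. \<gamma> * r powr (\<gamma> - 1) - (1 + \<theta>) * r powr \<theta> / 2"
  have "norm (\<phi> r - \<phi> a - ?f' a * (r - a)) \<le> 32 * a powr (\<gamma> - 2) * norm (r - a) * norm (r - a)"
  proof -
    let ?S = "closed_segment a r"
    let ?g = "\<lambda>v. \<phi> v - ?f' a * v"
    have S: "v \<in> {a / 4..2 * a}" "\<bar>v - a\<bar> \<le> \<bar>r - a\<bar>" if "v \<in> ?S" for v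
      using that r a by (auto simp: closed_segment_eq_real_ivl split: if_splits)
    have d': "\<bar>?f' v - ?f' a\<bar> \<le> 32 * a powr (\<gamma> - 2) * \<bar>v - a\<bar>" if "v \<in> {a / 4..2 * a}" for v
    proof -
      have "norm (?f' v - ?f' a) \<le> 32 * a powr (\<gamma> - 2) * norm (v - a)"
      proof (rule field_differentiable_bound [where S = "{a / 4..2 * a}" and f' = "\<lambda>r. \<gamma> * ((\<gamma> - 1) * r powr (\<gamma> - 2)) - (1 + \<theta>) * (\<theta> * r powr (\<theta> - 1)) / 2"])
        show "\<And>z. z \<in> {a / 4..2 * a} \<Longrightarrow> (?f' has_field_derivative (\<gamma> * ((\<gamma> - 1) * z powr (\<gamma> - 2)) - (1 + \<theta>) * (\<theta> * z powr (\<theta> - 1)) / 2)) (at z within {a / 4..2 * a})"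
          using a by (auto intro!: has_field_derivative_at_within [OF modulus_deriv2])
        show "\<And>z. z \<in> {a / 4..2 * a} \<Longrightarrow> norm (\<gamma> * ((\<gamma> - 1) * z powr (\<gamma> - 2)) - (1 + \<theta>) * (\<theta> * z powr (\<theta> - 1)) / 2) \<le> 32 * a powr (\<gamma> - 2)"
          unfolding real_norm_def using a by (intro modulus_deriv_bound(2)) auto
      qed (use that a in auto)
      then show ?thesis by simp
    qed
    have "norm (?g r - ?g a) \<le> (32 * a powr (\<gamma> - 2) * \<bar>r - a\<bar>) * norm (r - a)"
    proof (rule field_differentiable_bound [where S = ?S and f' = "\<lambda>v. ?f' v - ?f' a"])
      show "(?g has_field_derivative ?f' v - ?f' a) (at v within ?S)" if "v \<in> ?S" for v
        using S [OF that] a by (auto intro!: derivative_eq_intros has_field_derivative_at_within [OF modulus_deriv])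
      show "norm (?f' v - ?f' a) \<le> 32 * a powr (\<gamma> - 2) * \<bar>r - a\<bar>" if "v \<in> ?S" for v
      proof -
        have "\<bar>?f' v - ?f' a\<bar> \<le> 32 * a powr (\<gamma> - 2) * \<bar>v - a\<bar>" using S [OF that] by (intro d')
        also have "\<dots> \<le> 32 * a powr (\<gamma> - 2) * \<bar>r - a\<bar>" using S [OF that] by (intro mult_left_mono) auto
        finally show ?thesis by simp
      qed
    qed auto
    moreover have "?g r - ?g a = \<phi> r - \<phi> a - ?f' a * (r - a)" by (simp add: right_diff_distrib)
    ultimately show ?thesis by simp
  qed
  then show ?thesis by (simp add: power2_eq_square mult.assoc)
qed

text \<open>The parallelogram law. It bounds the symmetric second difference of the norm, hence that of any smooth
  function of the norm.\<close>

lemma norm_symmetric_sum: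
  fixes v z :: "'a::real_inner"
  assumes "v \<noteq> 0"
  shows "0 \<le> norm (v + z) + norm (v - z) - 2 * norm v"
    and "norm (v + z) + norm (v - z) - 2 * norm v \<le> (norm z)\<^sup>2 / norm v"
proof -
  have "(v + z) + (v - z) = 2 *\<^sub>R v" by (simp add: scaleR_2)
  then have "2 * norm v = norm ((v + z) + (v - z))" by simp
  also have "\<dots> \<le> norm (v + z) + norm (v - z)" by (rule norm_triangle_ineq)
  finally show "0 \<le> norm (v + z) + norm (v - z) - 2 * norm v" by simp
  have "(norm (v + z) + norm (v - z))\<^sup>2 \<le> 2 * ((norm (v + z))\<^sup>2 + (norm (v - z))\<^sup>2)"
    using sum_squares_bound [of "norm (v + z)" "norm (v - z)"] by (simp add: power2_sum)
  also have "\<dots> = 4 * ((norm v)\<^sup>2 + (norm z)\<^sup>2)"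
    by (simp add: power2_norm_eq_inner algebra_simps inner_commute)
  also have "\<dots> \<le> (2 * norm v + (norm z)\<^sup>2 / norm v)\<^sup>2"
    using assms by (simp add: power2_sum power_mult_distrib)
  finally have "norm (v + z) + norm (v - z) \<le> 2 * norm v + (norm z)\<^sup>2 / norm v"
    by (rule power2_le_imp_le) simp
  then show "norm (v + z) + norm (v - z) - 2 * norm v \<le> (norm z)\<^sup>2 / norm v" by simp
qed

lemma modulus_norm_differences:
  fixes v z :: "'a::real_inner"
  assumes a: "a = norm v" "0 < a" "a \<le> 1 / 2" and z: "norm z \<le> a / 2"
  shows "\<bar>\<phi> (norm (v + z)) - \<phi> a\<bar> \<le> 32 * a powr (\<gamma> - 1) * norm z"
    and "\<bar>\<phi> (norm (v + z)) + \<phi> (norm (v - z)) - 2 * \<phi> a\<bar> \<le> 96 * a powr (\<gamma> - 2) * (norm z)\<^sup>2"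
proof -
  have r: "a / 4 \<le> norm (v + z)" "norm (v + z) \<le> 2 * a" "\<bar>norm (v + z) - a\<bar> \<le> norm z"
    if "norm z \<le> a / 2" for z
    using norm_triangle_ineq [of v z] norm_triangle_ineq4 [of "v + z" z] that a by auto
  note r1 = r [OF z] and r2 = r [of "- z", unfolded norm_minus_cancel add_uminus_conv_diff, OF z]
  have "\<bar>\<phi> (norm (v + z)) - \<phi> a\<bar> \<le> 32 * a powr (\<gamma> - 1) * \<bar>norm (v + z) - a\<bar>"
    using a r1 by (intro modulus_lipschitz) auto
  also have "\<dots> \<le> 32 * a powr (\<gamma> - 1) * norm z" using r1 by (intro mult_left_mono) auto
  finally show "\<bar>\<phi> (norm (v + z)) - \<phi> a\<bar> \<le> 32 * a powr (\<gamma> - 1) * norm z" .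
  define D where "D = \<gamma> * a powr (\<gamma> - 1) - (1 + \<theta>) * a powr \<theta> / 2"
  have t: "\<bar>\<phi> r - \<phi> a - D * (r - a)\<bar> \<le> 32 * a powr (\<gamma> - 2) * (norm z)\<^sup>2"
    if "a / 4 \<le> r" "r \<le> 2 * a" "\<bar>r - a\<bar> \<le> norm z" for r
  proof -
    have "\<bar>\<phi> r - \<phi> a - D * (r - a)\<bar> \<le> 32 * a powr (\<gamma> - 2) * (r - a)\<^sup>2"
      unfolding D_def using a that by (intro modulus_taylor) auto
    also have "\<dots> \<le> 32 * a powr (\<gamma> - 2) * (norm z)\<^sup>2"
      using that by (intro mult_left_mono) (auto simp: abs_le_square_iff [symmetric])
    finally show ?thesis .
  qed
  have D: "\<bar>D\<bar> \<le> 32 * a powr (\<gamma> - 1)" unfolding D_def using a by (intro modulus_deriv_bound) auto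
  have s: "\<bar>norm (v + z) + norm (v - z) - 2 * a\<bar> \<le> (norm z)\<^sup>2 / a"
    using norm_symmetric_sum [of v z] a by auto
  have "\<bar>D * (norm (v + z) + norm (v - z) - 2 * a)\<bar> \<le> (32 * a powr (\<gamma> - 1)) * ((norm z)\<^sup>2 / a)"
    unfolding abs_mult using D s by (intro mult_mono) auto
  also have "\<dots> = 32 * (a powr (\<gamma> - 1) / a) * (norm z)\<^sup>2" by simp
  also have "a powr (\<gamma> - 1) / a = a powr (\<gamma> - 2)"
    using a powr_diff [of a "\<gamma> - 1" 1] by simp
  finally have D2: "\<bar>D * (norm (v + z) + norm (v - z) - 2 * a)\<bar> \<le> 32 * a powr (\<gamma> - 2) * (norm z)\<^sup>2" .
  have "\<phi> (norm (v + z)) + \<phi> (norm (v - z)) - 2 * \<phi> a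
      = (\<phi> (norm (v + z)) - \<phi> a - D * (norm (v + z) - a)) + (\<phi> (norm (v - z)) - \<phi> a - D * (norm (v - z) - a))
        + D * (norm (v + z) + norm (v - z) - 2 * a)"
    by (simp add: algebra_simps)
  then show "\<bar>\<phi> (norm (v + z)) + \<phi> (norm (v - z)) - 2 * \<phi> a\<bar> \<le> 96 * a powr (\<gamma> - 2) * (norm z)\<^sup>2"
    using t [OF r1] t [OF r2] D2 by (simp only: abs_le_iff) linarith
qed

text \<open>Strict concavity, linearity and strict convexity of the power at the three points 1/2, 1 and 3/2, from the
  mean value theorem on both sides of 1.\<close>

lemma powr_midpoint_gap:
  fixes e :: real
  assumes "0 < e"
  shows "e < 1 \<Longrightarrow> (1/2) powr e + (3/2) powr e < 2" "e = 1 \<Longrightarrow> (1/2) powr e + (3/2) powr e = 2"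
    "1 < e \<Longrightarrow> 2 < (1/2) powr e + (3/2) powr e"
proof -
  have "\<exists>\<xi>. 1/2 < \<xi> \<and> \<xi> < 1 \<and> 1 powr e - (1/2) powr e = (1 - 1/2) * (e * \<xi> powr (e - 1))"
    by (intro MVT2) (auto intro!: DERIV_cong [OF has_real_derivative_powr])
  then obtain \<xi> where \<xi>: "1/2 < \<xi>" "\<xi> < 1" "1 - (1/2) powr e = (e * \<xi> powr (e - 1)) / 2" by auto
  have "\<exists>\<zeta>. 1 < \<zeta> \<and> \<zeta> < 3/2 \<and> (3/2) powr e - 1 powr e = (3/2 - 1) * (e * \<zeta> powr (e - 1))"
    by (intro MVT2) (auto intro!: DERIV_cong [OF has_real_derivative_powr])
  then obtain \<zeta> where \<zeta>: "1 < \<zeta>" "\<zeta> < 3/2" "(3/2) powr e - 1 = (e * \<zeta> powr (e - 1)) / 2" by auto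
  show "(1/2) powr e + (3/2) powr e < 2" if "e < 1"
  proof -
    have "\<zeta> powr (e - 1) < \<xi> powr (e - 1)" using \<xi> \<zeta> that by (intro powr_less_mono2_neg) auto
    then have "e * \<zeta> powr (e - 1) < e * \<xi> powr (e - 1)" using assms by simp
    then show ?thesis using \<xi> \<zeta> by linarith
  qed
  show "2 < (1/2) powr e + (3/2) powr e" if "1 < e"
  proof -
    have "\<xi> powr (e - 1) < \<zeta> powr (e - 1)" using \<xi> \<zeta> that by (intro powr_less_mono2) auto
    then have "e * \<xi> powr (e - 1) < e * \<zeta> powr (e - 1)" using assms by simp
    then show ?thesis using \<xi> \<zeta> by linarith
  qed
qed auto

lemma modulus_gap:
  obtains c where "0 < c" "c \<le> 8"
    "\<And>a. 0 < a \<Longrightarrow> a \<le> 1 \<Longrightarrow> c * a powr (\<gamma> + \<theta>) \<le> 2 * \<phi> a - \<phi> (a / 2) - \<phi> (3 * a / 2)"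
proof -
  define G where "G e = 2 - ((1/2) powr e + (3/2) powr e)" for e :: real
  have eq: "2 * \<phi> a - \<phi> (a / 2) - \<phi> (3 * a / 2) = G \<gamma> * a powr \<gamma> + (- G (1 + \<theta>) / 2) * a powr (1 + \<theta>)"
    if "0 < a" for a
    using that powr_mult [of "1/2" a] powr_mult [of "3/2" a]
    by (simp add: modulus_def G_def field_simps)
  have G2: "G (1 + \<theta>) < 0" using powr_midpoint_gap(3) [of "1 + \<theta>"] \<theta> by (simp add: G_def)
  show ?thesis
  proof (cases "\<gamma> = 1")
    case True
    then have G1: "G \<gamma> = 0" using powr_midpoint_gap(2) [of \<gamma>] by (simp add: G_def)
    show ?thesis
    proof (rule that [of "min 8 (- G (1 + \<theta>) / 2)"])
      fix a :: real assume a: "0 < a" "a \<le> 1"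
      have "min 8 (- G (1 + \<theta>) / 2) * a powr (1 + \<theta>) \<le> (- G (1 + \<theta>) / 2) * a powr (1 + \<theta>)"
        by (intro mult_right_mono) auto
      then show "min 8 (- G (1 + \<theta>) / 2) * a powr (\<gamma> + \<theta>) \<le> 2 * \<phi> a - \<phi> (a / 2) - \<phi> (3 * a / 2)"
        unfolding eq [OF a(1)] G1 using True by simp
    qed (use G2 in auto)
  next
    case False
    then have G1: "0 < G \<gamma>" using powr_midpoint_gap(1) [of \<gamma>] \<gamma> by (simp add: G_def)
    show ?thesis
    proof (rule that [of "min 8 (G \<gamma>)"])
      fix a :: real assume a: "0 < a" "a \<le> 1"
      have "min 8 (G \<gamma>) * a powr (\<gamma> + \<theta>) \<le> G \<gamma> * a powr \<gamma>"
        using G1 a \<theta> by (intro mult_mono powr_mono') auto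
      also have "\<dots> \<le> 2 * \<phi> a - \<phi> (a / 2) - \<phi> (3 * a / 2)"
        unfolding eq [OF a(1)] using G2 by (simp add: mult_le_0_iff)
      finally show "min 8 (G \<gamma>) * a powr (\<gamma> + \<theta>) \<le> 2 * \<phi> a - \<phi> (a / 2) - \<phi> (3 * a / 2)" .
    qed (use G1 in auto)
  qed
qed

text \<open>The radius of the ball is chosen so that moving \<open>z\<close> away from its centre costs at most half
  of the concavity gap; for \<open>\<gamma> = 1\<close> this forces the factor \<open>a powr \<theta>\<close> in the
  radius.\<close>

lemma modulus_gain:
  obtains c where "0 < c" "c \<le> 8"
    "\<And>(v::'a::real_inner) z a. a = norm v \<Longrightarrow> 0 < a \<Longrightarrow> a \<le> 1 / 2 \<Longrightarrow> norm (z + v /\<^sub>R 2) \<le> (c / 128 * a powr \<theta>) * a \<Longrightarrow>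
      c / 2 * a powr (\<gamma> + \<theta>) \<le> 2 * \<phi> a - \<phi> (norm (v + z)) - \<phi> (norm (v - z))"
proof -
  obtain c where c: "0 < c" "c \<le> 8"
    and gap: "\<And>a. 0 < a \<Longrightarrow> a \<le> 1 \<Longrightarrow> c * a powr (\<gamma> + \<theta>) \<le> 2 * \<phi> a - \<phi> (a / 2) - \<phi> (3 * a / 2)"
    by (rule modulus_gap) blast
  show ?thesis
  proof (rule that [OF c])
    fix v z :: 'a and a :: real
    assume a: "a = norm v" "0 < a" "a \<le> 1 / 2" and z: "norm (z + v /\<^sub>R 2) \<le> (c / 128 * a powr \<theta>) * a"
    let ?\<eta> = "c / 128 * a powr \<theta>"
    have "a powr \<theta> \<le> 1" using a \<theta> powr_le1 [of \<theta> a] by simp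
    then have "?\<eta> \<le> 8 / 128 * 1" using c by (intro mult_mono) auto
    then have \<eta>: "?\<eta> * a \<le> a / 4" using a by (simp add: mult_right_mono)
    have half: "v /\<^sub>R 2 + v /\<^sub>R 2 = v" using scaleR_half_double [of v] by (simp add: scaleR_add_right)
    have e1: "v + z = v /\<^sub>R 2 + (z + v /\<^sub>R 2)" using half by (simp add: algebra_simps)
    have "(3/2) *\<^sub>R v = v + v /\<^sub>R 2" using scaleR_left_distrib [of 1 "1/2" v] by (simp add: field_simps)
    then have e2: "v - z = (3/2) *\<^sub>R v - (z + v /\<^sub>R 2)" by (simp add: algebra_simps)
    have n1: "\<bar>norm (v + z) - a / 2\<bar> \<le> ?\<eta> * a"
      using norm_triangle_ineq3 [of "v + z" "v /\<^sub>R 2"] z a unfolding e1 by simp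
    have n2: "\<bar>norm (v - z) - 3 * a / 2\<bar> \<le> ?\<eta> * a"
    proof -
      define w where "w = z + v /\<^sub>R 2"
      have "norm w \<le> ?\<eta> * a" using z by (simp add: w_def)
      then show ?thesis
        using norm_triangle_ineq3 [of "(3/2) *\<^sub>R v - w" "(3/2) *\<^sub>R v"] a unfolding e2 w_def [symmetric] by simp
    qed
    have r1: "a / 4 \<le> norm (v + z)" "norm (v + z) \<le> 2 * a" using n1 \<eta> a(2) by linarith+
    have r2: "a / 4 \<le> norm (v - z)" "norm (v - z) \<le> 2 * a" using n2 \<eta> a(2) by linarith+
    have l1: "\<bar>\<phi> (norm (v + z)) - \<phi> (a / 2)\<bar> \<le> 32 * a powr (\<gamma> - 1) * (?\<eta> * a)"
    proof -
      have "\<bar>\<phi> (norm (v + z)) - \<phi> (a / 2)\<bar> \<le> 32 * a powr (\<gamma> - 1) * \<bar>norm (v + z) - a / 2\<bar>"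
        using r1 a(2,3) by (intro modulus_lipschitz) auto
      also have "\<dots> \<le> 32 * a powr (\<gamma> - 1) * (?\<eta> * a)" using n1 by (intro mult_left_mono) auto
      finally show ?thesis .
    qed
    have l2: "\<bar>\<phi> (norm (v - z)) - \<phi> (3 * a / 2)\<bar> \<le> 32 * a powr (\<gamma> - 1) * (?\<eta> * a)"
    proof -
      have "\<bar>\<phi> (norm (v - z)) - \<phi> (3 * a / 2)\<bar> \<le> 32 * a powr (\<gamma> - 1) * \<bar>norm (v - z) - 3 * a / 2\<bar>"
        using r2 a(2,3) by (intro modulus_lipschitz) auto
      also have "\<dots> \<le> 32 * a powr (\<gamma> - 1) * (?\<eta> * a)" using n2 by (intro mult_left_mono) auto
      finally show ?thesis .
    qed
    have "32 * a powr (\<gamma> - 1) * (?\<eta> * a) = c / 4 * (a powr (\<gamma> - 1) * a powr \<theta> * a powr 1)"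
      using a by simp
    also have "a powr (\<gamma> - 1) * a powr \<theta> * a powr 1 = a powr (\<gamma> + \<theta>)"
      by (simp only: powr_add [symmetric]) simp
    finally have "32 * a powr (\<gamma> - 1) * (?\<eta> * a) = c / 4 * a powr (\<gamma> + \<theta>)" .
    then show "c / 2 * a powr (\<gamma> + \<theta>) \<le> 2 * \<phi> a - \<phi> (norm (v + z)) - \<phi> (norm (v - z))"
      using l1 l2 gap [of a] a unfolding abs_le_iff by linarith
  qed
qed

end

section \<open>Doubling of variables\<close>

text \<open>The penalty is centred at the point \<open>x0\<close> where the bound is to be proved, so that positivity
  of the maximum keeps \<open>x\<close> close to \<open>x0\<close> once \<open>m\<close> is large, and the penalty
  does not enter the bound obtained at \<open>x0\<close>.\<close>

lemma doubling_maximum: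
  fixes u :: "'a::euclidean_space \<Rightarrow> real"
  assumes cont: "continuous_on (cball x0 (3 * h)) u" and h: "0 < h" "h \<le> 1/2"
    and \<phi>: "continuous_on {0..} \<phi>"
    and y0: "norm (x0 - y0) \<le> h" and pos: "L * \<phi> (norm (x0 - y0)) < u x0 - u y0"
  obtains x y where "norm (x - x0) \<le> 2 * h" "norm (x - y) \<le> h"
    "L * \<phi> (norm (x - y)) + m * (norm (x - x0))\<^sup>2 < u x - u y"
    "\<And>x' y'. norm (x' - x0) \<le> 2 * h \<Longrightarrow> norm (x' - y') \<le> h \<Longrightarrow>
      u x' - u y' - L * \<phi> (norm (x' - y')) - m * (norm (x' - x0))\<^sup>2
      \<le> u x - u y - L * \<phi> (norm (x - y)) - m * (norm (x - x0))\<^sup>2"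
proof -
  define \<Phi> where "\<Phi> = (\<lambda>w::'a \<times> 'a. u (fst w) - u (snd w) - L * \<phi> (norm (fst w - snd w)) - m * (norm (fst w - x0))\<^sup>2)"
  define D where "D = {w::'a \<times> 'a. norm (fst w - x0) \<le> 2 * h \<and> norm (fst w - snd w) \<le> h}"
  have sub: "fst w \<in> cball x0 (3 * h)" "snd w \<in> cball x0 (3 * h)" if "w \<in> D" for w
  proof -
    show "fst w \<in> cball x0 (3 * h)" using that h by (auto simp: D_def dist_norm norm_minus_commute)
    have "norm (snd w - x0) \<le> norm (fst w - x0) + norm (fst w - snd w)"
      using norm_triangle_ineq4 [of "fst w - x0" "fst w - snd w"] by simp
    then show "snd w \<in> cball x0 (3 * h)" using that by (auto simp: D_def dist_norm norm_minus_commute)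
  qed
  have "closed D" unfolding D_def by (intro closed_Collect_conj closed_Collect_le continuous_intros)
  moreover have "bounded D"
    by (rule bounded_subset [OF bounded_Times [OF bounded_cball bounded_cball]]) (use sub in \<open>auto simp: mem_Times_iff\<close>)
  ultimately have "compact D" by (simp add: compact_eq_bounded_closed)
  moreover have "(x0, y0) \<in> D" using y0 h by (simp add: D_def)
  moreover have "continuous_on D \<Phi>"
  proof -
    have 1: "continuous_on D (\<lambda>w. u (fst w))" "continuous_on D (\<lambda>w. u (snd w))"
      using sub by (auto intro!: continuous_on_compose2 [OF cont] continuous_intros)
    have 2: "continuous_on D (\<lambda>w. \<phi> (norm (fst w - snd w)))"
      by (auto intro!: continuous_on_compose2 [OF \<phi>] continuous_intros)
    show ?thesis unfolding \<Phi>_def by (intro continuous_intros 1 2)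
  qed
  ultimately obtain w where w: "w \<in> D" "\<And>w'. w' \<in> D \<Longrightarrow> \<Phi> w' \<le> \<Phi> w"
    using continuous_attains_sup [of D \<Phi>] by blast
  have "0 < \<Phi> (x0, y0)" using pos by (simp add: \<Phi>_def)
  also have "\<dots> \<le> \<Phi> w" using w(2) [of "(x0, y0)"] \<open>(x0, y0) \<in> D\<close> by simp
  finally have "0 < \<Phi> w" .
  then show ?thesis
    using that [of "fst w" "snd w"] w by (auto simp: D_def \<Phi>_def)
qed


text \<open>These are the functions that touch \<open>- u\<close> at \<open>x\<close> and \<open>u\<close> at
  \<open>y\<close> from below, with the derivative bounds that scaling suggests.\<close>

lemma (in modulus_params) modulus_test_function:
  fixes x y x0 :: "'a::euclidean_space"
  assumes a: "a = norm (x - y)" "0 < a" "a \<le> 1 / 2" and x0: "norm (x - x0) \<le> 1" and m: "0 \<le> m" "m \<le> L"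
    and \<psi>: "\<And>w. \<psi> w = c - L * \<phi> (norm (w - y)) - m * (norm (w - x0))\<^sup>2"
  shows "\<rho> \<le> a \<Longrightarrow> C2_on (ball x \<rho>) \<psi>"
    and "norm z \<le> a / 2 \<Longrightarrow> \<bar>\<psi> (x + z) - \<psi> x\<bar> \<le> 100 * L * a powr (\<gamma> - 1) * norm z"
    and "norm z \<le> a / 2 \<Longrightarrow> \<bar>\<psi> (x + z) + \<psi> (x - z) - 2 * \<psi> x\<bar> \<le> 100 * L * a powr (\<gamma> - 2) * (norm z)\<^sup>2"
proof -
  show "C2_on (ball x \<rho>) \<psi>" if "\<rho> \<le> a"
  proof -
    have y: "y \<notin> ball x \<rho>" using that a by (simp add: dist_norm)
    have "C2_on (ball x \<rho>) (\<lambda>w. 1 * (1 * c + (- L) * (1 * norm (w - y) powr \<gamma> + (- 1 / 2) * norm (w - y) powr (1 + \<theta>)))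
        + (- m) * (norm (w - x0))\<^sup>2)"
      by (intro C2_on_lincomb C2_on_const C2_on_norm_powr C2_on_norm_squared y)
    then show ?thesis by (simp add: \<psi> [abs_def] modulus_def algebra_simps)
  qed
  have L: "0 \<le> L" using m by linarith
  have one: "1 \<le> a powr (\<gamma> - 1)" "1 \<le> a powr (\<gamma> - 2)"
    using powr_mono' [of "\<gamma> - 1" 0 a] powr_mono' [of "\<gamma> - 2" 0 a] a \<gamma> by auto
  have sq: "(norm (x + z - x0))\<^sup>2 = (norm (x - x0))\<^sup>2 + 2 * ((x - x0) \<bullet> z) + (norm z)\<^sup>2" for z
    by (simp add: power2_norm_eq_inner algebra_simps inner_commute)
  show "\<bar>\<psi> (x + z) - \<psi> x\<bar> \<le> 100 * L * a powr (\<gamma> - 1) * norm z" if z: "norm z \<le> a / 2"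
  proof -
    have 1: "\<bar>\<phi> (norm (x + z - y)) - \<phi> a\<bar> \<le> 32 * a powr (\<gamma> - 1) * norm z"
      using modulus_norm_differences(1) [OF a z] by (simp add: algebra_simps)
    have 2: "\<bar>(norm (x + z - x0))\<^sup>2 - (norm (x - x0))\<^sup>2\<bar> \<le> 3 * norm z"
    proof -
      have "\<bar>(x - x0) \<bullet> z\<bar> \<le> norm (x - x0) * norm z" by (rule Cauchy_Schwarz_ineq2)
      also have "\<dots> \<le> 1 * norm z" using x0 by (intro mult_right_mono) auto
      finally have "\<bar>(x - x0) \<bullet> z\<bar> \<le> norm z" by simp
      moreover have "(norm z)\<^sup>2 \<le> norm z" using z a by (simp add: power2_eq_square mult_left_le)
      moreover have "0 \<le> (norm z)\<^sup>2" by simp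
      ultimately show ?thesis unfolding sq by linarith
    qed
    have "\<bar>\<psi> (x + z) - \<psi> x\<bar> = \<bar>L * (\<phi> (norm (x + z - y)) - \<phi> a) + m * ((norm (x + z - x0))\<^sup>2 - (norm (x - x0))\<^sup>2)\<bar>"
      unfolding \<psi> a(1) by (simp add: algebra_simps abs_if)
    also have "\<dots> \<le> L * \<bar>\<phi> (norm (x + z - y)) - \<phi> a\<bar> + m * \<bar>(norm (x + z - x0))\<^sup>2 - (norm (x - x0))\<^sup>2\<bar>"
      by (rule order_trans [OF abs_triangle_ineq]) (use L m in \<open>simp add: abs_mult\<close>)
    also have "\<dots> \<le> L * (32 * a powr (\<gamma> - 1) * norm z) + L * (3 * norm z)"
      using 1 2 L m by (intro add_mono mult_mono) auto
    also have "L * (3 * norm z) \<le> L * (3 * (a powr (\<gamma> - 1) * norm z))"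
      using one L mult_right_mono [OF one(1), of "norm z"] by (intro mult_left_mono) auto
    also have "L * (32 * a powr (\<gamma> - 1) * norm z) + L * (3 * (a powr (\<gamma> - 1) * norm z)) = 35 * (L * a powr (\<gamma> - 1) * norm z)"
      by simp
    also have "\<dots> \<le> 100 * (L * a powr (\<gamma> - 1) * norm z)" using L by (intro mult_right_mono) auto
    finally show ?thesis by (simp add: mult.assoc)
  qed
  show "\<bar>\<psi> (x + z) + \<psi> (x - z) - 2 * \<psi> x\<bar> \<le> 100 * L * a powr (\<gamma> - 2) * (norm z)\<^sup>2" if z: "norm z \<le> a / 2"
  proof -
    have 1: "\<bar>\<phi> (norm (x + z - y)) + \<phi> (norm (x - z - y)) - 2 * \<phi> a\<bar> \<le> 96 * a powr (\<gamma> - 2) * (norm z)\<^sup>2"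
      using modulus_norm_differences(2) [OF a z] by (simp add: algebra_simps)
    have s2: "(norm (x + z - x0))\<^sup>2 + (norm (x - z - x0))\<^sup>2 - 2 * (norm (x - x0))\<^sup>2 = 2 * (norm z)\<^sup>2"
      using sq [of z] sq [of "- z"] by simp
    have "\<psi> (x + z) + \<psi> (x - z) - 2 * \<psi> x
        = - (L * (\<phi> (norm (x + z - y)) + \<phi> (norm (x - z - y)) - 2 * \<phi> a))
          - m * ((norm (x + z - x0))\<^sup>2 + (norm (x - z - x0))\<^sup>2 - 2 * (norm (x - x0))\<^sup>2)"
      unfolding \<psi> a(1) by (simp only: algebra_simps)
    also have "\<dots> = - (L * (\<phi> (norm (x + z - y)) + \<phi> (norm (x - z - y)) - 2 * \<phi> a)) - m * (2 * (norm z)\<^sup>2)"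
      unfolding s2 ..
    also have "\<bar>\<dots>\<bar> \<le> L * \<bar>\<phi> (norm (x + z - y)) + \<phi> (norm (x - z - y)) - 2 * \<phi> a\<bar> + m * (2 * (norm z)\<^sup>2)"
      by (rule order_trans [OF abs_triangle_ineq4]) (use L m in \<open>simp add: abs_mult\<close>)
    also have "\<dots> \<le> L * (96 * a powr (\<gamma> - 2) * (norm z)\<^sup>2) + L * (2 * (norm z)\<^sup>2)"
      using 1 L m by (intro add_mono mult_mono) auto
    also have "L * (2 * (norm z)\<^sup>2) \<le> L * (2 * (a powr (\<gamma> - 2) * (norm z)\<^sup>2))"
      using one L mult_right_mono [OF one(2), of "(norm z)\<^sup>2"] by (intro mult_left_mono) auto
    also have "L * (96 * a powr (\<gamma> - 2) * (norm z)\<^sup>2) + L * (2 * (a powr (\<gamma> - 2) * (norm z)\<^sup>2)) = 98 * (L * a powr (\<gamma> - 2) * (norm z)\<^sup>2)"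
      by simp
    also have "\<dots> \<le> 100 * (L * a powr (\<gamma> - 2) * (norm z)\<^sup>2)" using L by (intro mult_right_mono) auto
    finally show ?thesis by (simp add: mult.assoc)
  qed
qed

section \<open>Absorption for large constants\<close>

abbreviation scaled_power :: "real \<Rightarrow> real \<Rightarrow> real \<Rightarrow> real \<Rightarrow> real \<Rightarrow> real" where
  "scaled_power \<gamma> P e L \<delta> \<equiv> (L * \<delta> powr \<gamma>) powr (P - 1) * \<delta> powr e"

text \<open>Inserts the bounds of the test functions and the radius \<open>\<delta> powr (1 + \<theta>') / 4\<close>
  into the error of \<open>visc_supersol_far_inequality\<close>; the small power
  \<open>\<theta>' * (P - \<tau>)\<close> is the profit from the radius being smaller than
  \<open>\<delta>\<close>.\<close>

lemma near_error_algebra: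
  fixes L a \<gamma> \<theta>' P \<tau> :: real
  assumes "0 < a" "0 < L" "2 \<le> P" "\<tau> < P"
  shows "(100 * L * a powr (\<gamma> - 1)) powr (P - 2) * (100 * L * a powr (\<gamma> - 2)) * (a powr (1 + \<theta>') / 4) powr (P - \<tau>)
    \<le> 100 powr (P - 1) * (scaled_power \<gamma> P (- \<tau> + \<theta>' * (P - \<tau>)) L a)"
proof -
  have 1: "(100 * L * a powr (\<gamma> - 1)) powr (P - 2) = (100 * L) powr (P - 2) * a powr ((\<gamma> - 1) * (P - 2))"
    using assms by (simp add: powr_mult powr_powr)
  have 2: "(100 * L) powr (P - 2) * (100 * L) = (100 * L) powr (P - 1)"
    using assms powr_add [of "100 * L" "P - 2" 1] by simp
  have 3: "(a powr (1 + \<theta>') / 4) powr (P - \<tau>) \<le> a powr ((1 + \<theta>') * (P - \<tau>))"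
  proof -
    have "(a powr (1 + \<theta>') / 4) powr (P - \<tau>) \<le> (a powr (1 + \<theta>')) powr (P - \<tau>)"
      using assms by (intro powr_mono2) auto
    then show ?thesis by (simp add: powr_powr)
  qed
  have 4: "(100 * L * a powr (\<gamma> - 1)) powr (P - 2) * (100 * L * a powr (\<gamma> - 2))
      = (100 * L) powr (P - 1) * (a powr ((\<gamma> - 1) * (P - 2)) * a powr (\<gamma> - 2))"
    unfolding 1 2 [symmetric] by (simp only: mult_ac)
  have "(100 * L * a powr (\<gamma> - 1)) powr (P - 2) * (100 * L * a powr (\<gamma> - 2)) * (a powr (1 + \<theta>') / 4) powr (P - \<tau>)
      \<le> (100 * L) powr (P - 1) * (a powr ((\<gamma> - 1) * (P - 2)) * a powr (\<gamma> - 2)) * a powr ((1 + \<theta>') * (P - \<tau>))"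
    unfolding 4 by (rule mult_left_mono [OF 3]) simp
  also have "\<dots> = (100 * L) powr (P - 1) * (a powr ((\<gamma> - 1) * (P - 2)) * a powr (\<gamma> - 2) * a powr ((1 + \<theta>') * (P - \<tau>)))"
    by simp
  also have "a powr ((\<gamma> - 1) * (P - 2)) * a powr (\<gamma> - 2) * a powr ((1 + \<theta>') * (P - \<tau>))
      = a powr (\<gamma> * (P - 1)) * a powr (- \<tau> + \<theta>' * (P - \<tau>))"
    by (simp only: powr_add [symmetric]) (rule arg_cong [where f = "(powr) a"], simp add: algebra_simps)
  also have "(100 * L) powr (P - 1) * (a powr (\<gamma> * (P - 1)) * a powr (- \<tau> + \<theta>' * (P - \<tau>)))
      = 100 powr (P - 1) * (scaled_power \<gamma> P (- \<tau> + \<theta>' * (P - \<tau>)) L a)"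
    using assms by (simp add: powr_mult powr_powr)
  finally show ?thesis .
qed

lemma gain_algebra:
  fixes L a \<gamma> \<theta> P \<sigma> d c c' :: real
  assumes "0 < a" "0 < L" "0 < c" "0 < c'"
  shows "(c * L * a powr (\<gamma> + \<theta>)) powr (P - 1) * ((c' * a powr \<theta>) * a) powr d * a powr (- (d + \<sigma>))
    = ((c) powr (P - 1) * (c') powr d) * (scaled_power \<gamma> P (- \<sigma> + \<theta> * (P - 1 + d)) L a)"
proof -
  have "(c * L * a powr (\<gamma> + \<theta>)) powr (P - 1) = (c) powr (P - 1) * L powr (P - 1) * a powr ((\<gamma> + \<theta>) * (P - 1))"
    using assms by (simp add: powr_mult powr_powr)
  moreover have "((c' * a powr \<theta>) * a) powr d = (c') powr d * a powr (\<theta> * d) * a powr d"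
    using assms by (simp add: powr_mult powr_powr)
  moreover have "(L * a powr \<gamma>) powr (P - 1) = L powr (P - 1) * a powr (\<gamma> * (P - 1))"
    using assms by (simp add: powr_mult powr_powr)
  moreover have "a powr ((\<gamma> + \<theta>) * (P - 1)) * a powr (\<theta> * d) * a powr d * a powr (- (d + \<sigma>))
      = a powr (\<gamma> * (P - 1)) * a powr (- \<sigma> + \<theta> * (P - 1 + d))"
    by (simp only: powr_add [symmetric]) (rule arg_cong [where f = "(powr) a"], simp add: algebra_simps)
  ultimately show ?thesis by (simp add: mult_ac)
qed

text \<open>At the maximum point \<open>L * \<delta> powr \<gamma>\<close> is bounded, so a large \<open>L\<close>
  makes \<open>\<delta>\<close> as small as desired. All smallness conditions on \<open>\<delta>\<close> are therefore
  stated for large \<open>L\<close>.\<close>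

lemma eventually_small_distance:
  fixes \<gamma> T a0 :: real
  assumes "0 < \<gamma>" "0 < a0"
  shows "\<forall>\<^sub>F L in at_top. \<forall>a>0. L * a powr \<gamma> \<le> T \<longrightarrow> a \<le> a0"
  using eventually_gt_at_top [of "max 0 (T / a0 powr \<gamma>)"]
proof eventually_elim
  case (elim L)
  show ?case
  proof (intro allI impI, rule ccontr)
    fix a assume a: "0 < a" "L * a powr \<gamma> \<le> T" "\<not> a \<le> a0"
    have "a0 powr \<gamma> \<le> a powr \<gamma>" using a assms by (intro powr_mono2) auto
    then have "L * a0 powr \<gamma> \<le> L * a powr \<gamma>" using elim by (intro mult_left_mono) auto
    moreover have "T < L * a0 powr \<gamma>" using elim assms by (simp add: field_simps)
    ultimately show False using a by linarith
  qed
qed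

lemma eventually_small_power:
  fixes \<gamma> T \<zeta> \<epsilon> :: real
  assumes "0 < \<gamma>" "0 < \<zeta>" "0 < \<epsilon>"
  shows "\<forall>\<^sub>F L in at_top. \<forall>a>0. L * a powr \<gamma> \<le> T \<longrightarrow> a powr \<zeta> \<le> \<epsilon>"
proof -
  have "\<forall>\<^sub>F L in at_top. \<forall>a>0. L * a powr \<gamma> \<le> T \<longrightarrow> a \<le> \<epsilon> powr (1 / \<zeta>)"
    using assms by (intro eventually_small_distance) auto
  then show ?thesis
  proof eventually_elim
    case (elim L)
    show ?case
    proof (intro allI impI)
      fix a assume a: "0 < a" "L * a powr \<gamma> \<le> T"
      then have "a powr \<zeta> \<le> (\<epsilon> powr (1 / \<zeta>)) powr \<zeta>" using elim assms by (intro powr_mono2) auto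
      then show "a powr \<zeta> \<le> \<epsilon>" using assms by (simp add: powr_powr)
    qed
  qed
qed

lemma eventually_absorbed:
  fixes \<gamma> T \<omega> e P \<epsilon> C :: real
  assumes "0 < \<gamma>" "2 \<le> P" "0 < \<epsilon>" and e: "\<gamma> * (P - 1) + e \<le> \<omega>" and C: "0 \<le> C"
  shows "\<forall>\<^sub>F L in at_top. \<forall>a>0. L * a powr \<gamma> \<le> T \<longrightarrow> C * a powr \<omega> \<le> \<epsilon> * (scaled_power \<gamma> P e L a)"
  using eventually_small_distance [OF assms(1) zero_less_one, of T] eventually_ge_at_top [of "max 1 (C / \<epsilon>)"]
proof eventually_elim
  case (elim L)
  show ?case
  proof (intro allI impI)
    fix a assume a: "0 < a" "L * a powr \<gamma> \<le> T"
    then have a1: "a \<le> 1" using elim assms by simp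
    have L: "1 \<le> L" "C \<le> \<epsilon> * L" using elim assms by (auto simp: field_simps)
    have "C * a powr \<omega> \<le> (\<epsilon> * L) * a powr (\<gamma> * (P - 1) + e)"
      using a a1 e L C by (intro mult_mono powr_mono') auto
    also have "L = L powr 1" using L by simp
    also have "\<epsilon> * L powr 1 * a powr (\<gamma> * (P - 1) + e) \<le> \<epsilon> * L powr (P - 1) * a powr (\<gamma> * (P - 1) + e)"
      using L assms by (intro mult_right_mono mult_left_mono powr_mono) auto
    also have "\<dots> = \<epsilon> * (scaled_power \<gamma> P e L a)"
      using a L by (simp add: powr_mult powr_powr powr_add mult.commute)
    finally show "C * a powr \<omega> \<le> \<epsilon> * (scaled_power \<gamma> P e L a)" .
  qed
qed

lemma continuous_on_of_lsc_both:
  assumes "lsc_on S u" "lsc_on S (\<lambda>x. - u x)"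
  shows "continuous_on S u"
  unfolding continuous_on_def
proof (intro ballI order_tendstoI)
  fix x c assume x: "x \<in> S"
  show "\<forall>\<^sub>F y in at x within S. c < u y" if "c < u x"
    using assms(1) x that unfolding lsc_on_def by blast
  show "\<forall>\<^sub>F y in at x within S. u y < c" if "u x < c"
  proof -
    have "- c < - u x" using that by simp
    then have "\<forall>\<^sub>F y in at x within S. - c < - u y" using assms(2) x unfolding lsc_on_def by blast
    then show ?thesis by eventually_elim simp
  qed
qed

section \<open>Solutions of the double phase equation\<close>

definition holder_interior :: "('a::euclidean_space \<Rightarrow> real) \<Rightarrow> real \<Rightarrow> bool" where
  "holder_interior u \<kappa> \<longleftrightarrow>
    (\<forall>R<2. \<exists>K. \<forall>x\<in>cball 0 R. \<forall>y\<in>cball 0 R. \<bar>u x - u y\<bar> \<le> K * norm (x - y) powr \<kappa>)"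

text \<open>The exponents \<open>\<omega>\<close> for which \<open>phase_difference_lower\<close> bounds the losses by
  a multiple of \<open>\<delta> powr \<omega>\<close>.\<close>

definition ring_exponents :: "real \<Rightarrow> real \<Rightarrow> real \<Rightarrow> real \<Rightarrow> real \<Rightarrow> real \<Rightarrow> bool" where
  "ring_exponents \<alpha> P \<tau> \<kappa> \<theta>' \<omega> \<longleftrightarrow> \<omega> \<le> \<alpha> \<and>
    (\<exists>e1<0. e1 \<le> 1 + \<kappa> * (P - 2) - \<tau> \<and> \<omega> \<le> \<kappa> / 2 + (1 + \<theta>') * e1) \<and>
    (\<exists>e2<0. e2 \<le> \<kappa> * (P - 2) - \<tau> \<and> \<omega> \<le> \<kappa> + e2 / 2)"

text \<open>Both cases for the coefficient are covered: \<open>\<tau>q\<close> is the effective order of the second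
  phase at the origin, and \<open>\<beta>\<close> a lower bound of \<open>b\<close> near the origin. If
  \<open>b 0 = 0\<close>, then \<open>\<tau>q = s * p\<close> and \<open>\<beta> = 0\<close>; otherwise
  \<open>\<tau>q = t * q\<close> and \<open>\<beta> = b 0 / 2\<close>.\<close>

locale double_phase_solution =
  fixes s t p q \<alpha> B H \<tau>q \<Lambda>q \<beta> h0 :: real and a :: "'a::euclidean_space \<Rightarrow> 'a \<Rightarrow> real" and b u :: "'a \<Rightarrow> real"
  assumes st: "0 < s" "s \<le> t" "t < 1" and pq: "2 \<le> p" "p \<le> q" and \<alpha>: "0 < \<alpha>" "\<alpha> \<le> 1"
    and a_eq: "a x (x + z) = b z" and b_even: "b (- z) = b z" and b_nonneg: "0 \<le> b z" and b_le: "b z \<le> B"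
    and b_holder: "\<bar>b z - b z'\<bar> \<le> H * norm (z - z') powr \<alpha>" and H: "0 \<le> H"
    and sol: "visc_sol s t p q a (ball 0 2) u"
    and \<tau>q: "0 < \<tau>q" "\<tau>q < q" and \<Lambda>q: "B \<le> \<Lambda>q"
    and b_near: "norm z \<le> 1 \<Longrightarrow> b z * norm z powr (- (real DIM('a) + t * q)) \<le> \<Lambda>q * norm z powr (- (real DIM('a) + \<tau>q))"
    and \<beta>: "0 \<le> \<beta>" "0 < h0" "norm z \<le> h0 \<Longrightarrow> \<beta> \<le> b z"
begin

lemma b_borel: "b \<in> borel_measurable borel"
proof -
  have "continuous_on UNIV b"
    unfolding continuous_on_def
  proof
    fix x :: 'a
    have "((\<lambda>y. dist (b y) (b x)) \<longlongrightarrow> 0) (at x)"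
    proof (rule tendsto_sandwich [where f = "\<lambda>_. 0" and h = "\<lambda>y. H * norm (y - x) powr \<alpha>"])
      show "((\<lambda>y. H * norm (y - x) powr \<alpha>) \<longlongrightarrow> 0) (at x)"
      proof -
        have "((\<lambda>y. norm (y - x)) \<longlongrightarrow> 0) (at x)"
          using LIM_zero [OF tendsto_ident_at, of x UNIV] tendsto_norm_zero by blast
        then have "((\<lambda>y. H * norm (y - x) powr \<alpha>) \<longlongrightarrow> H * 0 powr \<alpha>) (at x)"
          using \<alpha> by (intro tendsto_intros tendsto_powr') auto
        then show ?thesis by simp
      qed
    qed (auto simp: dist_real_def b_holder)
    then show "(b \<longlongrightarrow> b x) (at x)" by (subst tendsto_dist_iff)
  qed
  then show ?thesis by (rule borel_measurable_continuous_onI)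
qed

definition kp :: "'a \<Rightarrow> real" where "kp z = norm z powr (- (real DIM('a) + s * p))"
definition kq :: "'a \<Rightarrow> real" where "kq z = b z * norm z powr (- (real DIM('a) + t * q))"

lemma orders: "0 < s * p" "s * p < p" "0 < t * q" "t * q < q"
  using st pq by auto

lemma phase_p: "0 < h \<Longrightarrow> h \<le> 1 \<Longrightarrow> holder_phase p (s * p) (s * p) 1 kp (\<lambda>_. 1) 1 0 \<alpha> h"
proof unfold_locales
  show "kp \<in> borel_measurable borel" unfolding kp_def [abs_def] by measurable
qed (use orders pq \<alpha> in \<open>auto simp: kp_def\<close>)

lemma phase_q: "0 < h \<Longrightarrow> h \<le> 1 \<Longrightarrow> holder_phase q (t * q) \<tau>q \<Lambda>q kq b B H \<alpha> h"
proof unfold_locales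
  show "kq \<in> borel_measurable borel" unfolding kq_def [abs_def] using b_borel by measurable
  show "kq z \<le> \<Lambda>q * norm z powr (- (real DIM('a) + t * q))" for z
    unfolding kq_def using b_le [of z] \<Lambda>q by (intro mult_right_mono) auto
  show "norm z \<le> 1 \<Longrightarrow> kq z \<le> \<Lambda>q * norm z powr (- (real DIM('a) + \<tau>q))" for z
    unfolding kq_def by (rule b_near)
  show "b \<in> borel_measurable borel" by (rule b_borel)
qed (use orders pq \<alpha> \<tau>q H in \<open>auto simp: kq_def b_nonneg b_even b_le b_holder\<close>)

lemma solution_facts:
  shows "visc_supersol s t p q a (ball 0 2) u" "visc_supersol s t p q a (ball 0 2) (\<lambda>x. - u x)"
    "continuous_on (ball 0 2) u" "u \<in> tail_space (p - 1) (s * p)" "u \<in> tail_space (q - 1) (t * q)"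
proof -
  show *: "visc_supersol s t p q a (ball 0 2) u" "visc_supersol s t p q a (ball 0 2) (\<lambda>x. - u x)"
    using sol by (auto simp: visc_sol_def visc_subsol_def)
  show "continuous_on (ball 0 2) u"
    using * by (intro continuous_on_of_lsc_both) (auto simp: visc_supersol_def)
  show "u \<in> tail_space (p - 1) (s * p)" "u \<in> tail_space (q - 1) (t * q)"
    using * by (auto simp: visc_supersol_def)
qed

lemma bounded_interior:
  assumes "R < 2"
  obtains S where "0 < S" "\<And>x. norm x \<le> R \<Longrightarrow> \<bar>u x\<bar> \<le> S"
proof -
  have "continuous_on (cball 0 R) u"
    by (rule continuous_on_subset [OF solution_facts(3)]) (use assms in auto)
  then have "bounded (u ` cball 0 R)" by (intro compact_imp_bounded compact_continuous_image) auto
  then obtain S where "0 < S" "\<forall>v\<in>u ` cball 0 R. norm v \<le> S" using bounded_pos by blast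
  then show ?thesis using that by auto
qed

lemma holder_interior_zero: "holder_interior u 0"
  unfolding holder_interior_def
proof (intro allI impI)
  fix R :: real assume "R < 2"
  then obtain S where S: "0 < S" "\<And>x. norm x \<le> R \<Longrightarrow> \<bar>u x\<bar> \<le> S" using bounded_interior by blast
  show "\<exists>K. \<forall>x\<in>cball 0 R. \<forall>y\<in>cball 0 R. \<bar>u x - u y\<bar> \<le> K * norm (x - y) powr 0"
  proof (intro exI [of _ "2 * S"] ballI)
    fix x y assume "x \<in> cball (0::'a) R" "y \<in> cball (0::'a) R"
    then have "\<bar>u x\<bar> \<le> S" "\<bar>u y\<bar> \<le> S" using S by auto
    then show "\<bar>u x - u y\<bar> \<le> 2 * S * norm (x - y) powr 0" by (cases "x = y") auto
  qed
qed

end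


section \<open>The inequality at the maximum point\<close>

context double_phase_solution begin

text \<open>A violation of the Hoelder bound with constant \<open>L\<close> forces, at the distance
  \<open>\<delta>\<close> of the doubled points, the gains of the two phases to be dominated by their losses. The
  constants do not depend on \<open>x0\<close> and \<open>L\<close>, so that this can be contradicted by letting
  \<open>L\<close> grow.\<close>

lemma key_inequality:
  assumes hr: "holder_interior u \<kappa>" and \<kappa>: "0 \<le> \<kappa>" "\<kappa> \<le> 1" and \<gamma>: "0 < \<gamma>" "\<gamma> \<le> 1"
    and \<theta>: "0 < \<theta>" "\<theta> \<le> 1" and \<theta>': "0 < \<theta>'" and \<gamma>\<theta>: "\<gamma> + \<theta> \<le> 1 + \<kappa> / 2"
    and ring_p: "ring_exponents \<alpha> p (s * p) \<kappa> \<theta>' \<omega>p" and ring_q: "ring_exponents \<alpha> q \<tau>q \<kappa> \<theta>' \<omega>q"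
    and R: "0 \<le> R" "R < 2"
  obtains c C T r0 where "0 < c" "0 < C" "0 < T" "0 < r0"
    "\<forall>\<^sub>F L in at_top. \<forall>x0 y0. norm x0 \<le> R \<longrightarrow> norm (x0 - y0) \<le> r0 \<longrightarrow> L * norm (x0 - y0) powr \<gamma> < u x0 - u y0 \<longrightarrow>
      (\<exists>\<delta>>0. L * \<delta> powr \<gamma> \<le> T \<and>
        c * (scaled_power \<gamma> p (- (s * p) + \<theta> * (p - 1 + real DIM('a))) L \<delta>)
        + c * \<beta> * (scaled_power \<gamma> q (- (t * q) + \<theta> * (q - 1 + real DIM('a))) L \<delta>)
        \<le> C * (scaled_power \<gamma> p (- (s * p) + \<theta>' * (p - s * p)) L \<delta>)
        + C * (scaled_power \<gamma> q (- \<tau>q + \<theta>' * (q - \<tau>q)) L \<delta>)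
        + C * \<delta> powr \<omega>p + C * \<delta> powr \<omega>q)"
proof -
  define d where "d = real DIM('a)"
  define h where "h = min ((2 - R) / 8) h0"
  have h: "0 < h" "h \<le> 1 / 4" "h \<le> h0" "R + 4 * h < 2"
  proof -
    have hle: "h \<le> (2 - R) / 8" "h \<le> h0" unfolding h_def by (rule min.cobounded1, rule min.cobounded2)
    show "0 < h" using R \<beta> by (simp add: h_def)
    show "h \<le> 1 / 4" using hle R by argo
    show "h \<le> h0" by (rule hle)
    show "R + 4 * h < 2" using hle R by argo
  qed
  interpret mp: modulus_params \<gamma> \<theta> using \<gamma> \<theta> by unfold_locales
  interpret hp: holder_phase p "s * p" "s * p" 1 kp "\<lambda>_. 1" 1 0 \<alpha> h using h by (intro phase_p) auto
  interpret hq: holder_phase q "t * q" \<tau>q \<Lambda>q kq b B H \<alpha> h using h by (intro phase_q) auto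
  obtain S where S: "0 < S" "\<And>x. norm x \<le> R + 4 * h \<Longrightarrow> \<bar>u x\<bar> \<le> S"
    using bounded_interior [OF h(4)] by blast
  obtain K where K: "0 < K" "\<And>x y. norm x \<le> R + 4 * h \<Longrightarrow> norm y \<le> R + 4 * h \<Longrightarrow> \<bar>u x - u y\<bar> \<le> K * norm (x - y) powr \<kappa>"
  proof -
    obtain K0 where K0: "\<forall>x\<in>cball 0 (R + 4 * h). \<forall>y\<in>cball 0 (R + 4 * h). \<bar>u x - u y\<bar> \<le> K0 * norm (x - y) powr \<kappa>"
      using hr h(4) unfolding holder_interior_def by blast
    show ?thesis
    proof (rule that [of "\<bar>K0\<bar> + 1"])
      fix x y :: 'a assume "norm x \<le> R + 4 * h" "norm y \<le> R + 4 * h"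
      then have "\<bar>u x - u y\<bar> \<le> K0 * norm (x - y) powr \<kappa>" using K0 by auto
      also have "\<dots> \<le> (\<bar>K0\<bar> + 1) * norm (x - y) powr \<kappa>" by (intro mult_right_mono) auto
      finally show "\<bar>u x - u y\<bar> \<le> (\<bar>K0\<bar> + 1) * norm (x - y) powr \<kappa>" .
    qed auto
  qed
  define m where "m = 2 * S / h\<^sup>2 + 1"
  have m: "0 < m" "2 * S < m * h\<^sup>2" using S h by (auto simp: m_def field_simps add_pos_pos)
  define m1 where "m1 = m * (2 * sqrt (K / m) + 1)"
  have m1: "0 < m1" using m K by (simp add: m1_def add_nonneg_pos)
  obtain c0 where c0: "0 < c0" "c0 \<le> 8" and gain: "\<And>(v::'a) z \<delta>. \<delta> = norm v \<Longrightarrow> 0 < \<delta> \<Longrightarrow> \<delta> \<le> 1 / 2 \<Longrightarrow>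
      norm (z + v /\<^sub>R 2) \<le> (c0 / 128 * \<delta> powr \<theta>) * \<delta> \<Longrightarrow>
      c0 / 2 * \<delta> powr (\<gamma> + \<theta>) \<le> 2 * mp.\<phi> \<delta> - mp.\<phi> (norm (v + z)) - mp.\<phi> (norm (v - z))"
    by (rule mp.modulus_gain [where 'a = 'a]) blast
  obtain e1 e2 where ep: "e1 < 0" "e1 \<le> 1 + \<kappa> * (p - 2) - s * p" "e2 < 0" "e2 \<le> \<kappa> * (p - 2) - s * p"
      "\<omega>p \<le> \<alpha>" "\<omega>p \<le> \<kappa> / 2 + (1 + \<theta>') * e1" "\<omega>p \<le> \<kappa> + e2 / 2"
    using ring_p unfolding ring_exponents_def by blast
  obtain f1 f2 where eq: "f1 < 0" "f1 \<le> 1 + \<kappa> * (q - 2) - \<tau>q" "f2 < 0" "f2 \<le> \<kappa> * (q - 2) - \<tau>q"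
      "\<omega>q \<le> \<alpha>" "\<omega>q \<le> \<kappa> / 2 + (1 + \<theta>') * f1" "\<omega>q \<le> \<kappa> + f2 / 2"
    using ring_q unfolding ring_exponents_def by blast
  have SK: "0 \<le> S" "0 \<le> K" "0 \<le> m1" using S K m1 by auto
  obtain cp Cp where cp: "0 < cp" "0 < Cp" and low_p: "\<And>x y g \<eta> \<beta>' \<delta> \<rho>. doubling_pair u h \<kappa> K m1 S x y g \<eta> \<Longrightarrow>
      \<delta> = norm (x - y) \<Longrightarrow> \<rho> = \<delta> powr (1 + \<theta>') / 4 \<Longrightarrow> 0 \<le> \<beta>' \<Longrightarrow> (\<And>z::'a. norm z \<le> h \<Longrightarrow> \<beta>' \<le> 1) \<Longrightarrow>
      cp * \<beta>' * g powr (p - 1) * (\<eta> * \<delta>) powr real DIM('a) * \<delta> powr (- (real DIM('a) + s * p)) - Cp * \<delta> powr \<omega>p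
      \<le> exterior_integral p kp u \<rho> x
        - exterior_integral p kp u \<rho> y"
    by (rule hp.phase_difference_lower [OF solution_facts(4) \<kappa> \<theta>' ep(1-7) SK]) blast
  obtain cq Cq where cq: "0 < cq" "0 < Cq" and low_q: "\<And>x y g \<eta> \<beta>' \<delta> \<rho>. doubling_pair u h \<kappa> K m1 S x y g \<eta> \<Longrightarrow>
      \<delta> = norm (x - y) \<Longrightarrow> \<rho> = \<delta> powr (1 + \<theta>') / 4 \<Longrightarrow> 0 \<le> \<beta>' \<Longrightarrow> (\<And>z. norm z \<le> h \<Longrightarrow> \<beta>' \<le> b z) \<Longrightarrow>
      cq * \<beta>' * g powr (q - 1) * (\<eta> * \<delta>) powr real DIM('a) * \<delta> powr (- (real DIM('a) + t * q)) - Cq * \<delta> powr \<omega>q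
      \<le> exterior_integral q kq u \<rho> x
        - exterior_integral q kq u \<rho> y"
    by (rule hq.phase_difference_lower [OF solution_facts(5) \<kappa> \<theta>' eq(1-7) SK]) blast
  have kq_eq: "kq z = a x (x + z) * norm z powr (- (real DIM('a) + t * q))" for x z
    by (simp add: a_eq kq_def)
  obtain Cv where Cv: "0 < Cv" and visc: "\<And>u \<Omega> x r \<psi> G N. visc_supersol s t p q a \<Omega> u \<Longrightarrow> test_from_below \<Omega> u x r \<psi> G N \<Longrightarrow>
       0 \<le> exterior_integral p kp u r x
         + exterior_integral q kq u r x
         + Cv * (G powr (p - 2) * N * r powr (p - s * p) + G powr (q - 2) * N * r powr (q - \<tau>q))"
    by (rule visc_supersol_far_inequality [OF hp.phase_kernel_axioms hq.phase_kernel_axioms kp_def kq_eq]) blast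
  define wp where "wp = (c0 / 4) powr (p - 1) * (c0 / 128) powr d"
  define wq where "wq = (c0 / 4) powr (q - 1) * (c0 / 128) powr d"
  have w: "0 < wp" "0 < wq" using c0 by (auto simp: wp_def wq_def)
  define c where "c = min (cp * wp) (cq * wq)"
  define C where "C = 2 * Cv * 100 powr (q - 1) + Cp + Cq"
  have c: "0 < c" using cp cq w by (simp add: c_def)
  have C: "0 < C" using Cv cp cq by (simp add: C_def add_pos_pos)
  have "0 < 4 * S" using S by simp
  show ?thesis
  proof (rule that [OF c C \<open>0 < 4 * S\<close> h(1)])
    have ev1: "\<forall>\<^sub>F L in at_top. \<forall>\<delta>>0. L * \<delta> powr \<gamma> \<le> 4 * S \<longrightarrow> \<delta> \<le> h / 4"
      using \<gamma> h by (intro eventually_small_distance) auto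
    have ev2: "\<forall>\<^sub>F L in at_top. max (max 1 m) (8 * m1 / c0) \<le> L" by (rule eventually_ge_at_top)
    show "\<forall>\<^sub>F L in at_top. \<forall>x0 y0. norm x0 \<le> R \<longrightarrow> norm (x0 - y0) \<le> h \<longrightarrow> L * norm (x0 - y0) powr \<gamma> < u x0 - u y0 \<longrightarrow>
      (\<exists>\<delta>>0. L * \<delta> powr \<gamma> \<le> 4 * S \<and>
        c * (scaled_power \<gamma> p (- (s * p) + \<theta> * (p - 1 + real DIM('a))) L \<delta>)
        + c * \<beta> * (scaled_power \<gamma> q (- (t * q) + \<theta> * (q - 1 + real DIM('a))) L \<delta>)
        \<le> C * (scaled_power \<gamma> p (- (s * p) + \<theta>' * (p - s * p)) L \<delta>)
        + C * (scaled_power \<gamma> q (- \<tau>q + \<theta>' * (q - \<tau>q)) L \<delta>)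
        + C * \<delta> powr \<omega>p + C * \<delta> powr \<omega>q)"
      using ev1 ev2
    proof (eventually_elim, intro allI impI)
      fix L :: real and x0 y0 :: 'a
      assume small: "\<forall>\<delta>>0. L * \<delta> powr \<gamma> \<le> 4 * S \<longrightarrow> \<delta> \<le> h / 4"
        and Lbig: "max (max 1 m) (8 * m1 / c0) \<le> L"
        and x0: "norm x0 \<le> R" and y0: "norm (x0 - y0) \<le> h"
        and fail: "L * norm (x0 - y0) powr \<gamma> < u x0 - u y0"
      have L: "1 \<le> L" "m \<le> L" "8 * m1 \<le> c0 * L" "0 < L"
        using Lbig c0 by (auto simp: field_simps)
      have "L * mp.\<phi> (norm (x0 - y0)) < u x0 - u y0"
      proof -
        have "L * mp.\<phi> (norm (x0 - y0)) \<le> L * norm (x0 - y0) powr \<gamma>"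
          using L y0 h by (intro mult_left_mono mp.modulus_bounds) auto
        then show ?thesis using fail by linarith
      qed
      moreover have "continuous_on (cball x0 (3 * h)) u"
      proof (rule continuous_on_subset [OF solution_facts(3)])
        show "cball x0 (3 * h) \<subseteq> ball 0 2"
        proof
          fix w assume "w \<in> cball x0 (3 * h)"
          then have "norm (w - x0) \<le> 3 * h" by (simp add: dist_norm norm_minus_commute)
          then have "norm w < 2" using norm_triangle_sub [of w x0] x0 h by linarith
          then show "w \<in> ball 0 2" by simp
        qed
      qed
      moreover have "continuous_on {0..} mp.\<phi>"
        unfolding modulus_def [abs_def] using \<gamma> \<theta>
        by (intro continuous_on_diff continuous_on_divide continuous_on_powr' continuous_on_id continuous_on_const) auto
      ultimately obtain x y where xx0: "norm (x - x0) \<le> 2 * h" and xy: "norm (x - y) \<le> h"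
        and pos: "L * mp.\<phi> (norm (x - y)) + m * (norm (x - x0))\<^sup>2 < u x - u y"
        and max: "\<And>x' y'. norm (x' - x0) \<le> 2 * h \<Longrightarrow> norm (x' - y') \<le> h \<Longrightarrow>
          u x' - u y' - L * mp.\<phi> (norm (x' - y')) - m * (norm (x' - x0))\<^sup>2
          \<le> u x - u y - L * mp.\<phi> (norm (x - y)) - m * (norm (x - x0))\<^sup>2"
        using doubling_maximum [of x0 h u mp.\<phi> y0 L m] h y0 by auto
      define \<delta> where "\<delta> = norm (x - y)"
      have nx: "norm x \<le> R + 2 * h" using norm_triangle_sub [of x x0] xx0 x0 by linarith
      have ny: "norm y \<le> R + 3 * h" using norm_triangle_sub [of y x] nx xy by (simp add: norm_minus_commute)
      have ux: "\<bar>u x\<bar> \<le> S" and uy: "\<bar>u y\<bar> \<le> S" using S(2) nx ny h by auto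
      have \<delta>1: "0 \<le> \<delta>" "\<delta> \<le> 1" using xy h by (auto simp: \<delta>_def)
      have mn: "0 \<le> m * (norm (x - x0))\<^sup>2" using m by simp
      have \<phi>\<delta>: "\<delta> powr \<gamma> / 2 \<le> mp.\<phi> \<delta>" using mp.modulus_bounds [OF \<delta>1] by simp
      have L\<phi>: "L * (\<delta> powr \<gamma> / 2) \<le> L * mp.\<phi> \<delta>" using \<phi>\<delta> L by (intro mult_left_mono) auto
      have \<delta>: "0 < \<delta>"
      proof (rule ccontr)
        assume "\<not> 0 < \<delta>"
        then have "x = y" by (simp add: \<delta>_def)
        then show False using pos mn by (simp add: modulus_def)
      qed
      have L\<delta>: "L * \<delta> powr \<gamma> \<le> 4 * S"
        using L\<phi> pos mn ux uy unfolding \<delta>_def by linarith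
      then have \<delta>h: "\<delta> \<le> h / 4" using small \<delta> by blast
      have uyx: "u y \<le> u x"
      proof -
        have "0 \<le> L * (\<delta> powr \<gamma> / 2)" using L by simp
        then show ?thesis using L\<phi> pos mn unfolding \<delta>_def by linarith
      qed
      have m_le: "m * (norm (x - x0))\<^sup>2 \<le> u x - u y"
      proof -
        have "0 \<le> L * (\<delta> powr \<gamma> / 2)" using L by simp
        then show ?thesis using L\<phi> pos unfolding \<delta>_def by linarith
      qed
      \<comment> \<open>\<open>m\<close> was chosen so that \<open>m * h\<^sup>2\<close> exceeds the oscillation of \<open>u\<close>\<close>
      have xh: "norm (x - x0) \<le> h"
      proof -
        have "m * (norm (x - x0))\<^sup>2 \<le> m * h\<^sup>2" using m_le ux uy m by linarith
        then have "(norm (x - x0))\<^sup>2 \<le> h\<^sup>2" using m by simp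
        then show ?thesis by (rule power2_le_imp_le) (use h in simp)
      qed
      \<comment> \<open>the penalty at the maximum is at most the Hoelder bound for \<open>u x - u y\<close>, so its gradient is small\<close>
      have x_small: "norm (x - x0) \<le> sqrt (K / m) * \<delta> powr (\<kappa> / 2)"
      proof -
        have "m * (norm (x - x0))\<^sup>2 \<le> K * \<delta> powr \<kappa>"
          using m_le K(2) [of x y] nx ny h unfolding \<delta>_def by linarith
        then have "(norm (x - x0))\<^sup>2 \<le> K / m * \<delta> powr \<kappa>" using m by (simp add: field_simps)
        also have "\<dots> = (sqrt (K / m) * \<delta> powr (\<kappa> / 2))\<^sup>2"
        proof -
          have "(\<delta> powr (\<kappa> / 2))\<^sup>2 = \<delta> powr \<kappa>"
            unfolding power2_eq_square by (simp add: powr_add [symmetric])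
          moreover have "(sqrt (K / m))\<^sup>2 = K / m" using K m by simp
          ultimately show ?thesis by (simp only: power_mult_distrib)
        qed
        finally show ?thesis by (rule power2_le_imp_le) (use K m in simp)
      qed
      have quad: "m * (norm (x + z - x0))\<^sup>2 - m * (norm (x - x0))\<^sup>2 \<le> m1 * (\<delta> powr (\<kappa> / 2) * norm z + (norm z)\<^sup>2)" for z
      proof -
        have "(norm (x + z - x0))\<^sup>2 = (norm (x - x0))\<^sup>2 + 2 * ((x - x0) \<bullet> z) + (norm z)\<^sup>2"
          by (simp add: power2_norm_eq_inner algebra_simps inner_commute)
        moreover have "(x - x0) \<bullet> z \<le> norm (x - x0) * norm z" by (rule norm_cauchy_schwarz)
        moreover have "norm (x - x0) * norm z \<le> sqrt (K / m) * \<delta> powr (\<kappa> / 2) * norm z"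
          using x_small by (intro mult_right_mono) auto
        ultimately have "(norm (x + z - x0))\<^sup>2 - (norm (x - x0))\<^sup>2 \<le> 2 * (sqrt (K / m) * \<delta> powr (\<kappa> / 2) * norm z) + (norm z)\<^sup>2"
          by linarith
        also have "\<dots> \<le> (2 * sqrt (K / m) + 1) * (\<delta> powr (\<kappa> / 2) * norm z + (norm z)\<^sup>2)"
        proof -
          have "0 \<le> \<delta> powr (\<kappa> / 2) * norm z" "0 \<le> sqrt (K / m) * (norm z)\<^sup>2" using K m by auto
          then show ?thesis by (simp add: algebra_simps)
        qed
        finally have "m * ((norm (x + z - x0))\<^sup>2 - (norm (x - x0))\<^sup>2) \<le> m * ((2 * sqrt (K / m) + 1) * (\<delta> powr (\<kappa> / 2) * norm z + (norm z)\<^sup>2))"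
          using m by (intro mult_left_mono) auto
        then show ?thesis by (simp add: m1_def right_diff_distrib mult.assoc)
      qed
      have near: "norm (x + z) \<le> R + 4 * h" "norm (y + z) \<le> R + 4 * h" "norm (x + z - x0) \<le> 2 * h" if "norm z \<le> h" for z
      proof -
        show "norm (x + z) \<le> R + 4 * h" using norm_triangle_ineq [of x z] nx that h by linarith
        show "norm (y + z) \<le> R + 4 * h" using norm_triangle_ineq [of y z] ny that h by linarith
        show "norm (x + z - x0) \<le> 2 * h" using norm_triangle_ineq [of "x - x0" z] xh that by (simp add: algebra_simps)
      qed
      have max_x: "u (x + z) - L * mp.\<phi> (norm (x + z - y)) - m * (norm (x + z - x0))\<^sup>2
          \<le> u x - L * mp.\<phi> \<delta> - m * (norm (x - x0))\<^sup>2" if "norm z \<le> \<delta>" for z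
      proof -
        have "norm (x + z - y) \<le> h"
          using norm_triangle_ineq [of "x - y" z] that \<delta>h h by (simp add: \<delta>_def algebra_simps)
        then show ?thesis using max [of "x + z" y] near(3) [of z] that \<delta>h h by (simp add: \<delta>_def)
      qed
      have max_y: "- u (y + z) - L * mp.\<phi> (norm (x - (y + z))) \<le> - u y - L * mp.\<phi> \<delta>" if "norm z \<le> \<delta>" for z
      proof -
        have "norm (x - (y + z)) \<le> h"
          using norm_triangle_ineq4 [of "x - y" z] that \<delta>h h by (simp add: \<delta>_def algebra_simps)
        then show ?thesis using max [of x "y + z"] xh h by (simp add: \<delta>_def)
      qed
      define g where "g = c0 / 4 * L * \<delta> powr (\<gamma> + \<theta>)"
      define \<eta> where "\<eta> = c0 / 128 * \<delta> powr \<theta>"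
      have \<eta>: "0 < \<eta>" "\<eta> \<le> 1 / 4"
      proof -
        show "0 < \<eta>" using c0 \<delta> by (simp add: \<eta>_def)
        have "\<delta> powr \<theta> \<le> 1" using \<delta>1 \<theta> by (intro powr_le1) auto
        then have "\<eta> \<le> 8 / 128 * 1" unfolding \<eta>_def using c0 by (intro mult_mono) auto
        then show "\<eta> \<le> 1 / 4" by simp
      qed
      have pair: "doubling_pair u h \<kappa> K m1 S x y g \<eta>"
        unfolding doubling_pair_def \<delta>_def [symmetric]
      proof (intro conjI allI impI)
        show "0 < \<delta>" "\<delta> \<le> h / 2" "norm y \<le> 2" "\<bar>u y\<bar> \<le> S" "u y \<le> u x" "0 < \<eta>" "\<eta> \<le> 1 / 4"
          using \<delta> \<delta>h ny h uy uyx \<eta> by auto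
        show "0 \<le> g" using c0 L by (simp add: g_def)
        fix z :: 'a
        show "\<bar>u (x + z) - u (y + z)\<bar> \<le> K * \<delta> powr \<kappa>" if "norm z < h"
          using K(2) [of "x + z" "y + z"] near [of z] that by (simp add: \<delta>_def)
        show "\<bar>u x - u (x + z)\<bar> \<le> K * norm z powr \<kappa>" if "norm z < h"
          using K(2) [of x "x + z"] near [of z] that nx h by simp
        show "\<bar>u y - u (y + z)\<bar> \<le> K * norm z powr \<kappa>" if "norm z < h"
          using K(2) [of y "y + z"] near [of z] that ny h by simp
        show "u (x + z) - u (y + z) \<le> u x - u y + m1 * (\<delta> powr (\<kappa> / 2) * norm z + (norm z)\<^sup>2)" if "norm z < h"
          using max [of "x + z" "y + z"] near(3) [of z] that xy quad [of z] by simp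
        show "g \<le> (u x - u (x + z)) - (u y - u (y + z))" if z: "norm (z + (x - y) /\<^sub>R 2) \<le> \<eta> * \<delta>"
        proof -
          have "\<eta> * \<delta> \<le> \<delta> / 2" using \<eta> \<delta> by simp
          moreover have "norm ((x - y) /\<^sub>R 2) = \<delta> / 2" by (simp add: \<delta>_def)
          ultimately have zd: "norm z \<le> \<delta>"
            using norm_triangle_ineq4 [of "z + (x - y) /\<^sub>R 2" "(x - y) /\<^sub>R 2"] z by simp
          have G: "c0 / 2 * \<delta> powr (\<gamma> + \<theta>) \<le> 2 * mp.\<phi> \<delta> - mp.\<phi> (norm ((x - y) + z)) - mp.\<phi> (norm ((x - y) - z))"
            using z \<delta> \<delta>h h by (intro gain) (auto simp: \<delta>_def \<eta>_def)
          have "L * (c0 / 2 * \<delta> powr (\<gamma> + \<theta>)) \<le> L * (2 * mp.\<phi> \<delta> - mp.\<phi> (norm ((x - y) + z)) - mp.\<phi> (norm ((x - y) - z)))"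
            using G L by (intro mult_left_mono) auto
          moreover have "m1 * (\<delta> powr (\<kappa> / 2) * norm z + (norm z)\<^sup>2) \<le> L * (c0 / 4 * \<delta> powr (\<gamma> + \<theta>))"
          proof -
            have p1: "\<delta> powr (\<kappa> / 2) * \<delta> = \<delta> powr (1 + \<kappa> / 2)" using \<delta> by (simp add: powr_add)
            have p2: "\<delta> powr 2 = \<delta>\<^sup>2" using \<delta> by simp
            have "\<delta> powr 2 \<le> \<delta> powr (1 + \<kappa> / 2)" using \<delta> \<delta>1 \<kappa> by (intro powr_mono') auto
            moreover have "(norm z)\<^sup>2 \<le> \<delta>\<^sup>2" using zd by (simp add: power_mono)
            moreover have "\<delta> powr (\<kappa> / 2) * norm z \<le> \<delta> powr (\<kappa> / 2) * \<delta>" using zd by (intro mult_left_mono) auto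
            ultimately have "\<delta> powr (\<kappa> / 2) * norm z + (norm z)\<^sup>2 \<le> 2 * \<delta> powr (1 + \<kappa> / 2)"
              using p1 p2 by linarith
            also have "\<dots> \<le> 2 * \<delta> powr (\<gamma> + \<theta>)"
              using \<delta> \<delta>1 \<gamma>\<theta> powr_mono' [of "\<gamma> + \<theta>" "1 + \<kappa> / 2" \<delta>] by simp
            finally have "m1 * (\<delta> powr (\<kappa> / 2) * norm z + (norm z)\<^sup>2) \<le> m1 * (2 * \<delta> powr (\<gamma> + \<theta>))"
              using m1 by (intro mult_left_mono) auto
            also have "\<dots> = (8 * m1) * (\<delta> powr (\<gamma> + \<theta>) / 4)" by simp
            also have "\<dots> \<le> (c0 * L) * (\<delta> powr (\<gamma> + \<theta>) / 4)" using L by (intro mult_right_mono) auto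
            finally show ?thesis by (simp add: mult_ac)
          qed
          moreover have "L * (c0 / 2 * \<delta> powr (\<gamma> + \<theta>)) = 2 * g" "L * (c0 / 4 * \<delta> powr (\<gamma> + \<theta>)) = g"
            by (auto simp: g_def)
          moreover have "norm (x + z - y) = norm ((x - y) + z)" "norm (x - (y + z)) = norm ((x - y) - z)"
            by (simp_all add: algebra_simps)
          ultimately show ?thesis
            using max_x [OF zd] max_y [OF zd] quad [of z] by (simp add: right_diff_distrib)
        qed
      qed
      define \<rho> where "\<rho> = \<delta> powr (1 + \<theta>') / 4"
      have \<rho>: "0 < \<rho>" "\<rho> \<le> \<delta> / 4"
      proof -
        show "0 < \<rho>" using \<delta> by (simp add: \<rho>_def)
        have "\<delta> powr (1 + \<theta>') \<le> \<delta> powr 1" using \<delta> \<delta>1 \<theta>' by (intro powr_mono') auto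
        then show "\<rho> \<le> \<delta> / 4" using \<delta> by (simp add: \<rho>_def)
      qed
      define G where "G = 100 * L * \<delta> powr (\<gamma> - 1)"
      define N where "N = 100 * L * \<delta> powr (\<gamma> - 2)"
      have GN: "0 \<le> G" "0 \<le> N" using L by (auto simp: G_def N_def)
      have sub: "ball x \<rho> \<subseteq> ball 0 2" "ball y \<rho> \<subseteq> ball 0 2"
      proof -
        show "ball x \<rho> \<subseteq> ball 0 2"
        proof
          fix w assume "w \<in> ball x \<rho>"
          then show "w \<in> ball 0 2" using norm_triangle_sub [of w x] nx \<rho> \<delta>h h by (simp add: dist_norm norm_minus_commute)
        qed
        show "ball y \<rho> \<subseteq> ball 0 2"
        proof
          fix w assume "w \<in> ball y \<rho>"
          then show "w \<in> ball 0 2" using norm_triangle_sub [of w y] ny \<rho> \<delta>h h by (simp add: dist_norm norm_minus_commute)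
        qed
      qed
      have \<delta>2: "\<delta> \<le> 1 / 2" using \<delta>h h by simp
      define \<psi>x where "\<psi>x w = (- u x + L * mp.\<phi> \<delta> + m * (norm (x - x0))\<^sup>2) - L * mp.\<phi> (norm (w - y)) - m * (norm (w - x0))\<^sup>2" for w
      define \<psi>y where "\<psi>y w = (u y + L * mp.\<phi> \<delta>) - L * mp.\<phi> (norm (w - x)) - 0 * (norm (w - y))\<^sup>2" for w
      have tx: "test_from_below (ball 0 2) (\<lambda>w. - u w) x \<rho> \<psi>x G N"
        unfolding test_from_below_def
      proof (intro conjI ballI allI impI)
        note T = mp.modulus_test_function [OF \<delta>_def \<delta> \<delta>2, of x0 m L \<psi>x "- u x + L * mp.\<phi> \<delta> + m * (norm (x - x0))\<^sup>2", OF _ _ L(2) \<psi>x_def]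
        show "C2_on (ball x \<rho>) \<psi>x" using xh h m \<rho> \<delta> by (intro T) auto
        show "\<psi>x x = - u x" by (simp add: \<psi>x_def \<delta>_def)
        show "\<psi>x w \<le> - u w" if "w \<in> ball x \<rho>" for w
          using max_x [of "w - x"] that \<rho> \<delta> by (simp add: \<psi>x_def dist_norm norm_minus_commute)
        show "\<bar>\<psi>x (x + z) - \<psi>x x\<bar> \<le> G * norm z" if "norm z < \<rho>" for z
          unfolding G_def using xh h m \<rho> \<delta> that by (intro T) auto
        show "\<bar>\<psi>x (x + z) + \<psi>x (x - z) - 2 * \<psi>x x\<bar> \<le> N * (norm z)\<^sup>2" if "norm z < \<rho>" for z
          unfolding N_def using xh h m \<rho> \<delta> that by (intro T) auto
      qed (use \<rho> \<delta>2 sub GN in auto)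
      have \<delta>_def': "\<delta> = norm (y - x)" by (simp add: \<delta>_def norm_minus_commute)
      have ty: "test_from_below (ball 0 2) u y \<rho> \<psi>y G N"
        unfolding test_from_below_def
      proof (intro conjI ballI allI impI)
        have L0: "0 \<le> L" using L by simp
        note T = mp.modulus_test_function [OF \<delta>_def' \<delta> \<delta>2, of y 0 L \<psi>y "u y + L * mp.\<phi> \<delta>", OF _ _ L0 \<psi>y_def]
        show "C2_on (ball y \<rho>) \<psi>y" using \<rho> \<delta> by (intro T) auto
        show "\<psi>y y = u y" by (simp add: \<psi>y_def \<delta>_def')
        show "\<psi>y w \<le> u w" if "w \<in> ball y \<rho>" for w
          using max_y [of "w - y"] that \<rho> \<delta> by (simp add: \<psi>y_def dist_norm norm_minus_commute)
        show "\<bar>\<psi>y (y + z) - \<psi>y y\<bar> \<le> G * norm z" if "norm z < \<rho>" for z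
          unfolding G_def using \<rho> \<delta> that by (intro T) auto
        show "\<bar>\<psi>y (y + z) + \<psi>y (y - z) - 2 * \<psi>y y\<bar> \<le> N * (norm z)\<^sup>2" if "norm z < \<rho>" for z
          unfolding N_def using \<rho> \<delta> that by (intro T) auto
      qed (use \<rho> \<delta>2 sub GN in auto)
      let ?I = "\<lambda>P k x. exterior_integral P k u \<rho> x"
      let ?E = "G powr (p - 2) * N * \<rho> powr (p - s * p) + G powr (q - 2) * N * \<rho> powr (q - \<tau>q)"
      have neg: "exterior_integral P k (\<lambda>w. - u w) \<rho> x = - ?I P k x" for P k x
      proof -
        have "signed_pow P (- u x - - u (x + z)) = - signed_pow P (u x - u (x + z))" for z
          using signed_pow_minus [of P "u x - u (x + z)"] by simp
        then show ?thesis by simp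
      qed
      have Ix: "?I p kp x + ?I q kq x \<le> Cv * ?E"
        using visc [OF solution_facts(2) tx] unfolding neg by simp
      have Iy: "0 \<le> ?I p kp y + ?I q kq y + Cv * ?E"
        by (rule visc [OF solution_facts(1) ty])
      let ?X = "scaled_power \<gamma> p (- (s * p) + \<theta>' * (p - s * p)) L \<delta>"
      let ?Y = "scaled_power \<gamma> q (- \<tau>q + \<theta>' * (q - \<tau>q)) L \<delta>"
      let ?Gp = "scaled_power \<gamma> p (- (s * p) + \<theta> * (p - 1 + d)) L \<delta>"
      let ?Gq = "scaled_power \<gamma> q (- (t * q) + \<theta> * (q - 1 + d)) L \<delta>"
      have E: "?E \<le> 100 powr (q - 1) * ?X + 100 powr (q - 1) * ?Y"
      proof (rule add_mono)
        have "G powr (p - 2) * N * \<rho> powr (p - s * p) \<le> 100 powr (p - 1) * ?X"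
          unfolding G_def N_def \<rho>_def using \<delta> L pq orders by (intro near_error_algebra) auto
        also have "\<dots> \<le> 100 powr (q - 1) * ?X" using pq by (intro mult_right_mono powr_mono) auto
        finally show "G powr (p - 2) * N * \<rho> powr (p - s * p) \<le> 100 powr (q - 1) * ?X" .
        show "G powr (q - 2) * N * \<rho> powr (q - \<tau>q) \<le> 100 powr (q - 1) * ?Y"
          unfolding G_def N_def \<rho>_def using \<delta> L pq \<tau>q by (intro near_error_algebra) auto
      qed
      have lp: "cp * wp * ?Gp - Cp * \<delta> powr \<omega>p \<le> ?I p kp x - ?I p kp y"
      proof -
        have "cp * 1 * g powr (p - 1) * (\<eta> * \<delta>) powr real DIM('a) * \<delta> powr (- (real DIM('a) + s * p)) - Cp * \<delta> powr \<omega>p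
          \<le> ?I p kp x - ?I p kp y"
          by (rule low_p [OF pair \<delta>_def \<rho>_def]) auto
        moreover have "g powr (p - 1) * (\<eta> * \<delta>) powr d * \<delta> powr (- (d + s * p)) = wp * ?Gp"
          unfolding g_def \<eta>_def wp_def using \<delta> L c0 by (intro gain_algebra) auto
        ultimately show ?thesis unfolding d_def by (simp add: mult.assoc)
      qed
      have lq: "cq * \<beta> * wq * ?Gq - Cq * \<delta> powr \<omega>q \<le> ?I q kq x - ?I q kq y"
      proof -
        have "cq * \<beta> * g powr (q - 1) * (\<eta> * \<delta>) powr real DIM('a) * \<delta> powr (- (real DIM('a) + t * q)) - Cq * \<delta> powr \<omega>q
          \<le> ?I q kq x - ?I q kq y"
          using \<beta> h by (intro low_q [OF pair \<delta>_def \<rho>_def]) auto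
        moreover have "g powr (q - 1) * (\<eta> * \<delta>) powr d * \<delta> powr (- (d + t * q)) = wq * ?Gq"
          unfolding g_def \<eta>_def wq_def using \<delta> L c0 by (intro gain_algebra) auto
        ultimately show ?thesis unfolding d_def by (simp add: mult.assoc)
      qed
      have cG: "c * ?Gp \<le> cp * wp * ?Gp" "c * \<beta> * ?Gq \<le> cq * \<beta> * wq * ?Gq"
      proof -
        show "c * ?Gp \<le> cp * wp * ?Gp" by (intro mult_right_mono) (auto simp: c_def)
        have "c * (\<beta> * ?Gq) \<le> (cq * wq) * (\<beta> * ?Gq)" using \<beta> by (intro mult_right_mono) (auto simp: c_def)
        then show "c * \<beta> * ?Gq \<le> cq * \<beta> * wq * ?Gq" by (simp add: mult_ac)
      qed
      have XY: "0 \<le> ?X" "0 \<le> ?Y" "0 \<le> \<delta> powr \<omega>p" "0 \<le> \<delta> powr \<omega>q" by auto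
      have "2 * Cv * ?E \<le> 2 * Cv * (100 powr (q - 1) * ?X + 100 powr (q - 1) * ?Y)"
        using E Cv by (intro mult_left_mono) auto
      then have EE: "2 * Cv * ?E \<le> (2 * Cv * 100 powr (q - 1)) * ?X + (2 * Cv * 100 powr (q - 1)) * ?Y"
        by (simp add: distrib_left mult.assoc)
      have CC: "2 * Cv * 100 powr (q - 1) \<le> C" "Cp \<le> C" "Cq \<le> C" using Cv cp cq by (auto simp: C_def)
      have "c * ?Gp + c * \<beta> * ?Gq \<le> C * ?X + C * ?Y + C * \<delta> powr \<omega>p + C * \<delta> powr \<omega>q"
        using Ix Iy lp lq cG EE mult_right_mono [OF CC(1) XY(1)] mult_right_mono [OF CC(1) XY(2)]
          mult_right_mono [OF CC(2) XY(3)] mult_right_mono [OF CC(3) XY(4)] by linarith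
      then show "\<exists>\<delta>>0. L * \<delta> powr \<gamma> \<le> 4 * S \<and>
        c * (scaled_power \<gamma> p (- (s * p) + \<theta> * (p - 1 + real DIM('a))) L \<delta>)
        + c * \<beta> * (scaled_power \<gamma> q (- (t * q) + \<theta> * (q - 1 + real DIM('a))) L \<delta>)
        \<le> C * (scaled_power \<gamma> p (- (s * p) + \<theta>' * (p - s * p)) L \<delta>)
        + C * (scaled_power \<gamma> q (- \<tau>q + \<theta>' * (q - \<tau>q)) L \<delta>)
        + C * \<delta> powr \<omega>p + C * \<delta> powr \<omega>q"
        using \<delta> L\<delta> unfolding d_def by blast
    qed
  qed
qed

end


section \<open>Choice of the exponents\<close>

text \<open>The limit of the conditions on the exponents as the auxiliary small parameters tend to 0; \<open>X\<close>
  is the exponent of \<open>\<delta>\<close> in the gain that has to absorb the losses.\<close>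

definition improvable :: "real \<Rightarrow> real \<Rightarrow> real \<Rightarrow> real \<Rightarrow> bool" where
  "improvable P \<tau> \<kappa> X \<longleftrightarrow> X < \<kappa> / 2 + min (1 + \<kappa> * (P - 2) - \<tau>) 0 \<and> X < \<kappa> + min (\<kappa> * (P - 2) - \<tau>) 0 / 2"

text \<open>Strict inequalities survive a small perturbation; \<open>\<nu>\<close> plays the role of
  \<open>\<theta>'\<close>, and \<open>\<nu>\<^sup>2\<close> that of \<open>\<theta>\<close>.\<close>

lemma eventually_ring_exponents:
  assumes "improvable P \<tau> \<kappa> X" "X < \<alpha>"
  shows "\<forall>\<^sub>F \<nu> in at_right 0. ring_exponents \<alpha> P \<tau> \<kappa> \<nu> (X + \<nu>\<^sup>2 * n)"
proof -
  define M1 where "M1 = min (1 + \<kappa> * (P - 2) - \<tau>) 0"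
  define M2 where "M2 = min (\<kappa> * (P - 2) - \<tau>) 0"
  have X: "X < \<kappa> / 2 + M1" "X < \<kappa> + M2 / 2" using assms(1) by (auto simp: improvable_def M1_def M2_def)
  have "((\<lambda>\<nu>::real. X + \<nu>\<^sup>2 * n) \<longlongrightarrow> X + 0\<^sup>2 * n) (at_right 0)" by (intro tendsto_intros)
  then have 1: "\<forall>\<^sub>F \<nu> in at_right 0. X + \<nu>\<^sup>2 * n < \<alpha>" by (rule order_tendstoD) (use assms in simp)
  have "((\<lambda>\<nu>::real. \<kappa> / 2 + (1 + \<nu>) * (M1 - \<nu>) - (X + \<nu>\<^sup>2 * n)) \<longlongrightarrow> \<kappa> / 2 + (1 + 0) * (M1 - 0) - (X + 0\<^sup>2 * n)) (at_right 0)"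
    by (intro tendsto_intros)
  then have 2: "\<forall>\<^sub>F \<nu> in at_right 0. 0 < \<kappa> / 2 + (1 + \<nu>) * (M1 - \<nu>) - (X + \<nu>\<^sup>2 * n)"
    by (rule order_tendstoD) (use X in simp)
  have "((\<lambda>\<nu>::real. \<kappa> + (M2 - \<nu>) / 2 - (X + \<nu>\<^sup>2 * n)) \<longlongrightarrow> \<kappa> + (M2 - 0) / 2 - (X + 0\<^sup>2 * n)) (at_right 0)"
    by (intro tendsto_intros) simp_all
  then have 3: "\<forall>\<^sub>F \<nu> in at_right 0. 0 < \<kappa> + (M2 - \<nu>) / 2 - (X + \<nu>\<^sup>2 * n)"
    by (rule order_tendstoD) (use X in simp)
  have M: "M1 \<le> 0" "M1 \<le> 1 + \<kappa> * (P - 2) - \<tau>" "M2 \<le> 0" "M2 \<le> \<kappa> * (P - 2) - \<tau>"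
    by (auto simp: M1_def M2_def)
  show ?thesis
    using 1 2 3 eventually_at_right_less [of 0]
  proof eventually_elim
    case (elim \<nu>)
    show ?case
      unfolding ring_exponents_def
    proof (intro conjI)
      show "\<exists>e1<0. e1 \<le> 1 + \<kappa> * (P - 2) - \<tau> \<and> X + \<nu>\<^sup>2 * n \<le> \<kappa> / 2 + (1 + \<nu>) * e1"
        using elim M by (intro exI [of _ "M1 - \<nu>"] conjI) linarith+
      show "\<exists>e2<0. e2 \<le> \<kappa> * (P - 2) - \<tau> \<and> X + \<nu>\<^sup>2 * n \<le> \<kappa> + e2 / 2"
        using elim M by (intro exI [of _ "M2 - \<nu>"] conjI) linarith+
    qed (use elim in linarith)
  qed
qed

lemma ring_exponents_mono:
  assumes "ring_exponents \<alpha> P \<tau> \<kappa> \<theta>' \<omega>" "P \<le> Q" "0 \<le> \<kappa>"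
  shows "ring_exponents \<alpha> Q \<tau> \<kappa> \<theta>' \<omega>"
proof -
  have "\<kappa> * (P - 2) \<le> \<kappa> * (Q - 2)" using assms by (intro mult_left_mono) auto
  then have le: "e \<le> 1 + \<kappa> * (Q - 2) - \<tau>" if "e \<le> 1 + \<kappa> * (P - 2) - \<tau>" for e using that by linarith
  have le': "e \<le> \<kappa> * (Q - 2) - \<tau>" if "e \<le> \<kappa> * (P - 2) - \<tau>" for e
    using that \<open>\<kappa> * (P - 2) \<le> \<kappa> * (Q - 2)\<close> by linarith
  show ?thesis using assms(1) le le' unfolding ring_exponents_def by blast
qed

text \<open>The step from \<open>\<kappa>\<close> to \<open>\<gamma>\<close> may be as long as
  \<open>\<kappa>1 / (2 * Q)\<close>, which does not depend on \<open>\<kappa>\<close>: the penalty contributes an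
  extra \<open>\<kappa> / 2\<close> to the exponent of the losses.\<close>

lemma improvable_close:
  assumes P: "2 \<le> P" "P \<le> Q" and \<kappa>: "0 < \<kappa>1" "\<kappa>1 \<le> \<kappa>" "\<kappa> \<le> \<gamma>" "\<gamma> \<le> 1"
    and \<gamma>: "\<gamma> * (P - 1) \<le> \<tau>" "\<gamma> \<le> \<kappa> + \<kappa>1 / (2 * Q)"
  shows "improvable P \<tau> \<kappa> (\<gamma> * (P - 1) - \<tau>)"
proof -
  have "\<kappa>1 * (P - 1) < \<kappa>1 * Q" using P \<kappa> by simp
  then have small: "\<kappa>1 / (2 * Q) * (P - 1) < \<kappa>1 / 2" using P by (simp add: field_simps)
  have "\<gamma> * (P - 1) \<le> (\<kappa> + \<kappa>1 / (2 * Q)) * (P - 1)" using P \<gamma> by (intro mult_right_mono) auto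
  also have "\<dots> = \<kappa> * (P - 1) + \<kappa>1 / (2 * Q) * (P - 1)" by (simp add: algebra_simps)
  finally have up: "\<gamma> * (P - 1) < \<kappa> * (P - 1) + \<kappa>1 / 2" using small by linarith
  have e: "\<kappa> * (P - 1) = \<kappa> * (P - 2) + \<kappa>" by (simp add: algebra_simps)
  have "0 < \<kappa>" "\<kappa> \<le> 1" using \<kappa> by linarith+
  then show ?thesis using up e \<gamma>(1) \<kappa> unfolding improvable_def min_def by (auto simp: field_simps)
qed

lemma improvable_zero:
  assumes "X + \<tau> < 1" "X + \<tau> < \<tau> / 2" "0 < \<tau>"
  shows "improvable P \<tau> 0 X"
  using assms unfolding improvable_def min_def by auto

lemma eventually_near_absorbed:
  fixes \<gamma> T \<zeta>' \<zeta> P \<epsilon> C \<tau> :: real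
  assumes "0 < \<gamma>" "0 < \<epsilon>" "0 < C" and \<zeta>: "\<zeta> < \<zeta>'"
  shows "\<forall>\<^sub>F L in at_top. \<forall>\<delta>>0. L * \<delta> powr \<gamma> \<le> T \<longrightarrow>
    C * (scaled_power \<gamma> P (- \<tau> + \<zeta>') L \<delta>) \<le> \<epsilon> * (scaled_power \<gamma> P (- \<tau> + \<zeta>) L \<delta>)"
proof -
  have "\<forall>\<^sub>F L in at_top. \<forall>\<delta>>0. L * \<delta> powr \<gamma> \<le> T \<longrightarrow> \<delta> powr (\<zeta>' - \<zeta>) \<le> \<epsilon> / C"
    using assms by (intro eventually_small_power) auto
  then show ?thesis
  proof eventually_elim
    case (elim L)
    show ?case
    proof (intro allI impI)
      fix \<delta> assume \<delta>: "0 < \<delta>" "L * \<delta> powr \<gamma> \<le> T"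
      let ?Y = "(L * \<delta> powr \<gamma>) powr (P - 1)"
      have "\<delta> powr (- \<tau> + \<zeta>') = \<delta> powr (\<zeta>' - \<zeta>) * \<delta> powr (- \<tau> + \<zeta>)"
        by (simp add: powr_add [symmetric])
      moreover have "C * \<delta> powr (\<zeta>' - \<zeta>) \<le> \<epsilon>" using elim \<delta> assms by (simp add: field_simps)
      then have "(C * \<delta> powr (\<zeta>' - \<zeta>)) * (?Y * \<delta> powr (- \<tau> + \<zeta>)) \<le> \<epsilon> * (?Y * \<delta> powr (- \<tau> + \<zeta>))"
        by (intro mult_right_mono) auto
      ultimately show "C * (?Y * \<delta> powr (- \<tau> + \<zeta>')) \<le> \<epsilon> * (?Y * \<delta> powr (- \<tau> + \<zeta>))"
        by (simp add: mult_ac)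
    qed
  qed
qed

text \<open>When both kernels have the same order at the origin, the larger power is harmless because
  \<open>L * \<delta> powr \<gamma>\<close> is bounded.\<close>

lemma eventually_cross_absorbed:
  fixes \<gamma> T \<zeta>' \<zeta> p q \<theta>' \<epsilon> C \<tau> :: real
  assumes "0 < \<gamma>" "0 < \<epsilon>" "0 < C" "0 < T" and \<zeta>: "\<zeta> < \<theta>' * (p - \<tau>)" and pq: "p \<le> q" and \<theta>': "0 < \<theta>'"
  shows "\<forall>\<^sub>F L in at_top. \<forall>\<delta>>0. L * \<delta> powr \<gamma> \<le> T \<longrightarrow>
    C * (scaled_power \<gamma> q (- \<tau> + \<theta>' * (q - \<tau>)) L \<delta>) \<le> \<epsilon> * (scaled_power \<gamma> p (- \<tau> + \<zeta>) L \<delta>)"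
proof -
  have "0 < C * T powr (q - p)" using assms by simp
  from eventually_near_absorbed [OF assms(1,2) this \<zeta>, of T p \<tau>]
    eventually_small_distance [OF assms(1) zero_less_one, of T] eventually_gt_at_top [of 0]
  show ?thesis
  proof eventually_elim
    case (elim L)
    show ?case
    proof (intro allI impI)
      fix \<delta> assume \<delta>: "0 < \<delta>" "L * \<delta> powr \<gamma> \<le> T"
      let ?Y = "L * \<delta> powr \<gamma>"
      have Y: "0 < ?Y" using elim \<delta> by simp
      have "?Y powr (q - 1) = ?Y powr (q - p) * ?Y powr (p - 1)" by (simp add: powr_add [symmetric])
      also have "\<dots> \<le> T powr (q - p) * ?Y powr (p - 1)"
        using Y \<delta> pq by (intro mult_right_mono powr_mono2) auto
      finally have 1: "?Y powr (q - 1) \<le> T powr (q - p) * ?Y powr (p - 1)" .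
      have "\<theta>' * (p - \<tau>) \<le> \<theta>' * (q - \<tau>)" using pq \<theta>' by (intro mult_left_mono) auto
      then have 2: "\<delta> powr (- \<tau> + \<theta>' * (q - \<tau>)) \<le> \<delta> powr (- \<tau> + \<theta>' * (p - \<tau>))"
        using \<delta> elim by (intro powr_mono') auto
      have "C * (?Y powr (q - 1) * \<delta> powr (- \<tau> + \<theta>' * (q - \<tau>)))
          \<le> C * ((T powr (q - p) * ?Y powr (p - 1)) * \<delta> powr (- \<tau> + \<theta>' * (p - \<tau>)))"
        using 1 2 assms by (intro mult_left_mono mult_mono) auto
      also have "\<dots> = (C * T powr (q - p)) * (?Y powr (p - 1) * \<delta> powr (- \<tau> + \<theta>' * (p - \<tau>)))" by simp
      also have "\<dots> \<le> \<epsilon> * (?Y powr (p - 1) * \<delta> powr (- \<tau> + \<zeta>))" using elim \<delta> by blast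
      finally show "C * (?Y powr (q - 1) * \<delta> powr (- \<tau> + \<theta>' * (q - \<tau>))) \<le> \<epsilon> * (?Y powr (p - 1) * \<delta> powr (- \<tau> + \<zeta>))" .
    qed
  qed
qed

section \<open>Improvement of the Hoelder exponent and iteration\<close>

context double_phase_solution begin

text \<open>Each of the four losses is at most an eighth of the available gains for large \<open>L\<close>. The losses
  of the first phase are absorbed by its own gain; for the losses of the second phase there is the choice.\<close>

lemma holder_improvement_if_absorbed:
  assumes hr: "holder_interior u \<kappa>" and \<kappa>: "0 \<le> \<kappa>" "\<kappa> \<le> 1" and \<gamma>: "0 < \<gamma>" "\<gamma> \<le> 1"
    and \<theta>: "0 < \<theta>" "\<theta> \<le> 1" and \<theta>': "0 < \<theta>'" and \<gamma>\<theta>: "\<gamma> + \<theta> \<le> 1 + \<kappa> / 2"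
    and ring_p: "ring_exponents \<alpha> p (s * p) \<kappa> \<theta>' \<omega>p" and ring_q: "ring_exponents \<alpha> q \<tau>q \<kappa> \<theta>' \<omega>q"
    and near_p: "\<theta> * (p - 1 + real DIM('a)) < \<theta>' * (p - s * p)"
    and far_p: "\<gamma> * (p - 1) + (- (s * p) + \<theta> * (p - 1 + real DIM('a))) \<le> \<omega>p"
    and near_q: "\<tau>q = s * p \<or> (0 < \<beta> \<and> \<tau>q = t * q \<and> \<theta> * (q - 1 + real DIM('a)) < \<theta>' * (q - t * q))"
    and far_q: "\<gamma> * (p - 1) + (- (s * p) + \<theta> * (p - 1 + real DIM('a))) \<le> \<omega>q
      \<or> (0 < \<beta> \<and> \<gamma> * (q - 1) + (- (t * q) + \<theta> * (q - 1 + real DIM('a))) \<le> \<omega>q)"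
  shows "holder_interior u \<gamma>"
  unfolding holder_interior_def
proof (intro allI impI)
  fix R' :: real assume R': "R' < 2"
  define R where "R = max R' 0"
  have R: "0 \<le> R" "R < 2" "R' \<le> R" using R' by (auto simp: R_def)
  define d where "d = real DIM('a)"
  define ep where "ep = - (s * p) + \<theta> * (p - 1 + d)"
  define eq where "eq = - (t * q) + \<theta> * (q - 1 + d)"
  obtain c C T r0 where c: "0 < c" "0 < C" "0 < T" "0 < r0"
    and key: "\<forall>\<^sub>F L in at_top. \<forall>x0 y0. norm x0 \<le> R \<longrightarrow> norm (x0 - y0) \<le> r0 \<longrightarrow> L * norm (x0 - y0) powr \<gamma> < u x0 - u y0 \<longrightarrow>
      (\<exists>\<delta>>0. L * \<delta> powr \<gamma> \<le> T \<and>
        c * (scaled_power \<gamma> p ep L \<delta>)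
        + c * \<beta> * (scaled_power \<gamma> q eq L \<delta>)
        \<le> C * (scaled_power \<gamma> p (- (s * p) + \<theta>' * (p - s * p)) L \<delta>)
        + C * (scaled_power \<gamma> q (- \<tau>q + \<theta>' * (q - \<tau>q)) L \<delta>)
        + C * \<delta> powr \<omega>p + C * \<delta> powr \<omega>q)"
    unfolding ep_def eq_def d_def
    by (rule key_inequality [OF hr \<kappa> \<gamma> \<theta> \<theta>' \<gamma>\<theta> ring_p ring_q R(1,2)]) blast
  have pq': "2 \<le> q" using pq by linarith
  have c8: "0 < c / 8" using c by simp
  let ?Gp = "\<lambda>L \<delta>. scaled_power \<gamma> p ep L \<delta>"
  let ?Gq = "\<lambda>L \<delta>. scaled_power \<gamma> q eq L \<delta>"
  have A1: "\<forall>\<^sub>F L in at_top. \<forall>\<delta>>0. L * \<delta> powr \<gamma> \<le> T \<longrightarrow>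
      C * (scaled_power \<gamma> p (- (s * p) + \<theta>' * (p - s * p)) L \<delta>) \<le> c / 8 * ?Gp L \<delta>"
    unfolding ep_def using near_p by (intro eventually_near_absorbed [OF \<gamma>(1) c8 c(2)]) (simp add: d_def)
  have A2: "\<forall>\<^sub>F L in at_top. \<forall>\<delta>>0. L * \<delta> powr \<gamma> \<le> T \<longrightarrow> C * \<delta> powr \<omega>p \<le> c / 8 * ?Gp L \<delta>"
    using far_p c pq by (intro eventually_absorbed [OF \<gamma>(1) _ c8]) (auto simp: ep_def d_def)
  have A3: "\<forall>\<^sub>F L in at_top. \<forall>\<delta>>0. L * \<delta> powr \<gamma> \<le> T \<longrightarrow>
      C * (scaled_power \<gamma> q (- \<tau>q + \<theta>' * (q - \<tau>q)) L \<delta>) \<le> c / 8 * ?Gp L \<delta> + c / 8 * \<beta> * ?Gq L \<delta>"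
    using near_q
  proof
    assume \<tau>: "\<tau>q = s * p"
    have "\<forall>\<^sub>F L in at_top. \<forall>\<delta>>0. L * \<delta> powr \<gamma> \<le> T \<longrightarrow>
      C * (scaled_power \<gamma> q (- \<tau>q + \<theta>' * (q - \<tau>q)) L \<delta>) \<le> c / 8 * ?Gp L \<delta>"
      unfolding ep_def \<tau> using near_p by (intro eventually_cross_absorbed [OF \<gamma>(1) c8 c(2,3) _ pq(2) \<theta>']) (simp add: d_def)
    then show ?thesis
    proof eventually_elim
      case (elim L)
      have "0 \<le> c / 8 * \<beta> * ?Gq L \<delta>" for \<delta> using c \<beta> by simp
      then show ?case using elim by (meson add_increasing2)
    qed
  next
    assume *: "0 < \<beta> \<and> \<tau>q = t * q \<and> \<theta> * (q - 1 + real DIM('a)) < \<theta>' * (q - t * q)"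
    then have b8: "0 < c / 8 * \<beta>" using c8 by simp
    have "\<forall>\<^sub>F L in at_top. \<forall>\<delta>>0. L * \<delta> powr \<gamma> \<le> T \<longrightarrow>
      C * (scaled_power \<gamma> q (- (t * q) + \<theta>' * (q - t * q)) L \<delta>) \<le> c / 8 * \<beta> * ?Gq L \<delta>"
      unfolding eq_def using * by (intro eventually_near_absorbed [OF \<gamma>(1) b8 c(2)]) (simp add: d_def)
    then show ?thesis
    proof eventually_elim
      case (elim L)
      have "0 \<le> c / 8 * ?Gp L \<delta>" for \<delta> using c by simp
      then show ?case using elim * by (metis add_increasing)
    qed
  qed
  have A4: "\<forall>\<^sub>F L in at_top. \<forall>\<delta>>0. L * \<delta> powr \<gamma> \<le> T \<longrightarrow>
      C * \<delta> powr \<omega>q \<le> c / 8 * ?Gp L \<delta> + c / 8 * \<beta> * ?Gq L \<delta>"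
    using far_q
  proof
    assume "\<gamma> * (p - 1) + (- (s * p) + \<theta> * (p - 1 + real DIM('a))) \<le> \<omega>q"
    then have "\<forall>\<^sub>F L in at_top. \<forall>\<delta>>0. L * \<delta> powr \<gamma> \<le> T \<longrightarrow> C * \<delta> powr \<omega>q \<le> c / 8 * ?Gp L \<delta>"
      using c pq by (intro eventually_absorbed [OF \<gamma>(1) _ c8]) (auto simp: ep_def d_def)
    then show ?thesis
    proof eventually_elim
      case (elim L)
      have "0 \<le> c / 8 * \<beta> * ?Gq L \<delta>" for \<delta> using c \<beta> by simp
      then show ?case using elim by (meson add_increasing2)
    qed
  next
    assume *: "0 < \<beta> \<and> \<gamma> * (q - 1) + (- (t * q) + \<theta> * (q - 1 + real DIM('a))) \<le> \<omega>q"
    then have b8: "0 < c / 8 * \<beta>" using c8 by simp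
    have "\<forall>\<^sub>F L in at_top. \<forall>\<delta>>0. L * \<delta> powr \<gamma> \<le> T \<longrightarrow> C * \<delta> powr \<omega>q \<le> c / 8 * \<beta> * ?Gq L \<delta>"
      using * c pq' by (intro eventually_absorbed [OF \<gamma>(1) _ b8]) (auto simp: eq_def d_def)
    then show ?thesis
    proof eventually_elim
      case (elim L)
      have "0 \<le> c / 8 * ?Gp L \<delta>" for \<delta> using c by simp
      then show ?case using elim by (meson add_increasing)
    qed
  qed
  have "\<forall>\<^sub>F L in at_top. 0 < L \<and> (\<forall>x0 y0. norm x0 \<le> R \<longrightarrow> norm (x0 - y0) \<le> r0 \<longrightarrow> u x0 - u y0 \<le> L * norm (x0 - y0) powr \<gamma>)"
    using key A1 A2 A3 A4 eventually_gt_at_top [of 0]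
  proof eventually_elim
    case (elim L)
    have False if f: "norm x0 \<le> R" "norm (x0 - y0) \<le> r0" "\<not> u x0 - u y0 \<le> L * norm (x0 - y0) powr \<gamma>" for x0 y0
    proof -
      have lt: "L * norm (x0 - y0) powr \<gamma> < u x0 - u y0" using f(3) by simp
      obtain \<delta> where \<delta>: "0 < \<delta>" "L * \<delta> powr \<gamma> \<le> T"
        and le: "c * ?Gp L \<delta> + c * \<beta> * ?Gq L \<delta>
          \<le> C * (scaled_power \<gamma> p (- (s * p) + \<theta>' * (p - s * p)) L \<delta>)
          + C * (scaled_power \<gamma> q (- \<tau>q + \<theta>' * (q - \<tau>q)) L \<delta>)
          + C * \<delta> powr \<omega>p + C * \<delta> powr \<omega>q"
        using elim(1) [rule_format, OF f(1,2) lt] by blast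
      have "0 < c * ?Gp L \<delta>" using c \<delta> elim by simp
      moreover have "0 \<le> c * \<beta> * ?Gq L \<delta>" using c \<beta> by simp
      moreover have "c / 8 * ?Gp L \<delta> = (c * ?Gp L \<delta>) / 8" "c / 8 * \<beta> * ?Gq L \<delta> = (c * \<beta> * ?Gq L \<delta>) / 8" by auto
      ultimately show False
        using le elim(2-5) [rule_format, OF \<delta>] by linarith
    qed
    then show ?case using elim by blast
  qed
  then obtain L where L: "0 < L" "\<And>x0 y0. norm x0 \<le> R \<Longrightarrow> norm (x0 - y0) \<le> r0 \<Longrightarrow> u x0 - u y0 \<le> L * norm (x0 - y0) powr \<gamma>"
    using eventually_happens [of _ "at_top :: real filter"] by (metis (no_types, lifting) trivial_limit_at_top_linorder)
  obtain S where S: "0 < S" "\<And>x. norm x \<le> R \<Longrightarrow> \<bar>u x\<bar> \<le> S" using bounded_interior [OF R(2)] by blast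
  show "\<exists>K. \<forall>x\<in>cball 0 R'. \<forall>y\<in>cball 0 R'. \<bar>u x - u y\<bar> \<le> K * norm (x - y) powr \<gamma>"
  proof (intro exI [of _ "L + 2 * S / r0 powr \<gamma>"] ballI)
    fix x y :: 'a assume "x \<in> cball 0 R'" "y \<in> cball 0 R'"
    then have xy: "norm x \<le> R" "norm y \<le> R" using R by auto
    show "\<bar>u x - u y\<bar> \<le> (L + 2 * S / r0 powr \<gamma>) * norm (x - y) powr \<gamma>"
    proof (cases "norm (x - y) \<le> r0")
      case True
      then have "\<bar>u x - u y\<bar> \<le> L * norm (x - y) powr \<gamma>"
        using L(2) [OF xy(1), of y] L(2) [OF xy(2), of x] by (simp add: norm_minus_commute abs_le_iff)
      also have "\<dots> \<le> (L + 2 * S / r0 powr \<gamma>) * norm (x - y) powr \<gamma>"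
        using S by (intro mult_right_mono) auto
      finally show ?thesis .
    next
      case False
      have "\<bar>u x - u y\<bar> \<le> 2 * S" using S(2) [OF xy(1)] S(2) [OF xy(2)] by linarith
      also have "\<dots> = 2 * S / r0 powr \<gamma> * r0 powr \<gamma>" using c by simp
      also have "\<dots> \<le> (L + 2 * S / r0 powr \<gamma>) * norm (x - y) powr \<gamma>"
        using False c S L \<gamma> by (intro mult_mono powr_mono2) auto
      finally show ?thesis .
    qed
  qed
qed

text \<open>Takes \<open>\<theta>' = \<nu>\<close> and \<open>\<theta> = \<nu>\<^sup>2\<close> with a small
  \<open>\<nu>\<close>: then \<open>\<theta>\<close> is negligible against \<open>\<theta>'\<close>, so that the loss
  inside the ball of radius \<open>\<rho>\<close> is smaller than the gain, and both are negligible in the conditions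
  on the exponents.\<close>

lemma holder_improvement:
  assumes hr: "holder_interior u \<kappa>" and \<kappa>: "0 \<le> \<kappa>" "\<kappa> \<le> 1" and \<gamma>: "0 < \<gamma>" "\<gamma> \<le> 1" "\<gamma> < 1 + \<kappa> / 2"
    and Xp: "\<gamma> * (p - 1) \<le> s * p" and imp_p: "improvable p (s * p) \<kappa> (\<gamma> * (p - 1) - s * p)"
    and q_cases: "\<tau>q = s * p \<or> (0 < \<beta> \<and> \<tau>q = t * q \<and>
      ((\<gamma> * (q - 1) \<le> t * q \<and> improvable q (t * q) \<kappa> (\<gamma> * (q - 1) - t * q))
       \<or> improvable q (t * q) \<kappa> (\<gamma> * (p - 1) - s * p)))"
  shows "holder_interior u \<gamma>"
proof -
  define d where "d = real DIM('a)"
  define np nq where "np = p - 1 + d" and "nq = q - 1 + d"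
  have Xa: "\<gamma> * (p - 1) - s * p < \<alpha>" using Xp \<alpha> by linarith
  have small: "\<forall>\<^sub>F \<nu> in at_right 0. \<nu>\<^sup>2 * n < \<nu> * v" if "0 < v" for n v :: real
  proof -
    have "((\<lambda>\<nu>. \<nu> * n) \<longlongrightarrow> 0 * n) (at_right 0)" by (intro tendsto_intros)
    then have "\<forall>\<^sub>F \<nu> in at_right 0. \<nu> * n < v" by (rule order_tendstoD) (use that in simp)
    then show ?thesis using eventually_at_right_less [of 0]
    proof eventually_elim
      case (elim \<nu>)
      then have "\<nu> * (\<nu> * n) < \<nu> * v" by (intro mult_strict_left_mono) auto
      then show ?case by (simp add: power2_eq_square mult.assoc)
    qed
  qed
  have ev: "\<forall>\<^sub>F \<nu> in at_right 0. \<nu> \<in> {0<..<1::real}" by (rule eventually_at_right_real) simp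
  have "((\<lambda>\<nu>::real. \<gamma> + \<nu>\<^sup>2) \<longlongrightarrow> \<gamma> + 0\<^sup>2) (at_right 0)" by (intro tendsto_intros)
  then have ev2: "\<forall>\<^sub>F \<nu> in at_right 0. \<gamma> + \<nu>\<^sup>2 < 1 + \<kappa> / 2" by (rule order_tendstoD) (use \<gamma> in simp)
  have ev3: "\<forall>\<^sub>F \<nu> in at_right 0. \<nu>\<^sup>2 * np < \<nu> * (p - s * p)" using orders by (intro small) auto
  have ev4: "\<forall>\<^sub>F \<nu> in at_right 0. \<nu>\<^sup>2 * nq < \<nu> * (q - t * q)" using orders by (intro small) auto
  have ring_p: "\<forall>\<^sub>F \<nu> in at_right 0. ring_exponents \<alpha> p (s * p) \<kappa> \<nu> (\<gamma> * (p - 1) - s * p + \<nu>\<^sup>2 * np)"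
    by (rule eventually_ring_exponents [OF imp_p Xa])
  have ring_q: "\<forall>\<^sub>F \<nu> in at_right 0. \<exists>\<omega>q. ring_exponents \<alpha> q \<tau>q \<kappa> \<nu> \<omega>q \<and>
      (\<gamma> * (p - 1) + (- (s * p) + \<nu>\<^sup>2 * np) \<le> \<omega>q \<or> (0 < \<beta> \<and> \<gamma> * (q - 1) + (- (t * q) + \<nu>\<^sup>2 * nq) \<le> \<omega>q))"
    using q_cases
  proof (elim disjE conjE)
    assume \<tau>: "\<tau>q = s * p"
    show ?thesis using ring_p
    proof eventually_elim
      case (elim \<nu>)
      then have "ring_exponents \<alpha> q \<tau>q \<kappa> \<nu> (\<gamma> * (p - 1) - s * p + \<nu>\<^sup>2 * np)"
        unfolding \<tau> using pq(2) \<kappa>(1) by (rule ring_exponents_mono)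
      then show ?case by (intro exI [of _ "\<gamma> * (p - 1) - s * p + \<nu>\<^sup>2 * np"]) auto
    qed
  next
    assume *: "0 < \<beta>" "\<tau>q = t * q" "\<gamma> * (q - 1) \<le> t * q" "improvable q (t * q) \<kappa> (\<gamma> * (q - 1) - t * q)"
    have "\<gamma> * (q - 1) - t * q < \<alpha>" using * \<alpha> by linarith
    from eventually_ring_exponents [OF *(4) this, of nq]
    show ?thesis
    proof eventually_elim
      case (elim \<nu>)
      then show ?case using * by (intro exI [of _ "\<gamma> * (q - 1) - t * q + \<nu>\<^sup>2 * nq"]) auto
    qed
  next
    assume *: "0 < \<beta>" "\<tau>q = t * q" "improvable q (t * q) \<kappa> (\<gamma> * (p - 1) - s * p)"
    from eventually_ring_exponents [OF *(3) Xa, of np]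
    show ?thesis
    proof eventually_elim
      case (elim \<nu>)
      then show ?case using * by (intro exI [of _ "\<gamma> * (p - 1) - s * p + \<nu>\<^sup>2 * np"]) auto
    qed
  qed
  have "\<forall>\<^sub>F \<nu> in at_right (0::real). holder_interior u \<gamma>"
    using ev ev2 ev3 ev4 ring_p ring_q
  proof eventually_elim
    case (elim \<nu>)
    then obtain \<omega>q where \<omega>q: "ring_exponents \<alpha> q \<tau>q \<kappa> \<nu> \<omega>q"
      "\<gamma> * (p - 1) + (- (s * p) + \<nu>\<^sup>2 * np) \<le> \<omega>q \<or> (0 < \<beta> \<and> \<gamma> * (q - 1) + (- (t * q) + \<nu>\<^sup>2 * nq) \<le> \<omega>q)" by blast
    have \<nu>: "0 < \<nu>" "\<nu> < 1" "\<nu>\<^sup>2 \<le> 1" using elim by (auto simp: power_le_one)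
    show ?case
    proof (rule holder_improvement_if_absorbed [OF hr \<kappa> \<gamma>(1,2) _ \<nu>(3) \<nu>(1) _ elim(5) \<omega>q(1)])
      show "\<tau>q = s * p \<or> (0 < \<beta> \<and> \<tau>q = t * q \<and> \<nu>\<^sup>2 * (q - 1 + real DIM('a)) < \<nu> * (q - t * q))"
        using q_cases elim(4) by (auto simp: nq_def d_def)
    qed (use elim \<nu> \<omega>q(2) in \<open>auto simp: np_def nq_def d_def\<close>)
  qed
  then show ?thesis by simp
qed

lemma holder_interior_bootstrap:
  assumes start: "holder_interior u \<kappa>1" and \<kappa>1: "\<kappa>1 \<le> \<Gamma>" and \<eta>: "0 < \<eta>"
    and step: "\<And>\<kappa> \<gamma>. \<kappa>1 \<le> \<kappa> \<Longrightarrow> \<kappa> \<le> \<gamma> \<Longrightarrow> \<gamma> \<le> \<Gamma> \<Longrightarrow> \<gamma> \<le> \<kappa> + \<eta> \<Longrightarrow> holder_interior u \<kappa> \<Longrightarrow> holder_interior u \<gamma>"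
  shows "holder_interior u \<Gamma>"
proof -
  have *: "holder_interior u (min \<Gamma> (\<kappa>1 + real n * \<eta>))" for n
  proof (induction n)
    case 0
    then show ?case using start \<kappa>1 by (simp add: min_absorb2)
  next
    case (Suc n)
    show ?case
    proof (rule step [OF _ _ _ _ Suc])
      have "0 \<le> real n * \<eta>" using \<eta> by simp
      then show "\<kappa>1 \<le> min \<Gamma> (\<kappa>1 + real n * \<eta>)" using \<kappa>1 by simp
    qed (use \<eta> in \<open>auto simp: min_def algebra_simps\<close>)
  qed
  obtain n where "(\<Gamma> - \<kappa>1) / \<eta> \<le> real n" using real_arch_simple by blast
  then have "\<Gamma> \<le> \<kappa>1 + real n * \<eta>" using \<eta> by (simp add: field_simps)
  then show ?thesis using * [of n] by (simp add: min_absorb1)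
qed

text \<open>The first step, from mere boundedness, needs the exponent \<open>\<kappa>1\<close> to be small; from then
  on the steps have constant length.\<close>

lemma holder_interior_up_to:
  assumes \<Gamma>: "0 < \<Gamma>" "\<Gamma> \<le> 1" "\<Gamma> * (p - 1) \<le> s * p"
    and q_cases: "\<tau>q = s * p \<or> (0 < \<beta> \<and> \<tau>q = t * q \<and> \<Gamma> * (q - 1) \<le> t * q)"
  shows "holder_interior u \<Gamma>"
proof -
  have sp_tq: "s * p \<le> t * q" using st pq by (intro mult_mono) auto
  \<comment> \<open>so small that \<open>\<kappa>1 * (P - 1)\<close> stays below 1 and below half of the order for both phases\<close>
  define \<kappa>1 where "\<kappa>1 = min \<Gamma> (min 1 (s * p) / (4 * q))"
  have q0: "0 < q" using pq by linarith
  have \<kappa>1: "0 < \<kappa>1" "\<kappa>1 \<le> \<Gamma>" using \<Gamma> orders q0 by (auto simp: \<kappa>1_def)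
  have k4: "\<kappa>1 * q \<le> min 1 (s * p) / 4"
  proof -
    have "\<kappa>1 * q \<le> min 1 (s * p) / (4 * q) * q" using q0 by (intro mult_right_mono) (auto simp: \<kappa>1_def)
    then show ?thesis using q0 by simp
  qed
  have kP: "\<kappa>1 * (P - 1) < 1" "\<kappa>1 * (P - 1) < s * p / 2" if "2 \<le> P" "P \<le> q" for P
  proof -
    have "\<kappa>1 * (P - 1) \<le> \<kappa>1 * q" using that \<kappa>1 by (intro mult_left_mono) auto
    moreover have "min 1 (s * p) \<le> 1" "min 1 (s * p) \<le> s * p" by auto
    ultimately show "\<kappa>1 * (P - 1) < 1" "\<kappa>1 * (P - 1) < s * p / 2" using k4 orders(1) by linarith+
  qed
  have kpq: "\<kappa>1 * (p - 1) < 1" "\<kappa>1 * (p - 1) < s * p / 2" "\<kappa>1 * (q - 1) < 1" "\<kappa>1 * (q - 1) < t * q / 2"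
    using kP [of p] kP [of q] pq sp_tq by auto
  have "\<kappa>1 < 1"
  proof -
    have "\<kappa>1 * 1 \<le> \<kappa>1 * (p - 1)" using \<kappa>1 pq by (intro mult_left_mono) auto
    then show ?thesis using kpq by linarith
  qed
  have start: "holder_interior u \<kappa>1"
  proof (rule holder_improvement [OF holder_interior_zero])
    show "improvable p (s * p) 0 (\<kappa>1 * (p - 1) - s * p)"
      using kpq orders by (intro improvable_zero) auto
    have "improvable q (t * q) 0 (\<kappa>1 * (q - 1) - t * q)"
      using kpq orders by (intro improvable_zero) auto
    then show "\<tau>q = s * p \<or> (0 < \<beta> \<and> \<tau>q = t * q \<and>
      ((\<kappa>1 * (q - 1) \<le> t * q \<and> improvable q (t * q) 0 (\<kappa>1 * (q - 1) - t * q))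
       \<or> improvable q (t * q) 0 (\<kappa>1 * (p - 1) - s * p)))"
      using q_cases kpq orders by auto
  qed (use \<kappa>1 \<open>\<kappa>1 < 1\<close> kpq orders in auto)
  show ?thesis
  proof (rule holder_interior_bootstrap [OF start \<kappa>1(2), of "\<kappa>1 / (2 * q)"])
    show "0 < \<kappa>1 / (2 * q)" using \<kappa>1 q0 by simp
    fix \<kappa> \<gamma> assume k: "\<kappa>1 \<le> \<kappa>" "\<kappa> \<le> \<gamma>" "\<gamma> \<le> \<Gamma>" "\<gamma> \<le> \<kappa> + \<kappa>1 / (2 * q)" and hr: "holder_interior u \<kappa>"
    have \<gamma>1: "\<gamma> \<le> 1" using k \<Gamma> by linarith
    have gp: "\<gamma> * (p - 1) \<le> s * p"
    proof -
      have "\<gamma> * (p - 1) \<le> \<Gamma> * (p - 1)" using k pq by (intro mult_right_mono) auto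
      then show ?thesis using \<Gamma> by linarith
    qed
    have gq: "\<gamma> * (q - 1) \<le> t * q" if "\<Gamma> * (q - 1) \<le> t * q"
    proof -
      have "\<gamma> * (q - 1) \<le> \<Gamma> * (q - 1)" using k pq by (intro mult_right_mono) auto
      then show ?thesis using that by linarith
    qed
    show "holder_interior u \<gamma>"
    proof (rule holder_improvement [OF hr])
      show "improvable p (s * p) \<kappa> (\<gamma> * (p - 1) - s * p)"
        using \<kappa>1 k \<gamma>1 gp pq by (intro improvable_close [of p q \<kappa>1]) auto
      have "improvable q (t * q) \<kappa> (\<gamma> * (q - 1) - t * q)" if "\<Gamma> * (q - 1) \<le> t * q"
        using \<kappa>1 k \<gamma>1 gq [OF that] pq by (intro improvable_close [of q q \<kappa>1]) auto
      then show "\<tau>q = s * p \<or> (0 < \<beta> \<and> \<tau>q = t * q \<and>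
        ((\<gamma> * (q - 1) \<le> t * q \<and> improvable q (t * q) \<kappa> (\<gamma> * (q - 1) - t * q))
         \<or> improvable q (t * q) \<kappa> (\<gamma> * (p - 1) - s * p)))"
        using q_cases gq by auto
    qed (use \<kappa>1 k \<gamma>1 gp in auto)
  qed
qed

text \<open>Beyond \<open>t * q / (q - 1)\<close> the gain of the second phase carries a positive power of
  \<open>\<delta>\<close> and cannot absorb all losses of that phase. With
  \<open>\<kappa> \<ge> t * q / (q - 1)\<close> these losses, apart from the one inside the ball of radius
  \<open>\<rho>\<close>, are positive powers of \<open>\<delta>\<close>, and the gain of the first phase absorbs
  them.\<close>

lemma holder_interior_beyond:
  assumes \<beta>_pos: "0 < \<beta>" and \<tau>: "\<tau>q = t * q" and le: "t * q / (q - 1) \<le> s * p / (p - 1)" and lt: "s * p / (p - 1) < 1"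
  shows "holder_interior u (s * p / (p - 1))"
proof -
  define \<kappa>0 where "\<kappa>0 = t * q / (q - 1)"
  define \<Gamma> where "\<Gamma> = s * p / (p - 1)"
  have p1: "0 < p - 1" "0 < q - 1" using pq by auto
  have \<kappa>0: "0 < \<kappa>0" "\<kappa>0 * (q - 1) = t * q" using p1 orders by (auto simp: \<kappa>0_def)
  have \<Gamma>: "\<Gamma> * (p - 1) = s * p" "\<kappa>0 \<le> \<Gamma>" "\<Gamma> < 1" using p1 le lt by (auto simp: \<Gamma>_def \<kappa>0_def)
  have start: "holder_interior u \<kappa>0"
  proof (rule holder_interior_up_to)
    have "\<kappa>0 * (p - 1) \<le> \<Gamma> * (p - 1)" using \<Gamma> p1 by (intro mult_right_mono) auto
    then show "\<kappa>0 * (p - 1) \<le> s * p" using \<Gamma> by simp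
  qed (use \<kappa>0 \<Gamma> \<beta>_pos \<tau> in auto)
  have "holder_interior u \<Gamma>"
  proof (rule holder_interior_bootstrap [OF start \<Gamma>(2), of "\<kappa>0 / (2 * q)"])
    show "0 < \<kappa>0 / (2 * q)" using \<kappa>0 p1 by simp
    fix \<kappa> \<gamma> assume k: "\<kappa>0 \<le> \<kappa>" "\<kappa> \<le> \<gamma>" "\<gamma> \<le> \<Gamma>" "\<gamma> \<le> \<kappa> + \<kappa>0 / (2 * q)" and hr: "holder_interior u \<kappa>"
    have "\<gamma> * (p - 1) \<le> \<Gamma> * (p - 1)" using k p1 by (intro mult_right_mono) auto
    then have gp: "\<gamma> * (p - 1) \<le> s * p" using \<Gamma> by simp
    show "holder_interior u \<gamma>"
    proof (rule holder_improvement [OF hr])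
      show "improvable p (s * p) \<kappa> (\<gamma> * (p - 1) - s * p)"
        using \<kappa>0 k gp pq \<Gamma> by (intro improvable_close [of p q \<kappa>0]) auto
      have "\<kappa>0 * (q - 2) \<le> \<kappa> * (q - 2)" using k pq by (intro mult_right_mono) auto
      moreover have "\<kappa>0 * (q - 2) = t * q - \<kappa>0" using \<kappa>0(2) by (simp add: algebra_simps)
      ultimately have "- \<kappa>0 \<le> \<kappa> * (q - 2) - t * q" by linarith
      then have "improvable q (t * q) \<kappa> (\<gamma> * (p - 1) - s * p)"
        using gp \<kappa>0 k \<Gamma> unfolding improvable_def min_def by (auto simp: field_simps)
      then show "\<tau>q = s * p \<or> (0 < \<beta> \<and> \<tau>q = t * q \<and>
        ((\<gamma> * (q - 1) \<le> t * q \<and> improvable q (t * q) \<kappa> (\<gamma> * (q - 1) - t * q))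
         \<or> improvable q (t * q) \<kappa> (\<gamma> * (p - 1) - s * p)))"
        using \<beta>_pos \<tau> by auto
    qed (use \<kappa>0 k \<Gamma> gp in auto)
  qed
  then show ?thesis by (simp add: \<Gamma>_def)
qed

end

section \<open>The regularity theorem\<close>

lemma holder_loc_of_interior:
  fixes u :: "'a::euclidean_space \<Rightarrow> real"
  assumes hr: "holder_interior u \<Gamma>" and \<gamma>: "0 < \<gamma>" "\<gamma> \<le> \<Gamma>"
  shows "holder_loc \<gamma> (ball 0 2) u"
  unfolding holder_loc_def
proof (intro allI impI)
  fix K :: "'a set" assume K: "compact K" "K \<subseteq> ball 0 2"
  obtain R where R: "R < 2" "K \<subseteq> cball 0 R"
  proof (cases "K = {}")
    case True then show ?thesis using that [of 0] by simp
  next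
    case False
    then obtain x where x: "x \<in> K" "\<And>y. y \<in> K \<Longrightarrow> norm y \<le> norm x"
      using continuous_attains_sup [OF K(1) False, of norm] continuous_on_norm_id by auto
    show ?thesis using that [of "norm x"] x K by force
  qed
  obtain C where C: "\<forall>x\<in>cball 0 R. \<forall>y\<in>cball 0 R. \<bar>u x - u y\<bar> \<le> C * norm (x - y) powr \<Gamma>"
    using hr R unfolding holder_interior_def by blast
  show "\<exists>C. \<forall>x\<in>K. \<forall>y\<in>K. \<bar>u x - u y\<bar> \<le> C * norm (x - y) powr \<gamma>"
  proof (intro exI [of _ "\<bar>C\<bar> * 4 powr (\<Gamma> - \<gamma>)"] ballI)
    fix x y assume xy: "x \<in> K" "y \<in> K"
    then have n: "norm x < 2" "norm y < 2" using K by auto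
    then have "norm (x - y) \<le> 4" using norm_triangle_ineq4 [of x y] by linarith
    then have le: "norm (x - y) powr (\<Gamma> - \<gamma>) \<le> 4 powr (\<Gamma> - \<gamma>)" using \<gamma> by (intro powr_mono2) auto
    have "\<bar>u x - u y\<bar> \<le> C * norm (x - y) powr \<Gamma>" using C xy R by blast
    also have "\<dots> \<le> \<bar>C\<bar> * norm (x - y) powr \<Gamma>" by (intro mult_right_mono) auto
    also have "norm (x - y) powr \<Gamma> = norm (x - y) powr (\<Gamma> - \<gamma>) * norm (x - y) powr \<gamma>"
      by (simp add: powr_add [symmetric])
    also have "\<bar>C\<bar> * (norm (x - y) powr (\<Gamma> - \<gamma>) * norm (x - y) powr \<gamma>) \<le> \<bar>C\<bar> * (4 powr (\<Gamma> - \<gamma>) * norm (x - y) powr \<gamma>)"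
      using le by (intro mult_left_mono mult_right_mono) auto
    finally show "\<bar>u x - u y\<bar> \<le> \<bar>C\<bar> * 4 powr (\<Gamma> - \<gamma>) * norm (x - y) powr \<gamma>" by simp
  qed
qed

theorem theorem1p2:
  fixes s t p q \<alpha> A H :: real
    and a :: "real ^ 'd \<Rightarrow> real ^ 'd \<Rightarrow> real"
    and u :: "real ^ 'd \<Rightarrow> real"
  assumes "0 < s" "s \<le> t" "t < 1"
    and "2 \<le> p" "p \<le> q"
    and "0 < \<alpha>" "\<alpha> \<le> 1" "t * q \<le> s * p + \<alpha>"
    and "(\<lambda>(x, y). a x y) \<in> borel_measurable lebesgue"
    and "\<And>x y. a x y = a y x"
    and "\<And>x y z. a (x + z) (y + z) = a x y"
    and "\<And>x y. 0 \<le> a x y" "\<And>x y. a x y \<le> A"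
    and "\<And>x1 x2 y1 y2.
           \<bar>a x1 y1 - a x2 y2\<bar> \<le> H * (norm (x1 - x2) powr \<alpha> + norm (y1 - y2) powr \<alpha>)"
    and "visc_sol s t p q a (ball 0 2) u"
  shows "(\<forall>\<gamma>. 0 < \<gamma> \<longrightarrow> \<gamma> \<le> min 1 (min (s * p / (p - 1)) (t * q / (q - 1)))
               \<longrightarrow> holder_loc \<gamma> (ball 0 2) u) \<and>
         (s * p / (p - 1) = max (s * p / (p - 1)) (t * q / (q - 1)) \<and> s * p / (p - 1) < 1
               \<longrightarrow> holder_loc (s * p / (p - 1)) (ball 0 2) u)"
proof -
  define b where "b z = a 0 z" for z
  have p1: "0 < p - 1" "0 < q - 1" using assms(4,5) by auto
  have sp: "0 < s * p" "s * p < p" "0 < t * q" "t * q < q" using assms(1-5) by auto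
  have spq: "s * p < q" using sp(2) assms(5) by linarith
  have a_eq: "a x (x + z) = b z" for x z
    using assms(11) [of 0 x z] by (simp add: b_def add.commute)
  have b_even: "b (- z) = b z" for z
    using assms(11) [of 0 z "- z"] assms(10) [of z 0] by (simp add: b_def)
  have b_nonneg: "0 \<le> b z" and b_le: "b z \<le> A" for z
    using assms(12,13) by (auto simp: b_def)
  have b_holder: "\<bar>b z - b z'\<bar> \<le> \<bar>H\<bar> * norm (z - z') powr \<alpha>" for z z'
  proof -
    have "\<bar>b z - b z'\<bar> \<le> H * norm (z - z') powr \<alpha>" using assms(14) [of 0 z 0 z'] by (simp add: b_def)
    also have "\<dots> \<le> \<bar>H\<bar> * norm (z - z') powr \<alpha>" by (intro mult_right_mono) auto
    finally show ?thesis .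
  qed
  have A: "0 \<le> A" using b_nonneg b_le order_trans by blast
  have pos: "0 < s * p / (p - 1)" "0 < t * q / (q - 1)" using p1 sp by auto
  show ?thesis
  proof (cases "b 0 = 0")
    case True
    interpret double_phase_solution s t p q \<alpha> A "\<bar>H\<bar>" "s * p" "A + \<bar>H\<bar>" 0 1 a b u
    proof unfold_locales
      fix z :: "real ^ 'd" assume z: "norm z \<le> 1"
      show "b z * norm z powr (- (real DIM(real ^ 'd) + t * q)) \<le> (A + \<bar>H\<bar>) * norm z powr (- (real DIM(real ^ 'd) + s * p))"
      proof (cases "z = 0")
        case False
        have "b z \<le> \<bar>H\<bar> * norm z powr \<alpha>" using b_holder [of z 0] True b_nonneg [of z] by simp
        then have "b z * norm z powr (- (real DIM(real ^ 'd) + t * q)) \<le> \<bar>H\<bar> * norm z powr \<alpha> * norm z powr (- (real DIM(real ^ 'd) + t * q))"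
          by (intro mult_right_mono) auto
        also have "\<dots> = \<bar>H\<bar> * norm z powr (\<alpha> - (real DIM(real ^ 'd) + t * q))"
          unfolding mult.assoc powr_add [symmetric] by (simp only: diff_conv_add_uminus)
        also have "\<dots> \<le> \<bar>H\<bar> * norm z powr (- (real DIM(real ^ 'd) + s * p))"
          using z False assms(8) by (intro mult_left_mono powr_mono') auto
        also have "\<dots> \<le> (A + \<bar>H\<bar>) * norm z powr (- (real DIM(real ^ 'd) + s * p))"
          using A by (intro mult_right_mono) auto
        finally show ?thesis .
      qed simp
    qed (use assms(1-8,15) a_eq b_even b_nonneg b_le b_holder A sp spq in auto)
    have main: "holder_interior u (min 1 (s * p / (p - 1)))"
    proof (rule holder_interior_up_to)
      have "min 1 (s * p / (p - 1)) * (p - 1) \<le> s * p / (p - 1) * (p - 1)" using p1 by (intro mult_right_mono) auto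
      then show "min 1 (s * p / (p - 1)) * (p - 1) \<le> s * p" using p1 by simp
    qed (use pos in auto)
    show ?thesis
      using pos by (auto intro!: holder_loc_of_interior [OF main])
  next
    case False
    then have b0: "0 < b 0" using b_nonneg [of 0] by linarith
    \<comment> \<open>on this ball the Hoelder bound makes \<open>b\<close> drop by at most half of \<open>b 0\<close>\<close>
    define h0 where "h0 = (b 0 / (2 * (\<bar>H\<bar> + 1))) powr (1 / \<alpha>)"
    have h0: "0 < h0" using b0 by (simp add: h0_def)
    have h0_powr: "h0 powr \<alpha> = b 0 / (2 * (\<bar>H\<bar> + 1))"
      using b0 assms(6) by (simp add: h0_def powr_powr)
    interpret double_phase_solution s t p q \<alpha> A "\<bar>H\<bar>" "t * q" A "b 0 / 2" h0 a b u
    proof unfold_locales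
      fix z :: "real ^ 'd"
      show "b 0 / 2 \<le> b z" if "norm z \<le> h0"
      proof -
        have cancel: "c * (v / (2 * c)) = v / 2" if "c \<noteq> 0" for c v :: real using that by simp
        have "b 0 - b z \<le> \<bar>H\<bar> * norm z powr \<alpha>" using b_holder [of 0 z] by simp
        also have "\<dots> \<le> (\<bar>H\<bar> + 1) * h0 powr \<alpha>" using that assms(6) by (intro mult_mono powr_mono2) auto
        also have "\<dots> = b 0 / 2" unfolding h0_powr by (rule cancel) linarith
        finally show ?thesis by simp
      qed
      show "b z * norm z powr (- (real DIM(real ^ 'd) + t * q)) \<le> A * norm z powr (- (real DIM(real ^ 'd) + t * q))"
        using b_le [of z] by (intro mult_right_mono) auto
    qed (use assms(1-8,15) a_eq b_even b_nonneg b_le b_holder A sp h0 b0 in auto)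
    let ?\<Gamma> = "min 1 (min (s * p / (p - 1)) (t * q / (q - 1)))"
    have main: "holder_interior u ?\<Gamma>"
    proof (rule holder_interior_up_to)
      have "?\<Gamma> * (p - 1) \<le> s * p / (p - 1) * (p - 1)" using p1 by (intro mult_right_mono) auto
      then show "?\<Gamma> * (p - 1) \<le> s * p" using p1 by simp
      have "?\<Gamma> * (q - 1) \<le> t * q / (q - 1) * (q - 1)" using p1 by (intro mult_right_mono) auto
      then have "?\<Gamma> * (q - 1) \<le> t * q" using p1 by simp
      then show "t * q = s * p \<or> (0 < b 0 / 2 \<and> t * q = t * q \<and> ?\<Gamma> * (q - 1) \<le> t * q)" using b0 by simp
    qed (use pos in auto)
    have "holder_loc (s * p / (p - 1)) (ball 0 2) u"
      if "s * p / (p - 1) = max (s * p / (p - 1)) (t * q / (q - 1))" "s * p / (p - 1) < 1"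
    proof (rule holder_loc_of_interior)
      have "t * q / (q - 1) \<le> s * p / (p - 1)" using that(1) by (metis max.cobounded2)
      then show "holder_interior u (s * p / (p - 1))" using that b0 by (intro holder_interior_beyond) auto
    qed (use pos in auto)
    then show ?thesis
      using holder_loc_of_interior [OF main] by blast
  qed
qed

end
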